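(* Let $\bar\lambda=\langle\lambda_i: i<\kappa\rangle$ be a sequence of infinite regular cardinals, $I^*$ an ideal on $\kappa$ and $\theta$ a cardinal. Consider the condition $( * )$ either ($\alpha$) $\min_{i<\kappa}\lambda_i>\theta\ge \mathrm{wsat}(I^* )$, or ($\beta$) $\liminf_{I^*}(\bar\lambda)\ge\theta\ge\mathrm{wsat}(I^* )$ and $(\prod\bar\lambda,\le_{I^*})$ is $\theta^+$-directed. (1) If $( * )$ holds, then $I^*$ satisfies the weak pcf-th for $(\bar\lambda,\theta^+)$. (2) If $( * )$ holds and either $\prod\bar\lambda/I^*$ is $\theta^{++}$-directed (in particular, if $\theta^+<\min_{i<\kappa}\lambda_i$) or just there is a continuity condition for $(\theta^+,\theta)$, then $I^*$ satisfies the pcf-th for $(\bar\lambda,\theta^+)$. (3) (With no use of $( * )$.) If $I^*$ satisfies the pcf-th for $(\bar\lambda,\theta)$ then $I^*$ satisfies the weak pcf-th for $(\bar\lambda,\theta)$; this implies that $I^*$ satisfies the weaker pcf-th for $(\bar\lambda,\theta)$; and this implies that $I^*$ satisfies the weakest pcf-th for $(\bar\lambda,\theta)$.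
   Context: $\kappa$ is an infinite cardinal; $I^*$ is a proper ideal on $\kappa$; $\prod\bar\lambda=\prod_{i<\kappa}\lambda_i$. For an ideal $J$, $f<_J g$ means $\{i<\kappa:\neg f(i)<g(i)\}\in J$, similarly $\le_J$; for a filter use the dual ideal. $I+\mathcal X$ is the ideal generated by $I\cup\mathcal X$; $A\subseteq B\bmod J$ means $A\setminus B\in J$. For $B\subseteq\kappa$, $(\prod\bar\lambda\restriction B,<_J)$ is $\prod_{i\in B}\lambda_i$ ordered modulo $J\cap\mathcal P(B)$. $I^+=\mathcal P(\kappa)\setminus I$. A quasi-order $P$ is $\lambda$-directed if every subset of size $<\lambda$ has an upper bound; $P$ has true cofinality $\lambda$ if it has a strictly increasing cofinal sequence of length $\lambda$, and $\mathrm{tcf}(P)$ is the least such $\lambda$. $\liminf_{I}(\bar\lambda)=\min\{\mu:\{i<\kappa:\lambda_i\le\mu\}\in I^+\}$. $\mathrm{wsat}(I)$ is the least cardinal $\theta$ such that $\kappa$ cannot be partitioned into $\theta$ pairwise disjoint sets each in $I^+$. $\mathrm{pcf}(\bar\lambda)=\{\mathrm{tcf}(\prod\bar\lambda/D): D$ an ultrafilter on $\kappa$, $D\cap I^*=\emptyset\}$. $J_{<\lambda}[\bar\lambda]=\{B\subseteq\kappa:$ there is no ultrafilter $D$ on $\kappa$ with $D\cap I^*=\emptyset$, $B\in D$ and $\mathrm{tcf}(\prod\bar\lambda/D)\ge\lambda\}$ (a possibly improper ideal extending $I^*$); $J_{\le\lambda}[\bar\lambda]=J_{<\lambda^+}[\bar\lambda]$.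 Each of the following four properties of $I^*$ for $(\bar\lambda,\theta)$ includes: (i) $(\prod\bar\lambda,<_{I^*})$ is $\theta$-directed, and (ii) $(\prod\bar\lambda,<_{J_{<\lambda}[\bar\lambda]})$ is $\lambda$-directed for every cardinal $\lambda\ge\theta$. - The weakest pcf-th: just (i) and (ii). - The weaker pcf-th: (i), (ii), and for every ultrafilter $D$ on $\kappa$ disjoint to $J_{<\theta}[\bar\lambda]$, letting $\lambda=\mathrm{tcf}(\prod\bar\lambda,<_D)$, we have $\lambda\ge\theta$ and for some $B\in D\cap J_{\le\lambda}[\bar\lambda]\setminus J_{<\lambda}[\bar\lambda]$, $(\prod\bar\lambda\restriction B,<_{J_{<\lambda}[\bar\lambda]})$ has true cofinality $\lambda$. - The weak pcf-th: (i), (ii), and there are $B_{\mu,\alpha}\subseteq\kappa$ for $\alpha<\mu\in\mathrm{pcf}(\bar\lambda)$ such that: $\alpha<\beta<\mu\in\mathrm{pcf}(\bar\lambda)$ implies $B_{\mu,\alpha}\subseteq B_{\mu,\beta}\bmod J_{<\mu}[\bar\lambda]$; for every cardinal $\lambda$, $J_{<\lambda}[\bar\lambda]=I^*+\{B_{\mu,\alpha}:\alpha<\mu<\lambda,\ \mu\in\mathrm{pcf}(\bar\lambda)\}$; and $(\prod\bar\lambda\restriction B_{\mu,\alpha},<_{J_{<\mu}[\bar\lambda]})$ has true cofinality $\mu$. - The pcf-th: (i), (ii), and there is $\langle B_\lambda:\lambda\in\mathrm{pcf}(\bar\lambda)\rangle$, $B_\lambda\subseteq\kappa$, such that for every cardinal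 $\lambda$, $J_{<\lambda}[\bar\lambda]=I^*+\{B_\mu:\mu\in\lambda\cap\mathrm{pcf}(\bar\lambda)\}$, and for $\lambda\in\mathrm{pcf}(\bar\lambda)$, $B_\lambda\notin J_{<\lambda}[\bar\lambda]$ and $(\prod\bar\lambda\restriction B_\lambda,<_{J_{<\lambda}[\bar\lambda]})$ has true cofinality $\lambda$. Continuity condition: for a regular cardinal $\lambda>\theta$, a continuity condition for $(\lambda,\theta)$ is a sequence $\langle a_\alpha:\alpha<\lambda\rangle$ for which there is an unbounded $S\subseteq\lambda$, consisting of limit ordinals (or at least with no two successive members), such that: $a_\alpha\subseteq\alpha$; $\mathrm{otp}(a_\alpha)<\theta+1$; $\beta\in a_\alpha$ implies $a_\beta=a_\alpha\cap\beta$; and for every club $E$ of $\lambda$ there is $\delta\in S$ with $$\theta=\mathrm{otp}\{\alpha\in a_\delta:\ \mathrm{otp}(a_\alpha)<\theta\text{ and for no }\beta\in a_\delta\cap\alpha\text{ is }(\beta,\alpha)\cap E=\emptyset\}.$$ *)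

theory Defs
  imports Main "HOL-Library.FuncSet" "HOL-Library.Disjoint_Sets"
begin

unbundle cardinal_syntax

text \<open>
  Ordinals are well-order relations, compared by \<open>\<le>o\<close>, \<open><o\<close>, \<open>=o\<close>; cardinals are
  the relations satisfying \<^const>\<open>Card_order\<close>. The ordinals below the ordinal \<open>r\<close> are the
  elements of \<^term>\<open>Field r\<close>, and \<open>x < y\<close> among them is written \<open>x \<in> underS r y\<close>, so that
  \<open>underS r y\<close> also plays the role of the ordinal \<open>y\<close> itself.
\<close>

text \<open>
  The least cardinal with property \<open>P\<close>, among the cardinals carried by the type \<open>'b\<close>.
  If \<open>P\<close> is invariant under \<open>=o\<close>, the witnesses of \<open>SOME\<close> are exactly one
  \<open>=o\<close>-class, so equal (isomorphic) least cardinals are literally the same relation. Each use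
  below is at a type which carries a cardinal satisfying the given property.
\<close>

definition least_card :: "('b rel \<Rightarrow> bool) \<Rightarrow> 'b rel" where
  "least_card P =
     (SOME r. Card_order r \<and> P r \<and> (\<forall>s. Card_order s \<and> P s \<longrightarrow> r \<le>o s))"


section \<open>Ideals and ultrafilters on a set\<close>

definition ideal_on :: "'k set \<Rightarrow> 'k set set \<Rightarrow> bool" where
  "ideal_on K I \<longleftrightarrow> I \<subseteq> Pow K \<and> {} \<in> I \<and>
     (\<forall>A\<in>I. \<forall>B. B \<subseteq> A \<longrightarrow> B \<in> I) \<and> (\<forall>A\<in>I. \<forall>B\<in>I. A \<union> B \<in> I)"

definition proper_ideal_on :: "'k set \<Rightarrow> 'k set set \<Rightarrow> bool" where
  "proper_ideal_on K I \<longleftrightarrow> ideal_on K I \<and> K \<notin> I"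

definition ultrafilter_on :: "'k set \<Rightarrow> 'k set set \<Rightarrow> bool" where
  "ultrafilter_on K D \<longleftrightarrow> D \<subseteq> Pow K \<and> K \<in> D \<and> {} \<notin> D \<and>
     (\<forall>A\<in>D. \<forall>B. A \<subseteq> B \<and> B \<subseteq> K \<longrightarrow> B \<in> D) \<and> (\<forall>A\<in>D. \<forall>B\<in>D. A \<inter> B \<in> D) \<and>
     (\<forall>A. A \<subseteq> K \<longrightarrow> A \<in> D \<or> K - A \<in> D)"

definition dual_ideal :: "'k set \<Rightarrow> 'k set set \<Rightarrow> 'k set set" where
  "dual_ideal K D = {A. A \<subseteq> K \<and> K - A \<in> D}"

definition ideal_plus :: "'k set \<Rightarrow> 'k set set \<Rightarrow> 'k set set \<Rightarrow> 'k set set" where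
  "ideal_plus K I X = \<Inter>{J. ideal_on K J \<and> I \<union> X \<subseteq> J}"

definition positive_sets :: "'k set \<Rightarrow> 'k set set \<Rightarrow> 'k set set" where
  "positive_sets K I = Pow K - I"

text \<open>
  Zero is excluded, since a nonempty set never has a partition into zero pieces. The value is at
  most the successor of \<open>|K|\<close>, which for infinite \<open>K\<close> is carried by the type \<open>'k set\<close>.
\<close>

definition wsat :: "'k set \<Rightarrow> 'k set set \<Rightarrow> 'k set rel" where
  "wsat K I = least_card (\<lambda>r. r \<noteq> {} \<and>
     \<not> (\<exists>P. partition_on K P \<and> P \<subseteq> positive_sets K I \<and> |P| =o r))"

definition min_card :: "'k set \<Rightarrow> ('k \<Rightarrow> 'a rel) \<Rightarrow> 'a rel" where
  "min_card K lam = least_card (\<lambda>\<mu>. \<exists>i\<in>K. \<mu> =o lam i)"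

definition liminf_card :: "'k set \<Rightarrow> 'k set set \<Rightarrow> ('k \<Rightarrow> 'a rel) \<Rightarrow> 'a rel" where
  "liminf_card K I lam = least_card (\<lambda>\<mu>. {i\<in>K. lam i \<le>o \<mu>} \<in> positive_sets K I)"


section \<open>Directedness and true cofinality\<close>

definition directed_card :: "'c set \<Rightarrow> ('c \<Rightarrow> 'c \<Rightarrow> bool) \<Rightarrow> 'b rel \<Rightarrow> bool" where
  "directed_card A R r \<longleftrightarrow>
     (\<forall>X. X \<subseteq> A \<and> |X| <o r \<longrightarrow> (\<exists>g\<in>A. \<forall>f\<in>X. R f g))"

definition has_tcf :: "'c set \<Rightarrow> ('c \<Rightarrow> 'c \<Rightarrow> bool) \<Rightarrow> 'b rel \<Rightarrow> bool" where
  "has_tcf A R r \<longleftrightarrow>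
     (\<exists>p. (\<forall>\<alpha>\<in>Field r. p \<alpha> \<in> A) \<and>
          (\<forall>\<beta>\<in>Field r. \<forall>\<alpha>\<in>underS r \<beta>. R (p \<alpha>) (p \<beta>)) \<and>
          (\<forall>q\<in>A. \<exists>\<alpha>\<in>Field r. R q (p \<alpha>)))"

definition tcf :: "'c set \<Rightarrow> ('c \<Rightarrow> 'c \<Rightarrow> bool) \<Rightarrow> 'c rel" where
  "tcf A R = least_card (has_tcf A R)"


section \<open>Reduced products\<close>

definition card_prod :: "'k set \<Rightarrow> ('k \<Rightarrow> 'a rel) \<Rightarrow> ('k \<Rightarrow> 'a) set" where
  "card_prod B lam = Pi\<^sub>E B (\<lambda>i. Field (lam i))"

text \<open>
  The first argument is the index set of the product. If it is a subset \<open>B\<close> of the set on which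
  the ideal \<open>J\<close> lives, these are the orders modulo \<open>J \<inter> Pow B\<close>.
\<close>

definition less_mod ::
    "'k set \<Rightarrow> ('k \<Rightarrow> 'a rel) \<Rightarrow> 'k set set \<Rightarrow> ('k \<Rightarrow> 'a) \<Rightarrow> ('k \<Rightarrow> 'a) \<Rightarrow> bool" where
  "less_mod B lam J f g \<longleftrightarrow> {i\<in>B. \<not> f i \<in> underS (lam i) (g i)} \<in> J"

definition le_mod ::
    "'k set \<Rightarrow> ('k \<Rightarrow> 'a rel) \<Rightarrow> 'k set set \<Rightarrow> ('k \<Rightarrow> 'a) \<Rightarrow> ('k \<Rightarrow> 'a) \<Rightarrow> bool" where
  "le_mod B lam J f g \<longleftrightarrow> {i\<in>B. \<not> (f i, g i) \<in> lam i} \<in> J"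

definition tcf_ultra :: "'k set \<Rightarrow> ('k \<Rightarrow> 'a rel) \<Rightarrow> 'k set set \<Rightarrow> ('k \<Rightarrow> 'a) rel" where
  "tcf_ultra K lam D = tcf (card_prod K lam) (less_mod K lam (dual_ideal K D))"

definition pcf :: "'k set \<Rightarrow> 'k set set \<Rightarrow> ('k \<Rightarrow> 'a rel) \<Rightarrow> ('k \<Rightarrow> 'a) rel set" where
  "pcf K I lam = {tcf_ultra K lam D | D. ultrafilter_on K D \<and> D \<inter> I = {}}"

definition J_less ::
    "'k set \<Rightarrow> 'k set set \<Rightarrow> ('k \<Rightarrow> 'a rel) \<Rightarrow> 'b rel \<Rightarrow> 'k set set" where
  "J_less K I lam l = {B. B \<subseteq> K \<and>
     \<not> (\<exists>D. ultrafilter_on K D \<and> D \<inter> I = {} \<and> B \<in> D \<and> l \<le>o tcf_ultra K lam D)}"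

definition J_le ::
    "'k set \<Rightarrow> 'k set set \<Rightarrow> ('k \<Rightarrow> 'a rel) \<Rightarrow> 'b rel \<Rightarrow> 'k set set" where
  "J_le K I lam l = J_less K I lam (cardSuc l)"


section \<open>The four properties\<close>

text \<open>
  Below, ``every cardinal'' ranges over the cardinals carried by the type \<open>('k \<Rightarrow> 'a) set\<close>.
  These include the successor of the cardinality of the product, and from that cardinal on
  \<open>J_less\<close> is constantly \<open>Pow K\<close> and every member of \<open>pcf\<close> lies below, so larger cardinals
  impose no further condition.
\<close>

definition weakest_pcf_th ::
    "'k set \<Rightarrow> 'k set set \<Rightarrow> ('k \<Rightarrow> 'a rel) \<Rightarrow> 't rel \<Rightarrow> bool" where
  "weakest_pcf_th K I lam \<theta> \<longleftrightarrow>
     directed_card (card_prod K lam) (less_mod K lam I) \<theta> \<and>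
     (\<forall>l :: ('k \<Rightarrow> 'a) set rel. Card_order l \<and> \<theta> \<le>o l \<longrightarrow>
        directed_card (card_prod K lam) (less_mod K lam (J_less K I lam l)) l)"

definition weaker_pcf_th ::
    "'k set \<Rightarrow> 'k set set \<Rightarrow> ('k \<Rightarrow> 'a rel) \<Rightarrow> 't rel \<Rightarrow> bool" where
  "weaker_pcf_th K I lam \<theta> \<longleftrightarrow> weakest_pcf_th K I lam \<theta> \<and>
     (\<forall>D. ultrafilter_on K D \<and> D \<inter> J_less K I lam \<theta> = {} \<longrightarrow>
        (let l = tcf_ultra K lam D in
           \<theta> \<le>o l \<and>
           (\<exists>B \<in> D \<inter> J_le K I lam l - J_less K I lam l.
              has_tcf (card_prod B lam) (less_mod B lam (J_less K I lam l)) l)))"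

definition weak_pcf_th ::
    "'k set \<Rightarrow> 'k set set \<Rightarrow> ('k \<Rightarrow> 'a rel) \<Rightarrow> 't rel \<Rightarrow> bool" where
  "weak_pcf_th K I lam \<theta> \<longleftrightarrow> weakest_pcf_th K I lam \<theta> \<and>
     (\<exists>B :: ('k \<Rightarrow> 'a) rel \<Rightarrow> ('k \<Rightarrow> 'a) \<Rightarrow> 'k set.
        (\<forall>\<mu> \<in> pcf K I lam. \<forall>\<alpha> \<in> Field \<mu>. B \<mu> \<alpha> \<subseteq> K) \<and>
        (\<forall>\<mu> \<in> pcf K I lam. \<forall>\<beta> \<in> Field \<mu>. \<forall>\<alpha> \<in> underS \<mu> \<beta>.
           B \<mu> \<alpha> - B \<mu> \<beta> \<in> J_less K I lam \<mu>) \<and>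
        (\<forall>l :: ('k \<Rightarrow> 'a) set rel. Card_order l \<longrightarrow>
           J_less K I lam l =
             ideal_plus K I {B \<mu> \<alpha> | \<mu> \<alpha>. \<mu> \<in> pcf K I lam \<and> \<mu> <o l \<and> \<alpha> \<in> Field \<mu>}) \<and>
        (\<forall>\<mu> \<in> pcf K I lam. \<forall>\<alpha> \<in> Field \<mu>.
           has_tcf (card_prod (B \<mu> \<alpha>) lam) (less_mod (B \<mu> \<alpha>) lam (J_less K I lam \<mu>)) \<mu>))"

definition pcf_th ::
    "'k set \<Rightarrow> 'k set set \<Rightarrow> ('k \<Rightarrow> 'a rel) \<Rightarrow> 't rel \<Rightarrow> bool" where
  "pcf_th K I lam \<theta> \<longleftrightarrow> weakest_pcf_th K I lam \<theta> \<and>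
     (\<exists>B :: ('k \<Rightarrow> 'a) rel \<Rightarrow> 'k set.
        (\<forall>\<mu> \<in> pcf K I lam. B \<mu> \<subseteq> K) \<and>
        (\<forall>l :: ('k \<Rightarrow> 'a) set rel. Card_order l \<longrightarrow>
           J_less K I lam l = ideal_plus K I {B \<mu> | \<mu>. \<mu> \<in> pcf K I lam \<and> \<mu> <o l}) \<and>
        (\<forall>\<mu> \<in> pcf K I lam. B \<mu> \<notin> J_less K I lam \<mu> \<and>
           has_tcf (card_prod (B \<mu>) lam) (less_mod (B \<mu>) lam (J_less K I lam \<mu>)) \<mu>))"


section \<open>The continuity condition\<close>

definition club_in :: "'b rel \<Rightarrow> 'b set \<Rightarrow> bool" where
  "club_in r E \<longleftrightarrow> E \<subseteq> Field r \<and> cofinal E r \<and>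
     (\<forall>\<delta>\<in>Field r. underS r \<delta> \<noteq> {} \<and>
        (\<forall>\<alpha>\<in>underS r \<delta>. \<exists>\<beta>\<in>E \<inter> underS r \<delta>. \<alpha> \<in> underS r \<beta>) \<longrightarrow> \<delta> \<in> E)"

text \<open>
  The order type of \<open>A \<subseteq> Field r\<close> is \<open>Restr r A\<close>; being below \<open>\<theta> + 1\<close> is expressed as
  \<open>Restr r A \<le>o \<theta>\<close>. On \<open>S\<close> only the weaker of the two alternative requirements (limit
  ordinals, or at least no member of \<open>S\<close> is the immediate successor of another) is imposed.
\<close>

definition continuity_condition :: "'b rel \<Rightarrow> 't rel \<Rightarrow> ('b \<Rightarrow> 'b set) \<Rightarrow> bool" where
  "continuity_condition r \<theta> a \<longleftrightarrow>
     Cinfinite r \<and> regularCard r \<and> \<theta> <o r \<and>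
     (\<exists>S. S \<subseteq> Field r \<and> cofinal S r \<and>
        \<not> (\<exists>\<alpha>\<in>S. \<exists>\<beta>\<in>S. \<alpha> \<in> underS r \<beta> \<and> (\<forall>\<gamma>. \<not> (\<alpha> \<in> underS r \<gamma> \<and> \<gamma> \<in> underS r \<beta>))) \<and>
        (\<forall>\<alpha>\<in>Field r. a \<alpha> \<subseteq> underS r \<alpha> \<and> Restr r (a \<alpha>) \<le>o \<theta> \<and>
           (\<forall>\<beta>\<in>a \<alpha>. a \<beta> = a \<alpha> \<inter> underS r \<beta>)) \<and>
        (\<forall>E. club_in r E \<longrightarrow> (\<exists>\<delta>\<in>S. \<theta> =o Restr r
           {\<alpha> \<in> a \<delta>. Restr r (a \<alpha>) <o \<theta> \<and>
              \<not> (\<exists>\<beta> \<in> a \<delta> \<inter> underS r \<alpha>. {\<gamma>. \<beta> \<in> underS r \<gamma> \<and> \<gamma> \<in> underS r \<alpha>} \<inter> E = {})})))"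


section \<open>The hypothesis on the sequence, the ideal and the cardinal\<close>

definition star_condition ::
    "'k set \<Rightarrow> 'k set set \<Rightarrow> ('k \<Rightarrow> 'a rel) \<Rightarrow> 't rel \<Rightarrow> bool" where
  "star_condition K I lam \<theta> \<longleftrightarrow>
     (\<theta> <o min_card K lam \<and> wsat K I \<le>o \<theta>) \<or>
     (\<theta> \<le>o liminf_card K I lam \<and> wsat K I \<le>o \<theta> \<and>
      directed_card (card_prod K lam) (le_mod K lam I) (cardSuc \<theta>))"

end

theory Submission imports Defs begin

text \<open>
  Write \<open>J\<close> for \<open>J_less K I lam l\<close>. Both alternatives of the hypothesis yield small sets \<open>H i\<close> such
  that every \<open>\<epsilon> < \<theta>\<close> lies in \<open>H i\<close> for almost all \<open>i\<close>; taking the supremum at \<open>i\<close> only over the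
  indices in \<open>H i\<close>, one builds ladders of \<open>\<theta>\<close> functions that increase pointwise off
  sets of \<open>I\<close>. If each rung crossed a given function on a positive set, these sets would be almost
  disjoint, against \<open>wsat I \<le> \<theta>\<close>. This gives \<open>l\<close>-directedness modulo \<open>J\<close> and,
  for \<open>l\<close> in \<open>pcf\<close>, an increasing sequence \<open>f\<close> modulo \<open>J\<close> which is cofinal in every ultraproduct of
  cofinality \<open>l\<close>. If \<open>g\<close> bounds \<open>f\<close> modulo \<open>J_le K I lam l\<close>, the sets where \<open>g \<le> f \<alpha>\<close> are the generators of
  the weak pcf theorem. They can be replaced by a single one if there are at most \<open>l\<close> small partial maps
  which guess, for every challenge, the initial segments of a chain of length \<open>\<theta>\<close> meeting the challenge.
  Such families come from a continuity condition at \<open>\<theta>\<^sup>+\<close>, from partial squares at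
  \<open>\<theta>\<^sup>+\<^sup>+\<close>, and from club guessing on \<open>\<theta>\<^sup>+\<^sup>+\<close> at larger regular cardinals.
\<close>

section \<open>Well-orders and regular cardinals\<close>

text \<open>\<open>I\<close> is only an ideal, so \<theta> null sets must never be united. In every
  comparison of rungs \<zeta> < \<epsilon> the exceptional set may therefore depend on \<zeta>
  alone: it is cut out of rung \<zeta> once, and pairwise disjoint positive sets remain. This shapes
  both halves of the proof. In a ladder, rung \<epsilon> passes rung \<zeta> at the coordinates
  \<open>i\<close> with \<zeta> in \<open>H i\<close>. For generators, the suprema
  \<open>F s\<close> must be fixed before their bound \<open>g\<close>, hence before the chain, and
  cannot know which recorded positions the chain will use. So a guess delivers, besides the
  positions \<open>x \<zeta>\<close>, labels \<open>j \<zeta>\<close> in \<theta>, the same for all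
  \<epsilon>; the exceptional set consists of the \<open>i\<close> with \<open>j \<zeta>\<close>
  outside \<open>H i\<close>. The size restriction on a guessing family comes from \<open>g\<close>:
  it bounds all \<open>F s\<close> modulo an ideal whose order is directed for sets of size at most
  \<open>l\<close>. The least possible cofinality is \<open>\<theta>\<^sup>+\<close>. There the
  continuity condition supplies the guesses, and if the product is
  \<open>\<theta>\<^sup>+\<^sup>+\<close>-directed this cofinality does not occur.\<close>

lemma wo_le_trans:
  assumes "Well_order r" "(x, y) \<in> r" "(y, z) \<in> r"
  shows "(x, z) \<in> r"
  using wo_rel.TRANS[of r] assms unfolding wo_rel_def trans_def by blast

lemma wo_le_antisym:
  assumes "Well_order r" "(x, y) \<in> r" "(y, x) \<in> r"
  shows "x = y"
  using wo_rel.ANTISYM[of r] assms unfolding wo_rel_def antisym_def by blast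

lemma wo_le_refl:
  assumes "Well_order r" "x \<in> Field r"
  shows "(x, x) \<in> r"
  using wo_rel.REFL[of r] assms unfolding wo_rel_def refl_on_def by blast

lemma underS_le_trans:
  assumes r: "Well_order r" and xy: "x \<in> underS r y" and yz: "(y, z) \<in> r"
  shows "x \<in> underS r z"
proof -
  have "(x, y) \<in> r" "x \<noteq> y" using xy unfolding underS_def by auto
  then show ?thesis
    using wo_le_trans[OF r _ yz] wo_le_antisym[OF r _ yz] unfolding underS_def by blast
qed

lemma le_underS_trans:
  assumes r: "Well_order r" and xy: "(x, y) \<in> r" and yz: "y \<in> underS r z"
  shows "x \<in> underS r z"
proof -
  have "(y, z) \<in> r" "y \<noteq> z" using yz unfolding underS_def by auto
  then show ?thesis
    using wo_le_trans[OF r xy] wo_le_antisym[OF r xy] unfolding underS_def by blast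
qed

lemma underS_imp_le: "x \<in> underS r y \<Longrightarrow> (x, y) \<in> r"
  unfolding underS_def by blast

lemma underS_trans:
  assumes "Well_order r" "x \<in> underS r y" "y \<in> underS r z"
  shows "x \<in> underS r z"
  using underS_le_trans[OF assms(1,2) underS_imp_le[OF assms(3)]] .

lemma underS_Field_left: "x \<in> underS r y \<Longrightarrow> x \<in> Field r"
  unfolding underS_def Field_def by blast

lemma underS_Field_right: "x \<in> underS r y \<Longrightarrow> y \<in> Field r"
  unfolding underS_def Field_def by blast

lemma underS_irrefl: "x \<notin> underS r x"
  unfolding underS_def by blast

lemma underS_linear:
  assumes "Well_order r" "x \<in> Field r" "y \<in> Field r"
  shows "x \<in> underS r y \<or> x = y \<or> y \<in> underS r x"
  using wo_rel.TOTALS[of r] assms unfolding wo_rel_def underS_def by auto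

lemma not_underS_iff:
  assumes "Well_order r" "x \<in> Field r" "y \<in> Field r"
  shows "x \<notin> underS r y \<longleftrightarrow> (y, x) \<in> r"
  using underS_linear[OF assms] wo_le_refl[OF assms(1,2)] underS_irrefl[of x r]
    le_underS_trans[OF assms(1), of y x y] underS_imp_le[of y r x] underS_irrefl[of y r] by blast

lemma Card_order_imp_Well_order: "Card_order r \<Longrightarrow> Well_order r"
  by (simp add: card_order_on_well_order_on)

text \<open>All transfinite constructions below go through this rule. The recursion runs on
  \<open>r - Id\<close>, where the predecessors of \<open>x\<close> form \<open>underS r x\<close>;
  guarding the requirement with \<open>x \<in> Field r\<close> leaves nothing to do
  elsewhere.\<close>

lemma wo_choice:
  assumes r: "Well_order r"
    and adm: "\<And>f g x y. x \<in> Field r \<Longrightarrow> (\<And>z. z \<in> underS r x \<Longrightarrow> f z = g z) \<Longrightarrow> P f x y = P g x y"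
    and step: "\<And>f x. x \<in> Field r \<Longrightarrow> (\<And>y. y \<in> underS r x \<Longrightarrow> P f y (f y)) \<Longrightarrow> \<exists>y. P f x y"
  shows "\<exists>f. \<forall>x\<in>Field r. P f x (f x)"
proof -
  have wf: "wf (r - Id)" using r unfolding well_order_on_def by blast
  have iff: "(z, x) \<in> r - Id \<longleftrightarrow> z \<in> underS r x" for z x
    unfolding underS_def by blast
  have "\<exists>f. \<forall>x. x \<in> Field r \<longrightarrow> P f x (f x)"
  proof (rule dependent_wf_choice[OF wf, where P = "\<lambda>f x y. x \<in> Field r \<longrightarrow> P f x y"])
    fix f g :: "'a \<Rightarrow> 'b" and x y
    assume "\<And>z. (z, x) \<in> r - Id \<Longrightarrow> f z = g z"
    then show "(x \<in> Field r \<longrightarrow> P f x y) = (x \<in> Field r \<longrightarrow> P g x y)"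
      unfolding iff using adm by blast
  next
    fix x and f :: "'a \<Rightarrow> 'b"
    assume *: "\<And>y. (y, x) \<in> r - Id \<Longrightarrow> y \<in> Field r \<longrightarrow> P f y (f y)"
    show "\<exists>y. x \<in> Field r \<longrightarrow> P f x y"
    proof (cases "x \<in> Field r")
      case True
      have "P f y (f y)" if "y \<in> underS r x" for y
        using * that underS_Field_left[OF that] unfolding iff by blast
      then show ?thesis using step[OF True] by blast
    qed blast
  qed
  then show ?thesis by blast
qed

lemma least_in:
  assumes "Well_order r" "A \<subseteq> Field r" "A \<noteq> {}"
  obtains a where "a \<in> A" "\<And>b. b \<in> A \<Longrightarrow> (a, b) \<in> r"
proof -
  have "wo_rel r" using assms(1) by (simp add: wo_rel_def)
  then show ?thesis
    using that wo_rel.minim_in[of r A] wo_rel.minim_least[of r A] assms(2,3) by blast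
qed

lemma Cinfinite_limit:
  assumes "Cinfinite r" "x \<in> Field r"
  obtains y where "y \<in> Field r" "x \<in> underS r y"
proof -
  obtain y where "y \<in> Field r" "x \<noteq> y" "(x, y) \<in> r"
    using infinite_Card_order_limit[of r x] assms unfolding cinfinite_def by blast
  then show ?thesis using that unfolding underS_def by blast
qed

text \<open>\<open>A\<close> is too small to be cofinal, so some \<open>a\<close> has no member of
  \<open>A\<close> strictly above it. An infinite cardinal has no last element, and a point above
  \<open>a\<close> is a strict bound.\<close>

lemma regularCard_bound:
  assumes r: "Cinfinite r" "regularCard r" and A: "A \<subseteq> Field r" "|A| <o r"
  obtains x where "x \<in> Field r" "A \<subseteq> underS r x"
proof -
  have wo: "Well_order r" using r by (simp add: Card_order_imp_Well_order)
  have "\<not> cofinal A r"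
    using r A not_ordLess_ordIso unfolding regularCard_def by blast
  then obtain a where a: "a \<in> Field r" "\<And>b. b \<in> A \<Longrightarrow> \<not> (a \<noteq> b \<and> (a, b) \<in> r)"
    unfolding cofinal_def by blast
  obtain y where y: "y \<in> Field r" "a \<in> underS r y"
    using Cinfinite_limit[OF r(1) a(1)] by blast
  have "b \<in> underS r y" if "b \<in> A" for b
  proof -
    have "b \<in> Field r" using that A by blast
    then have "(b, a) \<in> r"
      using a that not_underS_iff[OF wo a(1), of b] unfolding underS_def by blast
    then show ?thesis using le_underS_trans[OF wo _ y(2)] by blast
  qed
  then show ?thesis using that y(1) by blast
qed

section \<open>Cardinal arithmetic below an infinite cardinal, and transfer of cardinals between
  types\<close>

lemma card_image_ordLess: "|A| <o r \<Longrightarrow> |f ` A| <o r"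
  by (rule ordLeq_ordLess_trans[OF card_of_image])

lemma card_image_ordLeq: "|A| \<le>o r \<Longrightarrow> |f ` A| \<le>o r"
  by (rule ordLeq_transitive[OF card_of_image])

lemma card_subset_ordLess: "A \<subseteq> B \<Longrightarrow> |B| <o r \<Longrightarrow> |A| <o r"
  by (rule ordLeq_ordLess_trans[OF card_of_mono1])

lemma card_Un_ordLess:
  assumes "Cinfinite r" "|A| <o r" "|B| <o r"
  shows "|A \<union> B| <o r"
  using card_of_Un_ordLess_infinite_Field[of r A B] assms unfolding cinfinite_def by blast

lemma card_finite_ordLess: "Cinfinite r \<Longrightarrow> finite A \<Longrightarrow> |A| <o r"
  using Cfinite_ordLess_Cinfinite[of "|A|" r] card_of_Card_order[of A]
  unfolding cfinite_def Field_card_of by blast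

lemma card_UN_ordLess:
  assumes "Cinfinite r" "regularCard r" "|A| <o r" "\<And>a. a \<in> A \<Longrightarrow> |F a| <o r"
  shows "|\<Union>a\<in>A. F a| <o r"
  using stable_UNION[OF regularCard_stable] assms unfolding cinfinite_def by blast

lemma card_of_Field_less: "Card_order s \<Longrightarrow> s <o r \<Longrightarrow> |Field s| <o r"
  by (rule ordIso_ordLess_trans[OF card_of_Field_ordIso])

lemma card_of_Field_leq: "Card_order s \<Longrightarrow> s \<le>o r \<Longrightarrow> |Field s| \<le>o r"
  by (rule ordIso_ordLeq_trans[OF card_of_Field_ordIso])

lemma leq_card_of_Field: "Card_order s \<Longrightarrow> r \<le>o s \<Longrightarrow> r \<le>o |Field s|"
  by (rule ordLeq_ordIso_trans[OF _ ordIso_symmetric[OF card_of_Field_ordIso]])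

lemma Card_order_trichotomy:
  assumes "Card_order r" "Card_order s"
  shows "r <o s \<or> s \<le>o r"
  by (rule ordLess_or_ordLeq[OF Card_order_imp_Well_order Card_order_imp_Well_order, OF assms])

text \<open>Regularity provides a value above the small set \<open>G f x\<close> at each stage. This
  yields rank functions, and increasing sequences that must in addition escape a challenge.\<close>

lemma regular_recursion:
  assumes s: "Well_order s" and r: "Cinfinite r" "regularCard r"
    and adm: "\<And>f g x. x \<in> Field s \<Longrightarrow> (\<And>z. z \<in> underS s x \<Longrightarrow> f z = g z) \<Longrightarrow> G f x = G g x"
    and G: "\<And>f x. x \<in> Field s \<Longrightarrow> (\<And>z. z \<in> underS s x \<Longrightarrow> f z \<in> Field r) \<Longrightarrow>
              G f x \<subseteq> Field r \<and> |G f x| <o r"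
  shows "\<exists>f. \<forall>x\<in>Field s. f x \<in> Field r \<and> G f x \<subseteq> underS r (f x)"
proof (rule wo_choice[OF s])
  fix f g :: "'a \<Rightarrow> 'b" and x y
  assume "x \<in> Field s" "\<And>z. z \<in> underS s x \<Longrightarrow> f z = g z"
  then show "(y \<in> Field r \<and> G f x \<subseteq> underS r y) = (y \<in> Field r \<and> G g x \<subseteq> underS r y)"
    using adm by metis
next
  fix f x
  assume x: "x \<in> Field s"
    and "\<And>y. y \<in> underS s x \<Longrightarrow> f y \<in> Field r \<and> G f y \<subseteq> underS r (f y)"
  then have "G f x \<subseteq> Field r \<and> |G f x| <o r" using G by blast
  then show "\<exists>y. y \<in> Field r \<and> G f x \<subseteq> underS r y"
    using regularCard_bound[OF r] by metis
qed

text \<open>Cardinals on different types are compared only up to \<open>=o\<close>; this gives a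
  copy on the type over which a definition quantifies.\<close>

lemma card_leq_obtain:
  assumes "r \<le>o |UNIV :: 'b set|" "Card_order r"
  obtains B :: "'b set" where "|B| =o r"
proof -
  have "|Field r| \<le>o |UNIV :: 'b set|" by (rule card_of_Field_leq[OF assms(2,1)])
  then obtain B :: "'b set" where "|Field r| =o |B|"
    unfolding internalize_card_of_ordLeq2[of "Field r" UNIV] by (elim exE conjE)
  from this(1) have "|B| =o r"
    by (rule ordIso_transitive[OF ordIso_symmetric card_of_Field_ordIso[OF assms(2)]])
  then show ?thesis using that by blast
qed

lemma surj_indexed:
  assumes "|A| \<le>o r" "Card_order r" "A \<noteq> {}"
  obtains f where "f ` Field r = A"
proof -
  have "|A| \<le>o |Field r|" by (rule leq_card_of_Field[OF assms(2,1)])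
  then obtain f where "f ` Field r = A"
    unfolding card_of_ordLeq2[OF assms(3), symmetric] by (elim exE)
  then show ?thesis by (rule that)
qed

lemma inj_indexed:
  assumes "|A| \<le>o r" "Card_order r"
  obtains f where "inj_on f A" "f ` A \<subseteq> Field r"
proof -
  have "|A| \<le>o |Field r|" by (rule leq_card_of_Field[OF assms(2,1)])
  then obtain f where "inj_on f A" "f ` A \<subseteq> Field r"
    unfolding card_of_ordLeq[of A "Field r", symmetric] by (elim exE conjE)
  then show ?thesis using that by blast
qed


section \<open>Least cardinals and prime ideals\<close>

lemma least_card_props:
  fixes P :: "'b rel \<Rightarrow> bool"
  assumes "Card_order r" "P r"
  shows "Card_order (least_card P)" "P (least_card P)"
    "\<And>s. Card_order s \<Longrightarrow> P s \<Longrightarrow> least_card P \<le>o s"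
proof -
  let ?Q = "\<lambda>r. Card_order r \<and> P r \<and> (\<forall>s. Card_order s \<and> P s \<longrightarrow> r \<le>o s)"
  have "{r. Card_order r \<and> P r} \<noteq> {}" using assms by blast
  from exists_minim_Card_order[OF this]
  have "\<exists>r. ?Q r" by simp
  then have "?Q (least_card P)" unfolding least_card_def by (rule someI_ex)
  then show "Card_order (least_card P)" "P (least_card P)"
    "\<And>s. Card_order s \<Longrightarrow> P s \<Longrightarrow> least_card P \<le>o s" by blast+
qed

text \<open>By \<open>char\<close> the predicate under \<open>SOME\<close> describes exactly the
  \<open>=o\<close>-class of the least cardinal, so both choices are made from the same class.
  Literal equality matters because members of \<open>pcf\<close> index the generators.\<close>

lemma least_card_eq:
  fixes P Q :: "'b rel \<Rightarrow> bool"
  assumes r: "Card_order r" "P r" and s: "Card_order s" "Q s"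
    and P: "\<And>r s. r =o s \<Longrightarrow> P r \<Longrightarrow> P s" and Q: "\<And>r s. r =o s \<Longrightarrow> Q r \<Longrightarrow> Q s"
    and eq: "least_card P =o least_card Q"
  shows "least_card P = least_card Q"
proof -
  note lP = least_card_props[of r P, OF r] and lQ = least_card_props[of s Q, OF s]
  have char: "(Card_order r \<and> R r \<and> (\<forall>s. Card_order s \<and> R s \<longrightarrow> r \<le>o s)) \<longleftrightarrow> r =o least_card R"
    if l: "Card_order (least_card R)" "R (least_card R)"
        "\<And>s. Card_order s \<Longrightarrow> R s \<Longrightarrow> least_card R \<le>o s"
      and R: "\<And>r s. r =o s \<Longrightarrow> R r \<Longrightarrow> R s" for R :: "'b rel \<Rightarrow> bool" and r
  proof
    assume "Card_order r \<and> R r \<and> (\<forall>s. Card_order s \<and> R s \<longrightarrow> r \<le>o s)"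
    then show "r =o least_card R" using l ordIso_iff_ordLeq[of r "least_card R"] by blast
  next
    assume r: "r =o least_card R"
    then show "Card_order r \<and> R r \<and> (\<forall>s. Card_order s \<and> R s \<longrightarrow> r \<le>o s)"
      using l(3) R[OF ordIso_symmetric[OF r] l(2)] Card_order_ordIso[OF l(1) r]
        ordIso_ordLeq_trans[OF r] by blast
  qed
  have "(r =o least_card P) = (r =o least_card Q)" for r :: "'b rel"
    using ordIso_transitive[OF _ eq] ordIso_transitive[OF _ ordIso_symmetric[OF eq]] by blast
  then have "(SOME r :: 'b rel. r =o least_card P) = (SOME r :: 'b rel. r =o least_card Q)" by simp
  moreover have "(SOME r :: 'b rel. r =o least_card P) = least_card P"
    by (subst (2) least_card_def) (simp only: char[of P, OF lP P])
  moreover have "(SOME r :: 'b rel. r =o least_card Q) = least_card Q"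
    by (subst (2) least_card_def) (simp only: char[of Q, OF lQ Q])
  ultimately show ?thesis by simp
qed

text \<open>Zorn's lemma gives an ideal maximal among those that contain \<open>J\<close> and omit
  \<open>A\<close>. It is prime: if \<open>X\<close> and \<open>K - X\<close> were both outside,
  adjoining either one would capture \<open>A\<close>, and \<open>A\<close> would be covered by two
  members. The ultrafilter is its complement.\<close>

lemma prime_ideal_exists:
  assumes J: "ideal_on K J" and A: "A \<subseteq> K" "A \<notin> J"
  obtains D where "ultrafilter_on K D" "A \<in> D" "D \<inter> J = {}"
proof -
  let ?S = "{M. ideal_on K M \<and> J \<subseteq> M \<and> A \<notin> M}"
  have ne: "?S \<noteq> {}" using J A by blast
  have chain: "\<Union>C \<in> ?S" if C: "C \<noteq> {}" "subset.chain ?S C" for C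
  proof -
    have CS: "\<And>M. M \<in> C \<Longrightarrow> ideal_on K M \<and> J \<subseteq> M \<and> A \<notin> M"
      and lin: "\<And>M N. M \<in> C \<Longrightarrow> N \<in> C \<Longrightarrow> M \<subseteq> N \<or> N \<subseteq> M"
      using C(2) unfolding subset.chain_def by blast+
    have un: "X \<union> Y \<in> \<Union>C" if XY: "X \<in> \<Union>C" "Y \<in> \<Union>C" for X Y
    proof -
      obtain M N where MN: "M \<in> C" "X \<in> M" "N \<in> C" "Y \<in> N" using XY by blast
      have "\<exists>L\<in>C. X \<in> L \<and> Y \<in> L" using lin[OF MN(1,3)] MN by blast
      then show ?thesis using CS unfolding ideal_on_def by blast
    qed
    have "ideal_on K (\<Union>C)"
      unfolding ideal_on_def
    proof (intro conjI ballI allI impI)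
      show "\<Union>C \<subseteq> Pow K" using CS unfolding ideal_on_def by blast
      show "{} \<in> \<Union>C" using C(1) CS unfolding ideal_on_def by blast
    next
      fix X Y assume "X \<in> \<Union>C" "Y \<subseteq> X"
      then show "Y \<in> \<Union>C" using CS unfolding ideal_on_def by blast
    qed (rule un)
    then show ?thesis using CS C(1) by blast
  qed
  obtain M where M: "ideal_on K M" "J \<subseteq> M" "A \<notin> M"
    and max: "\<And>N. ideal_on K N \<Longrightarrow> J \<subseteq> N \<Longrightarrow> A \<notin> N \<Longrightarrow> M \<subseteq> N \<Longrightarrow> N = M"
    using subset_Zorn_nonempty[OF ne chain] by auto
  have down: "\<And>X Y. X \<in> M \<Longrightarrow> Y \<subseteq> X \<Longrightarrow> Y \<in> M"
    and un: "\<And>X Y. X \<in> M \<Longrightarrow> Y \<in> M \<Longrightarrow> X \<union> Y \<in> M"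
    and sub: "\<And>X. X \<in> M \<Longrightarrow> X \<subseteq> K" and emp: "{} \<in> M"
    using M(1) unfolding ideal_on_def by blast+
  have ext: "\<exists>m\<in>M. A \<subseteq> m \<union> X" if X: "X \<subseteq> K" "X \<notin> M" for X
  proof (rule ccontr)
    assume no: "\<not> (\<exists>m\<in>M. A \<subseteq> m \<union> X)"
    let ?N = "{Y. Y \<subseteq> K \<and> (\<exists>m\<in>M. Y \<subseteq> m \<union> X)}"
    have "ideal_on K ?N"
      unfolding ideal_on_def
    proof (intro conjI ballI allI impI)
      show "?N \<subseteq> Pow K" "{} \<in> ?N" using emp by blast+
    next
      fix Y Z assume "Y \<in> ?N" "Z \<subseteq> Y"
      then show "Z \<in> ?N" by blast
    next
      fix Y Z assume "Y \<in> ?N" "Z \<in> ?N"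
      then obtain m n where "m \<in> M" "n \<in> M" "Y \<subseteq> m \<union> X" "Z \<subseteq> n \<union> X" "Y \<subseteq> K" "Z \<subseteq> K" by blast
      then show "Y \<union> Z \<in> ?N" using un[of m n] by blast
    qed
    moreover have "M \<subseteq> ?N" using sub by blast
    ultimately have "?N = M" using max[of ?N] M(2) no by blast
    moreover have "X \<in> ?N" using X(1) emp by blast
    ultimately show False using X(2) by blast
  qed
  have KM: "K \<notin> M" using down[of K A] A(1) M(3) by blast
  have prime: "X \<in> M \<or> K - X \<in> M" if X: "X \<subseteq> K" for X
  proof (rule ccontr)
    assume "\<not> (X \<in> M \<or> K - X \<in> M)"
    then obtain m n where mn: "m \<in> M" "A \<subseteq> m \<union> X" "n \<in> M" "A \<subseteq> n \<union> (K - X)"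
      using ext[of X] ext[of "K - X"] X by blast
    then have "A \<subseteq> m \<union> n" by blast
    then show False using down[OF un[OF mn(1,3)]] M(3) by blast
  qed
  have "ultrafilter_on K (Pow K - M)"
    unfolding ultrafilter_on_def
  proof (intro conjI ballI allI impI)
    show "Pow K - M \<subseteq> Pow K" "K \<in> Pow K - M" "{} \<notin> Pow K - M" using KM emp by blast+
  next
    fix X Y assume "X \<in> Pow K - M" "X \<subseteq> Y \<and> Y \<subseteq> K"
    then show "Y \<in> Pow K - M" using down[of Y X] by blast
  next
    fix X Y assume XY: "X \<in> Pow K - M" "Y \<in> Pow K - M"
    have "X \<inter> Y \<notin> M"
    proof
      assume a: "X \<inter> Y \<in> M"
      have "K - X \<in> M" "K - Y \<in> M" using prime[of X] prime[of Y] XY by blast+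
      then have "(K - X) \<union> (K - Y) \<union> (X \<inter> Y) \<in> M" using un a by simp
      moreover have "K \<subseteq> (K - X) \<union> (K - Y) \<union> (X \<inter> Y)" by blast
      ultimately show False using KM down by simp
    qed
    then show "X \<inter> Y \<in> Pow K - M" using XY by blast
  next
    fix X assume X: "X \<subseteq> K"
    have "\<not> (X \<in> M \<and> K - X \<in> M)"
    proof
      assume "X \<in> M \<and> K - X \<in> M"
      then have "X \<union> (K - X) \<in> M" using un[of X "K - X"] by blast
      then show False using KM down[of "X \<union> (K - X)" K] by blast
    qed
    then show "X \<in> Pow K - M \<or> K - X \<in> Pow K - M" using X by blast
  qed
  moreover have "A \<in> Pow K - M" using A M(3) by simp
  moreover have "(Pow K - M) \<inter> J = {}" using M(2) by blast
  ultimately show ?thesis by (rule that)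
qed


section \<open>Reduced products of regular cardinals\<close>

locale reduced_product =
  fixes K :: "'k set" and lam :: "'k \<Rightarrow> 'a rel" and I :: "'k set set"
  assumes lam: "\<And>i. i \<in> K \<Longrightarrow> Cinfinite (lam i) \<and> regularCard (lam i)"
    and ideal: "proper_ideal_on K I"
begin

abbreviation P :: "('k \<Rightarrow> 'a) set" where "P \<equiv> card_prod K lam"

section \<open>Comparison sets and coordinatewise bounds in the product\<close>

definition LE :: "('k \<Rightarrow> 'a) \<Rightarrow> ('k \<Rightarrow> 'a) \<Rightarrow> 'k set" where
  "LE f g = {i\<in>K. (f i, g i) \<in> lam i}"

definition LT :: "('k \<Rightarrow> 'a) \<Rightarrow> ('k \<Rightarrow> 'a) \<Rightarrow> 'k set" where
  "LT f g = {i\<in>K. f i \<in> underS (lam i) (g i)}"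

definition U :: "'k set set set" where
  "U = {D. ultrafilter_on K D \<and> D \<inter> I = {}}"

lemma lam_wo: "i \<in> K \<Longrightarrow> Well_order (lam i)"
  using lam Card_order_imp_Well_order by blast

lemma P_Field: "f \<in> P \<Longrightarrow> i \<in> K \<Longrightarrow> f i \<in> Field (lam i)"
  using PiE_mem[of f K "\<lambda>i. Field (lam i)" i] unfolding card_prod_def by blast

lemma LE_sub: "LE f g \<subseteq> K" and LT_sub: "LT f g \<subseteq> K"
  unfolding LE_def LT_def by blast+

lemma LT_sub_LE: "LT f g \<subseteq> LE f g"
  unfolding LE_def LT_def underS_def by blast

lemma LE_trans: "LE f g \<inter> LE g h \<subseteq> LE f h"
  unfolding LE_def using wo_le_trans[OF lam_wo] by blast

lemma LT_LE_trans: "LT f g \<inter> LE g h \<subseteq> LT f h"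
  unfolding LE_def LT_def using underS_le_trans[OF lam_wo] by blast

lemma LE_LT_trans: "LE f g \<inter> LT g h \<subseteq> LT f h"
  unfolding LE_def LT_def using le_underS_trans[OF lam_wo] by blast

lemma LT_compl: assumes "f \<in> P" "g \<in> P" shows "K - LT f g = LE g f"
  unfolding LE_def LT_def using not_underS_iff[OF lam_wo P_Field P_Field] assms by blast

lemma LE_compl: assumes "f \<in> P" "g \<in> P" shows "K - LE f g = LT g f"
  using LT_compl[OF assms(2,1)] LT_sub by blast

lemma LT_LE_disjoint: assumes "f \<in> P" "g \<in> P" shows "LT f g \<inter> LE g f = {}"
  using LT_compl[OF assms] by blast

text \<open>The coordinates are linearly ordered, so \<open>f < g\<close> fails exactly where
  \<open>g \<le> f\<close>. Strict inequality modulo an ideal is used below only in the form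
  \<open>LE g f \<in> J\<close>.\<close>

lemma less_mod_iff:
  assumes "f \<in> P" "g \<in> P"
  shows "less_mod K lam J f g \<longleftrightarrow> LE g f \<in> J"
proof -
  have "{i\<in>K. f i \<notin> underS (lam i) (g i)} = K - LT f g" unfolding LT_def by blast
  then show ?thesis unfolding less_mod_def LT_compl[OF assms] by simp
qed

lemma le_mod_iff:
  assumes "f \<in> P" "g \<in> P"
  shows "le_mod K lam J f g \<longleftrightarrow> LT g f \<in> J"
proof -
  have "{i\<in>K. (f i, g i) \<notin> lam i} = K - LE f g" unfolding LE_def by blast
  then show ?thesis unfolding le_mod_def LE_compl[OF assms] by simp
qed

lemma P_choice:
  assumes "\<And>i. i \<in> K \<Longrightarrow> \<exists>x\<in>Field (lam i). Q i x"
  obtains f where "f \<in> P" "\<And>i. i \<in> K \<Longrightarrow> Q i (f i)"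
proof -
  have "\<exists>f. \<forall>i\<in>K. f i \<in> Field (lam i) \<and> Q i (f i)"
    by (rule bchoice) (use assms in blast)
  then obtain f where "\<forall>i\<in>K. f i \<in> Field (lam i) \<and> Q i (f i)" ..
  then show ?thesis using that[of "restrict f K"] unfolding card_prod_def by auto
qed

text \<open>Regularity is applied in each factor separately, so the sets may vary with
  \<open>i\<close>; this is what the sets \<open>H i\<close> exploit later.\<close>

lemma P_bound:
  assumes "\<And>i. i \<in> K \<Longrightarrow> A i \<subseteq> Field (lam i) \<and> |A i| <o lam i"
  obtains f where "f \<in> P" "\<And>i. i \<in> K \<Longrightarrow> A i \<subseteq> underS (lam i) (f i)"
proof (rule P_choice)
  fix i assume i: "i \<in> K"
  show "\<exists>x\<in>Field (lam i). A i \<subseteq> underS (lam i) x"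
    using regularCard_bound[of "lam i" "A i"] lam[OF i] assms[OF i] by metis
qed (rule that)

lemma P_finite_bound:
  assumes "finite X" "X \<subseteq> P"
  obtains g where "g \<in> P" "\<And>f. f \<in> X \<Longrightarrow> LT f g = K"
proof -
  obtain g where g: "g \<in> P" "\<And>i. i \<in> K \<Longrightarrow> (\<lambda>f. f i) ` X \<subseteq> underS (lam i) (g i)"
  proof (rule P_bound[where A = "\<lambda>i. (\<lambda>f. f i) ` X"])
    fix i assume i: "i \<in> K"
    show "(\<lambda>f. f i) ` X \<subseteq> Field (lam i) \<and> |(\<lambda>f. f i) ` X| <o lam i"
    proof
      show "(\<lambda>f. f i) ` X \<subseteq> Field (lam i)"
        by (rule image_subsetI, rule P_Field[OF _ i], rule subsetD[OF assms(2)])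
      show "|(\<lambda>f. f i) ` X| <o lam i"
        by (rule card_finite_ordLess[OF conjunct1[OF lam[OF i]]], rule finite_imageI, rule assms(1))
    qed
  qed (rule that)
  show ?thesis
  proof (rule that[OF g(1)])
    fix f assume "f \<in> X"
    then show "LT f g = K" using g(2) unfolding LT_def by blast
  qed
qed

lemma P_nonempty: "P \<noteq> {}"
proof -
  obtain g where "g \<in> P" by (rule P_finite_bound[of "{}"]) simp_all
  then show ?thesis by blast
qed

lemma P_above:
  assumes "g \<in> P" obtains h where "h \<in> P" "LT g h = K"
  by (rule P_finite_bound[of "{g}"]) (use assms in simp_all)

section \<open>Ideals on the index set and the ultrafilters disjoint from \<open>I\<close>\<close>

lemma I_ideal: "ideal_on K I" and K_notin_I: "K \<notin> I"
  using ideal unfolding proper_ideal_on_def by auto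

lemma ideal_down: "ideal_on K J \<Longrightarrow> A \<in> J \<Longrightarrow> B \<subseteq> A \<Longrightarrow> B \<in> J"
  unfolding ideal_on_def by simp

lemma ideal_Un: "ideal_on K J \<Longrightarrow> A \<in> J \<Longrightarrow> B \<in> J \<Longrightarrow> A \<union> B \<in> J"
  unfolding ideal_on_def by simp

lemma ideal_sub: "ideal_on K J \<Longrightarrow> A \<in> J \<Longrightarrow> A \<subseteq> K"
  unfolding ideal_on_def by blast

lemma ideal_empty: "ideal_on K J \<Longrightarrow> {} \<in> J"
  unfolding ideal_on_def by blast

lemma ideal_cover: "ideal_on K J \<Longrightarrow> A \<in> J \<Longrightarrow> B \<in> J \<Longrightarrow> C \<subseteq> A \<union> B \<Longrightarrow> C \<in> J"
  by (rule ideal_down[OF _ ideal_Un])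

lemma U_props:
  assumes "D \<in> U"
  shows U_sub: "\<And>A. A \<in> D \<Longrightarrow> A \<subseteq> K"
    and U_K: "K \<in> D" and U_empty: "{} \<notin> D"
    and U_up: "\<And>A B. A \<in> D \<Longrightarrow> A \<subseteq> B \<Longrightarrow> B \<subseteq> K \<Longrightarrow> B \<in> D"
    and U_Int: "\<And>A B. A \<in> D \<Longrightarrow> B \<in> D \<Longrightarrow> A \<inter> B \<in> D"
    and U_cases: "\<And>A. A \<subseteq> K \<Longrightarrow> A \<in> D \<or> K - A \<in> D"
    and U_I: "\<And>A. A \<in> D \<Longrightarrow> A \<notin> I"
  using assms unfolding U_def ultrafilter_on_def by blast+

lemma U_compl:
  assumes D: "D \<in> U" and A: "A \<subseteq> K"
  shows "K - A \<in> D \<longleftrightarrow> A \<notin> D"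
proof -
  have "\<not> (A \<in> D \<and> K - A \<in> D)"
  proof
    assume "A \<in> D \<and> K - A \<in> D"
    then have "A \<inter> (K - A) \<in> D" using U_Int[OF D] by blast
    then show False using U_empty[OF D] by simp
  qed
  then show ?thesis using U_cases[OF D A] by blast
qed

lemma U_meet:
  assumes D: "D \<in> U" and "A \<in> D" "B \<in> D" "A \<inter> B \<subseteq> C" "C \<subseteq> K"
  shows "C \<in> D"
  by (rule U_up[OF D U_Int[OF D assms(2,3)] assms(4,5)])

lemma U_Un:
  assumes D: "D \<in> U" and "A \<subseteq> K" "B \<subseteq> K" "A \<union> B \<in> D"
  shows "A \<in> D \<or> B \<in> D"
proof (rule ccontr)
  assume "\<not> (A \<in> D \<or> B \<in> D)"
  then have "K - A \<in> D" "K - B \<in> D" using U_compl[OF D] assms by blast+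
  then have "(K - A) \<inter> (K - B) \<in> D" using U_Int[OF D] by blast
  moreover have "(K - A) \<inter> (K - B) = K - (A \<union> B)" by blast
  ultimately show False using U_compl[OF D, of "A \<union> B"] assms by simp
qed

lemma U_LT: "D \<in> U \<Longrightarrow> f \<in> P \<Longrightarrow> g \<in> P \<Longrightarrow> LT f g \<notin> D \<longleftrightarrow> LE g f \<in> D"
  using U_compl[of D "LT f g"] LT_sub by (simp add: LT_compl)

lemma U_disj: "D \<in> U \<Longrightarrow> A \<in> D \<Longrightarrow> B \<in> D \<Longrightarrow> A \<inter> B \<noteq> {}"
  using U_Int[of D A B] U_empty[of D] by auto

lemma exists_U:
  assumes J: "ideal_on K J" "I \<subseteq> J" and A: "A \<subseteq> K" "A \<notin> J"
  obtains D where "D \<in> U" "A \<in> D" "D \<inter> J = {}"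
proof -
  obtain D where D: "ultrafilter_on K D" "A \<in> D" "D \<inter> J = {}"
    by (rule prime_ideal_exists[OF J(1) A])
  show ?thesis by (rule that[OF _ D(2,3)]) (use D(1,3) J(2) in \<open>auto simp: U_def\<close>)
qed

lemma less_mod_dual: "less_mod K lam (dual_ideal K D) f g \<longleftrightarrow> LT f g \<in> D"
proof -
  have "K - {i\<in>K. f i \<notin> underS (lam i) (g i)} = LT f g" unfolding LT_def by blast
  then show ?thesis unfolding less_mod_def dual_ideal_def by auto
qed


subsection \<open>True cofinalities of ultraproducts\<close>

abbreviation tcfU :: "'k set set \<Rightarrow> ('k \<Rightarrow> 'a) rel" where
  "tcfU \<equiv> tcf_ultra K lam"

definition cof_in :: "'k set set \<Rightarrow> ('k \<Rightarrow> 'a) set \<Rightarrow> bool" where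
  "cof_in D X \<longleftrightarrow> X \<subseteq> P \<and> (\<forall>q\<in>P. \<exists>f\<in>X. LE q f \<in> D)"

lemma has_tcf_D_iff:
  "has_tcf P (less_mod K lam (dual_ideal K D)) r \<longleftrightarrow>
    (\<exists>p. (\<forall>\<alpha>\<in>Field r. p \<alpha> \<in> P) \<and> (\<forall>\<beta>\<in>Field r. \<forall>\<alpha>\<in>underS r \<beta>. LT (p \<alpha>) (p \<beta>) \<in> D) \<and>
      (\<forall>q\<in>P. \<exists>\<alpha>\<in>Field r. LT q (p \<alpha>) \<in> D))"
  unfolding has_tcf_def less_mod_dual ..

lemma has_tcf_cof_in:
  assumes D: "D \<in> U" and "has_tcf P (less_mod K lam (dual_ideal K D)) r"
  obtains X where "cof_in D X" "|X| \<le>o |Field r|"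
proof -
  obtain p where p: "\<forall>\<alpha>\<in>Field r. p \<alpha> \<in> P" "\<forall>q\<in>P. \<exists>\<alpha>\<in>Field r. LT q (p \<alpha>) \<in> D"
    using assms(2) unfolding has_tcf_D_iff by blast
  have "cof_in D (p ` Field r)"
    unfolding cof_in_def
  proof (intro conjI ballI)
    show "p ` Field r \<subseteq> P" using p(1) by blast
  next
    fix q assume "q \<in> P"
    then obtain \<alpha> where "\<alpha> \<in> Field r" "LT q (p \<alpha>) \<in> D" using p(2) by blast
    then show "\<exists>f\<in>p ` Field r. LE q f \<in> D" using U_up[OF D _ LT_sub_LE LE_sub] by blast
  qed
  then show ?thesis using that card_of_image by blast
qed

lemma not_cof_in_bound:
  assumes D: "D \<in> U" and X: "X \<subseteq> P" "\<not> cof_in D X"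
  obtains g where "g \<in> P" "\<And>f. f \<in> X \<Longrightarrow> LT f g \<in> D"
proof -
  obtain g where g: "g \<in> P" "\<And>f. f \<in> X \<Longrightarrow> LE g f \<notin> D"
    using X unfolding cof_in_def by blast
  show ?thesis
  proof (rule that[OF g(1)])
    fix f assume "f \<in> X"
    then show "LT f g \<in> D" using g U_LT[OF D] X(1) by blast
  qed
qed

text \<open>Take a cofinal set \<open>X\<close> of least size; every smaller set is then bounded
  modulo \<open>D\<close>. The well-order \<open>|X|\<close> serves as index set: \<open>p x\<close>
  is placed above \<open>x\<close>, for cofinality, and above all earlier values, for monotonicity.
  A finite \<open>X\<close> is impossible, as it has a strict bound at every coordinate.\<close>

lemma tcf_exists:
  assumes D: "D \<in> U"
  obtains X where "cof_in D X" "\<And>Y. cof_in D Y \<Longrightarrow> |X| \<le>o |Y|" "infinite X"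
    "has_tcf P (less_mod K lam (dual_ideal K D)) |X|"
proof -
  have "cof_in D P"
    unfolding cof_in_def
  proof (intro conjI ballI subset_refl)
    fix q assume q: "q \<in> P"
    have "LE q q = K" unfolding LE_def using wo_le_refl[OF lam_wo P_Field[OF q]] by blast
    then show "\<exists>f\<in>P. LE q f \<in> D" using q U_K[OF D] by metis
  qed
  then have "card_of ` {X. cof_in D X} \<noteq> {}" by blast
  then have "\<exists>r\<in>card_of ` {X. cof_in D X}. \<forall>r'\<in>card_of ` {X. cof_in D X}. r \<le>o r'"
    by (rule exists_minim_Card_order) (auto simp: card_of_Card_order)
  then obtain X where X: "cof_in D X" and min: "\<And>Y. cof_in D Y \<Longrightarrow> |X| \<le>o |Y|" by blast
  have bound: "\<exists>g\<in>P. \<forall>f\<in>Y. LT f g \<in> D" if Y: "Y \<subseteq> P" "|Y| <o |X|" for Y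
  proof -
    have "\<not> cof_in D Y" using min[of Y] Y(2) not_ordLess_ordLeq by blast
    then show ?thesis using not_cof_in_bound[OF D Y(1)] by metis
  qed
  have XP: "X \<subseteq> P" using X unfolding cof_in_def by blast
  have inf: "infinite X"
  proof
    assume "finite X"
    then obtain g where g: "g \<in> P" "\<And>f. f \<in> X \<Longrightarrow> LT f g = K" using P_finite_bound XP by metis
    then obtain f where f: "f \<in> X" "LE g f \<in> D" using X unfolding cof_in_def by blast
    have "LE g f = {}" using LT_LE_disjoint[of f g] g f XP LE_sub by blast
    then show False using f(2) U_empty[OF D] by simp
  qed
  have Cinf: "Cinfinite |X|"
    using inf card_of_Card_order[of X] unfolding cinfinite_def Field_card_of by blast
  have "\<exists>p. \<forall>x\<in>Field |X|. p x \<in> P \<and> (\<forall>f\<in>insert x (p ` underS |X| x). LT f (p x) \<in> D)"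
  proof (rule wo_choice[OF card_of_Well_order])
    fix f g :: "('k \<Rightarrow> 'a) \<Rightarrow> 'k \<Rightarrow> 'a" and x y
    assume "\<And>z. z \<in> underS |X| x \<Longrightarrow> f z = g z"
    then have "f ` underS |X| x = g ` underS |X| x" by (rule image_cong[OF refl])
    then show "(y \<in> P \<and> (\<forall>h\<in>insert x (f ` underS |X| x). LT h y \<in> D)) =
      (y \<in> P \<and> (\<forall>h\<in>insert x (g ` underS |X| x). LT h y \<in> D))" by simp
  next
    fix f :: "('k \<Rightarrow> 'a) \<Rightarrow> 'k \<Rightarrow> 'a" and x
    assume x: "x \<in> Field |X|" and IH: "\<And>y. y \<in> underS |X| x \<Longrightarrow> f y \<in> P \<and>
      (\<forall>h\<in>insert y (f ` underS |X| y). LT h (f y) \<in> D)"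
    have "|f ` underS |X| x| <o |X|"
      by (rule card_image_ordLess, rule card_of_underS) (use x card_of_Card_order in auto)
    moreover have "|{x}| <o |X|" by (rule card_finite_ordLess[OF Cinf]) simp
    ultimately have "|{x} \<union> f ` underS |X| x| <o |X|" using card_Un_ordLess[OF Cinf] by blast
    moreover have "insert x (f ` underS |X| x) \<subseteq> P"
      using IH x XP unfolding Field_card_of by blast
    ultimately show "\<exists>y. y \<in> P \<and> (\<forall>h\<in>insert x (f ` underS |X| x). LT h y \<in> D)"
      using bound[of "insert x (f ` underS |X| x)"] by auto
  qed
  then obtain p where p: "\<forall>x\<in>X. p x \<in> P \<and> (\<forall>f\<in>insert x (p ` underS |X| x). LT f (p x) \<in> D)"
    unfolding Field_card_of by blast
  have "has_tcf P (less_mod K lam (dual_ideal K D)) |X|"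
    unfolding has_tcf_D_iff Field_card_of
  proof (intro exI conjI ballI)
    fix q assume "q \<in> P"
    then obtain x where x: "x \<in> X" "LE q x \<in> D" using X unfolding cof_in_def by blast
    then have "LT q (p x) \<in> D" using p U_meet[OF D x(2) _ LE_LT_trans LT_sub, of "p x"] by blast
    then show "\<exists>x\<in>X. LT q (p x) \<in> D" using x(1) by blast
  qed (use p in auto)
  then show ?thesis using that X min inf by blast
qed

text \<open>The length of a cofinal sequence is at least the least size of a cofinal set, and
  \<open>tcf_exists\<close> attains it by a cardinal on the type at which \<open>least_card\<close>
  is taken.\<close>

lemma tcf_char:
  assumes D: "D \<in> U"
  shows tcf_cof_in: "\<exists>X. cof_in D X \<and> (\<forall>Y. cof_in D Y \<longrightarrow> |X| \<le>o |Y| ) \<and> infinite X \<and> |X| =o tcfU D"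
    and tcf_Card_order: "Card_order (tcfU D)"
    and tcf_has_tcf: "has_tcf P (less_mod K lam (dual_ideal K D)) (tcfU D)"
proof -
  obtain X where X: "cof_in D X" "\<And>Y. cof_in D Y \<Longrightarrow> |X| \<le>o |Y|" "infinite X"
    and tcf: "has_tcf P (less_mod K lam (dual_ideal K D)) |X|"
    by (rule tcf_exists[OF D]) blast
  note l = least_card_props[of "|X|" "has_tcf P (less_mod K lam (dual_ideal K D))",
      OF card_of_Card_order tcf, folded tcf_def, folded tcf_ultra_def]
  obtain Y where Y: "cof_in D Y" "|Y| \<le>o |Field (tcfU D)|" by (rule has_tcf_cof_in[OF D l(2)])
  have "|X| \<le>o tcfU D"
    by (rule ordLeq_transitive[OF X(2)[OF Y(1)] ordLeq_ordIso_trans[OF Y(2) card_of_Field_ordIso[OF l(1)]]])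
  moreover have "tcfU D \<le>o |X|" by (rule l(3)[OF card_of_Card_order tcf])
  ultimately have "|X| =o tcfU D" unfolding ordIso_iff_ordLeq by blast
  then show "\<exists>X. cof_in D X \<and> (\<forall>Y. cof_in D Y \<longrightarrow> |X| \<le>o |Y| ) \<and> infinite X \<and> |X| =o tcfU D"
    using X by blast
  show "Card_order (tcfU D)" "has_tcf P (less_mod K lam (dual_ideal K D)) (tcfU D)"
    by (rule l)+
qed

lemma tcf_seq:
  assumes "D \<in> U"
  obtains p where "\<And>\<alpha>. \<alpha> \<in> Field (tcfU D) \<Longrightarrow> p \<alpha> \<in> P"
    "\<And>\<alpha> \<beta>. \<alpha> \<in> underS (tcfU D) \<beta> \<Longrightarrow> LT (p \<alpha>) (p \<beta>) \<in> D"
    "\<And>q. q \<in> P \<Longrightarrow> \<exists>\<alpha>\<in>Field (tcfU D). LT q (p \<alpha>) \<in> D"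
proof -
  have "has_tcf P (less_mod K lam (dual_ideal K D)) (tcfU D)" by (rule tcf_has_tcf[OF assms])
  then obtain p where p: "\<forall>\<alpha>\<in>Field (tcfU D). p \<alpha> \<in> P"
    "\<forall>\<beta>\<in>Field (tcfU D). \<forall>\<alpha>\<in>underS (tcfU D) \<beta>. LT (p \<alpha>) (p \<beta>) \<in> D"
    "\<forall>q\<in>P. \<exists>\<alpha>\<in>Field (tcfU D). LT q (p \<alpha>) \<in> D"
    unfolding has_tcf_D_iff by (elim exE conjE)
  show ?thesis
    by (rule that[of p]) (use p underS_Field_right in \<open>auto dest: underS_Field_right\<close>)
qed

lemma tcf_le_cof_in:
  assumes D: "D \<in> U" and "cof_in D Y"
  shows "tcfU D \<le>o |Y|"
proof -
  obtain X :: "('k \<Rightarrow> 'a) set" where X: "\<And>Y. cof_in D Y \<Longrightarrow> |X| \<le>o |Y|" "|X| =o tcfU D"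
    using tcf_cof_in[OF D] by auto
  show ?thesis by (rule ordIso_ordLeq_trans[OF ordIso_symmetric[OF X(2)] X(1)[OF assms(2)]])
qed

lemma tcf_bound:
  assumes D: "D \<in> U" and X: "X \<subseteq> P" "|X| <o tcfU D"
  obtains g where "g \<in> P" "\<And>f. f \<in> X \<Longrightarrow> LT f g \<in> D"
proof -
  have "\<not> cof_in D X" using tcf_le_cof_in[OF D] X(2) not_ordLess_ordLeq by blast
  then show ?thesis using not_cof_in_bound[OF D X(1)] that by metis
qed

lemma tcf_infinite:
  assumes D: "D \<in> U"
  shows "Cinfinite (tcfU D)"
proof -
  obtain X :: "('k \<Rightarrow> 'a) set" where X: "infinite X" "|X| =o tcfU D" using tcf_cof_in[OF D] by auto
  have "Cinfinite |X|"
    using X(1) card_of_Card_order[of X] unfolding cinfinite_def Field_card_of by blast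
  then show ?thesis by (rule Cinfinite_cong[OF X(2)])
qed

text \<open>A cofinal set of positions carries a cofinal set of functions, which cannot be smaller
  than the true cofinality.\<close>

lemma tcf_regular:
  assumes D: "D \<in> U"
  shows "regularCard (tcfU D)"
  unfolding regularCard_def
proof (intro allI impI)
  fix Z assume Z: "Z \<subseteq> Field (tcfU D) \<and> cofinal Z (tcfU D)"
  obtain p where p: "\<And>\<alpha>. \<alpha> \<in> Field (tcfU D) \<Longrightarrow> p \<alpha> \<in> P"
    "\<And>\<alpha> \<beta>. \<alpha> \<in> underS (tcfU D) \<beta> \<Longrightarrow> LT (p \<alpha>) (p \<beta>) \<in> D"
    "\<And>q. q \<in> P \<Longrightarrow> \<exists>\<alpha>\<in>Field (tcfU D). LT q (p \<alpha>) \<in> D"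
    by (rule tcf_seq[OF D]) blast
  have "cof_in D (p ` Z)"
    unfolding cof_in_def
  proof (intro conjI ballI)
    show "p ` Z \<subseteq> P" using p(1) Z by blast
  next
    fix q assume "q \<in> P"
    then obtain \<alpha> where \<alpha>: "\<alpha> \<in> Field (tcfU D)" "LT q (p \<alpha>) \<in> D" using p(3) by blast
    then obtain z where z: "z \<in> Z" "\<alpha> \<in> underS (tcfU D) z"
      using Z unfolding cofinal_def underS_def by blast
    have "LT q (p \<alpha>) \<inter> LT (p \<alpha>) (p z) \<subseteq> LE q (p z)"
      using LE_trans[of q "p \<alpha>" "p z"] LT_sub_LE[of q "p \<alpha>"] LT_sub_LE[of "p \<alpha>" "p z"] by blast
    then have "LE q (p z) \<in> D" by (rule U_meet[OF D \<alpha>(2) p(2)[OF z(2)] _ LE_sub])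
    then show "\<exists>f\<in>p ` Z. LE q f \<in> D" using z(1) by blast
  qed
  then have "tcfU D \<le>o |p ` Z|" by (rule tcf_le_cof_in[OF D])
  then have "tcfU D \<le>o |Z|" by (rule ordLeq_transitive[OF _ card_of_image])
  moreover have "|Z| \<le>o tcfU D"
    using ordLeq_ordIso_trans[OF card_of_mono1 card_of_Field_ordIso[OF tcf_Card_order[OF D]]] Z by blast
  ultimately show "|Z| =o tcfU D" unfolding ordIso_iff_ordLeq by blast
qed

lemma has_tcf_ordIso:
  assumes "r =o s" "has_tcf A R r" "Well_order s"
  shows "has_tcf A R s"
proof -
  obtain f where f: "iso s r f" using ordIso_symmetric[OF assms(1)] unfolding ordIso_def by blast
  have wo: "Well_order s" "Well_order r"
    using assms(1,3) unfolding ordIso_def by auto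
  have bij: "bij_betw f (Field s) (Field r)" using f unfolding iso_def by blast
  have emb: "embed s r f" using f unfolding iso_def by blast
  have lt: "f \<alpha> \<in> underS r (f \<beta>)" if "\<alpha> \<in> underS s \<beta>" for \<alpha> \<beta>
    using embed_underS[OF wo(1) emb underS_Field_right[OF that]] that
    unfolding bij_betw_def by blast
  obtain p where p: "\<forall>\<alpha>\<in>Field r. p \<alpha> \<in> A" "\<forall>\<beta>\<in>Field r. \<forall>\<alpha>\<in>underS r \<beta>. R (p \<alpha>) (p \<beta>)"
    "\<forall>q\<in>A. \<exists>\<alpha>\<in>Field r. R q (p \<alpha>)" using assms(2) unfolding has_tcf_def by (elim exE conjE)
  show ?thesis
    unfolding has_tcf_def
  proof (intro exI conjI ballI)
    fix \<alpha> assume "\<alpha> \<in> Field s"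
    then show "(p \<circ> f) \<alpha> \<in> A" using p(1) bij_betwE[OF bij] by simp
  next
    fix \<alpha> \<beta> assume "\<beta> \<in> Field s" "\<alpha> \<in> underS s \<beta>"
    then show "R ((p \<circ> f) \<alpha>) ((p \<circ> f) \<beta>)" using p(2) bij_betwE[OF bij] lt by simp
  next
    fix q assume "q \<in> A"
    then obtain \<alpha> where "\<alpha> \<in> Field r" "R q (p \<alpha>)" using p(3) by blast
    moreover have "\<alpha> \<in> f ` Field s"
      using bij_betw_imp_surj_on[OF bij] \<open>\<alpha> \<in> Field r\<close> by simp
    then obtain \<beta> where "\<beta> \<in> Field s" "f \<beta> = \<alpha>" by auto
    ultimately show "\<exists>\<beta>\<in>Field s. R q ((p \<circ> f) \<beta>)" by auto
  qed
qed

text \<open>A cofinality that has been squeezed between bounds is known only up to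
  \<open>=o\<close>; this identifies it with a given member of \<open>pcf\<close>.\<close>

lemma tcf_eq:
  assumes D: "D \<in> U" and E: "E \<in> U" and "tcfU D =o tcfU E"
  shows "tcfU D = tcfU E"
proof -
  define Q :: "'k set set \<Rightarrow> ('k \<Rightarrow> 'a) rel \<Rightarrow> bool"
    where "Q D = has_tcf P (less_mod K lam (dual_ideal K D))" for D
  have ex: "\<exists>r. Card_order r \<and> Q D r" if "D \<in> U" for D
    unfolding Q_def using tcf_Card_order[OF that] tcf_has_tcf[OF that] by auto
  obtain r where r: "Card_order r" "Q D r" using ex[OF D] by auto
  obtain s where s: "Card_order s" "Q E s" using ex[OF E] by auto
  have cong: "Q F s" if "r =o s" "Q F r" for F r s
    unfolding Q_def
    by (rule has_tcf_ordIso[OF that(1) that(2)[unfolded Q_def]])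
      (use that(1) in \<open>auto simp: ordIso_def\<close>)
  have "least_card (Q D) = least_card (Q E)"
    by (rule least_card_eq[of r "Q D" s "Q E", OF r s]) (use cong assms(3) in \<open>auto simp: tcf_ultra_def tcf_def Q_def\<close>)
  then show ?thesis unfolding tcf_ultra_def tcf_def Q_def .
qed

lemma pcf_iff: "\<mu> \<in> pcf K I lam \<longleftrightarrow> (\<exists>D\<in>U. \<mu> = tcfU D)"
  unfolding pcf_def U_def by blast

subsection \<open>The ideals \<open>J\<close>\<close>

abbreviation J :: "'b rel \<Rightarrow> 'k set set" where
  "J \<equiv> J_less K I lam"

lemma J_iff: "B \<in> J l \<longleftrightarrow> B \<subseteq> K \<and> (\<forall>D\<in>U. B \<in> D \<longrightarrow> \<not> l \<le>o tcfU D)"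
  unfolding J_less_def U_def by blast

lemma J_disjoint: "D \<in> U \<Longrightarrow> l \<le>o tcfU D \<Longrightarrow> D \<inter> J l = {}"
  unfolding J_less_def U_def by blast

lemma J_positive:
  assumes "A \<subseteq> K" "A \<notin> J l"
  obtains D where "D \<in> U" "A \<in> D" "l \<le>o tcfU D"
  using assms unfolding J_iff by blast

lemma I_sub_J: "I \<subseteq> J l"
  unfolding J_iff subset_iff using ideal_sub[OF I_ideal] U_I by blast

lemma J_ideal: "ideal_on K (J l)"
  unfolding ideal_on_def
proof (intro conjI ballI allI impI)
  show "J l \<subseteq> Pow K" "{} \<in> J l" unfolding J_less_def U_def ultrafilter_on_def by blast+
next
  fix A B assume A: "A \<in> J l" and B: "B \<subseteq> A"
  show "B \<in> J l"
    unfolding J_iff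
  proof (intro conjI ballI impI)
    show "B \<subseteq> K" using A B unfolding J_iff by blast
    fix D assume "D \<in> U" "B \<in> D"
    then show "\<not> l \<le>o tcfU D" using U_up[of D B A] A B unfolding J_iff by blast
  qed
next
  fix A B assume A: "A \<in> J l" and B: "B \<in> J l"
  show "A \<union> B \<in> J l"
    unfolding J_iff
  proof (intro conjI ballI impI)
    show "A \<union> B \<subseteq> K" using A B unfolding J_iff by blast
    fix D assume "D \<in> U" "A \<union> B \<in> D"
    then show "\<not> l \<le>o tcfU D" using U_Un[of D A B] A B unfolding J_iff by blast
  qed
qed

lemma J_mono: "l \<le>o l' \<Longrightarrow> J l \<subseteq> J l'"
  unfolding J_iff subset_iff using ordLeq_transitive[of l l'] by blast

lemma J_cong: "l =o l' \<Longrightarrow> J l = J l'"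
  using J_mono[of l l'] J_mono[of l' l] unfolding ordIso_iff_ordLeq by blast

section \<open>Directedness, cofinalities and generation of the ideals \<open>J\<close>\<close>

lemma LE_cover: "a \<in> P \<Longrightarrow> b \<in> P \<Longrightarrow> LE c a \<subseteq> LE b a \<union> LE c b"
  using LT_compl[of a b] LE_trans[of c a b] LT_sub_LE[of a b] LE_sub[of c a] by blast

lemma ideal_LE_trans:
  assumes "ideal_on K M" "a \<in> P" "b \<in> P" "LE b a \<in> M" "LE c b \<in> M"
  shows "LE c a \<in> M"
  by (rule ideal_cover[OF assms(1,4,5) LE_cover[OF assms(2,3)]])

lemma U_not_mem_LT: "D \<in> U \<Longrightarrow> f \<in> P \<Longrightarrow> g \<in> P \<Longrightarrow> LE g f \<notin> D \<Longrightarrow> LT f g \<in> D"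
  using U_LT by blast

lemma directed_iff:
  "directed_card P (less_mod K lam M) r \<longleftrightarrow>
    (\<forall>X. X \<subseteq> P \<and> |X| <o r \<longrightarrow> (\<exists>g\<in>P. \<forall>f\<in>X. LE g f \<in> M))"
proof -
  have "(\<forall>f\<in>X. less_mod K lam M f g) \<longleftrightarrow> (\<forall>f\<in>X. LE g f \<in> M)" if "X \<subseteq> P" "g \<in> P" for X g
    using that less_mod_iff[OF _ that(2)] by blast
  then show ?thesis unfolding directed_card_def by (metis (no_types, lifting))
qed

text \<open>The members of a cofinal sequence shorter than \<open>r\<close> would have a common
  bound modulo \<open>M\<close>. Since \<open>D\<close> misses \<open>M\<close>, no member could
  pass that bound modulo \<open>D\<close>.\<close>

lemma directed_tcf:
  assumes D: "D \<in> U" "D \<inter> M = {}" and dir: "directed_card P (less_mod K lam M) r"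
    and r: "Card_order r"
  shows "r \<le>o tcfU D"
proof (rule ccontr)
  assume "\<not> r \<le>o tcfU D"
  then have less: "tcfU D <o r" using Card_order_trichotomy[OF tcf_Card_order[OF D(1)] r] by blast
  obtain p where p: "\<And>\<alpha>. \<alpha> \<in> Field (tcfU D) \<Longrightarrow> p \<alpha> \<in> P"
    "\<And>\<alpha> \<beta>. \<alpha> \<in> underS (tcfU D) \<beta> \<Longrightarrow> LT (p \<alpha>) (p \<beta>) \<in> D"
    "\<And>q. q \<in> P \<Longrightarrow> \<exists>\<alpha>\<in>Field (tcfU D). LT q (p \<alpha>) \<in> D"
    by (rule tcf_seq[OF D(1)]) blast
  have "|p ` Field (tcfU D)| <o r"
    by (rule card_image_ordLess[OF card_of_Field_less[OF tcf_Card_order[OF D(1)] less]])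
  then obtain g where g: "g \<in> P" "\<forall>f\<in>p ` Field (tcfU D). LE g f \<in> M"
    using dir p(1) unfolding directed_iff by (metis image_subsetI)
  obtain \<alpha> where \<alpha>: "\<alpha> \<in> Field (tcfU D)" "LT g (p \<alpha>) \<in> D" using p(3)[OF g(1)] by blast
  have "LE g (p \<alpha>) \<in> D" by (rule U_up[OF D(1) \<alpha>(2) LT_sub_LE LE_sub])
  then show False using g(2) \<alpha>(1) D(2) by blast
qed

lemma U_of_disjoint: "ultrafilter_on K D \<Longrightarrow> D \<inter> J l = {} \<Longrightarrow> D \<in> U"
  using I_sub_J[of l] unfolding U_def by blast

text \<open>Serves both generation statements: \<open>\<G> \<mu>\<close> is a singleton or a whole
  family. If some \<open>A\<close> in \<open>J l\<close> escaped an ideal \<open>M\<close>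
  containing \<open>I\<close> and the generators, an ultrafilter \<open>D\<close> through
  \<open>A\<close> would miss \<open>M\<close>. Its cofinality \<mu> is below \<open>l\<close>. The
  set supplied by \<open>meets\<close> is covered modulo \<open>J \<mu>\<close> by a generator,
  which must then lie in \<open>D\<close> and in \<open>M\<close>.\<close>

lemma ideal_plus_J:
  assumes sub: "\<And>\<mu>. \<mu> \<in> pcf K I lam \<Longrightarrow> \<G> \<mu> \<subseteq> J (cardSuc \<mu>)"
    and gen: "\<And>\<mu> A. \<mu> \<in> pcf K I lam \<Longrightarrow> A \<in> J (cardSuc \<mu>) \<Longrightarrow> \<exists>B\<in>\<G> \<mu>. A - B \<in> J \<mu>"
    and meets: "\<And>D. D \<in> U \<Longrightarrow> D \<inter> J (cardSuc (tcfU D)) \<noteq> {}"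
    and l: "Card_order l"
  shows "J l = ideal_plus K I (\<Union>\<mu>\<in>{\<mu>. \<mu> \<in> pcf K I lam \<and> \<mu> <o l}. \<G> \<mu>)" (is "_ = ideal_plus K I ?X")
proof
  show "ideal_plus K I ?X \<subseteq> J l"
  proof -
    have "\<G> \<mu> \<subseteq> J l" if \<mu>: "\<mu> \<in> pcf K I lam" "\<mu> <o l" for \<mu>
    proof -
      have "Card_order \<mu>" using \<mu>(1) tcf_Card_order unfolding pcf_iff by blast
      then have "cardSuc \<mu> \<le>o l" by (rule cardSuc_least[OF _ l \<mu>(2)])
      then show ?thesis using sub[OF \<mu>(1)] J_mono by blast
    qed
    then have "I \<union> ?X \<subseteq> J l" using I_sub_J by blast
    then show ?thesis unfolding ideal_plus_def using J_ideal by blast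
  qed
next
  show "J l \<subseteq> ideal_plus K I ?X"
    unfolding ideal_plus_def
  proof (intro subsetI InterI)
    fix A M assume A: "A \<in> J l" and M: "M \<in> {M. ideal_on K M \<and> I \<union> ?X \<subseteq> M}"
    show "A \<in> M"
    proof (rule ccontr)
      assume "A \<notin> M"
      then obtain D where D: "D \<in> U" "A \<in> D" "D \<inter> M = {}"
        using exists_U[of M A] M ideal_sub[OF J_ideal A] by auto
      let ?\<mu> = "tcfU D"
      have \<mu>: "?\<mu> \<in> pcf K I lam" unfolding pcf_iff using D(1) by blast
      have less: "?\<mu> <o l"
        using A D Card_order_trichotomy[OF tcf_Card_order[OF D(1)] l] unfolding J_iff by blast
      obtain A' where A': "A' \<in> D" "A' \<in> J (cardSuc ?\<mu>)" using meets[OF D(1)] by blast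
      obtain B where B: "B \<in> \<G> ?\<mu>" "A' - B \<in> J ?\<mu>" using gen[OF \<mu> A'(2)] by blast
      have BK: "B \<subseteq> K" using sub[OF \<mu>] B(1) ideal_sub[OF J_ideal] by blast
      have "A' - B \<notin> D" using J_disjoint[OF D(1) ordLeq_refl[OF tcf_Card_order[OF D(1)]]] B(2) by blast
      moreover have "(A' - B) \<union> B \<in> D"
        by (rule U_up[OF D(1) A'(1)]) (use BK U_sub[OF D(1) A'(1)] in auto)
      ultimately have "B \<in> D" using U_Un[OF D(1), of "A' - B" B] BK U_sub[OF D(1) A'(1)] by blast
      moreover have "B \<in> M" using M B(1) \<mu> less by blast
      ultimately show False using D(3) by blast
    qed
  qed
qed

end


section \<open>Weakly saturated products\<close>

text \<open>\<open>S\<close> is a supply of records, partial maps from labels in \<theta> to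
  positions in \<open>r\<close>; a challenge \<beta> names a position for each record. The answer is
  a chain \<open>x\<close> with labels \<open>j\<close>: before each \<open>x \<epsilon>\<close>
  there is a record whose challenge has been passed and which holds the whole earlier chain under
  its labels. Labels lie in \<theta> so that \<open>H i\<close> can select among them.\<close>

definition guessing :: "'t rel \<Rightarrow> 'l rel \<Rightarrow> bool" where
  "guessing \<theta> r \<longleftrightarrow> (\<exists>S :: ('t \<Rightarrow> 'l option) set. |S| \<le>o r \<and>
     (\<forall>s\<in>S. \<forall>j b. s j = Some b \<longrightarrow> b \<in> Field r) \<and>
     (\<forall>\<beta>. (\<forall>s\<in>S. \<beta> s \<in> Field r) \<longrightarrow>
        (\<exists>x j. (\<forall>\<epsilon>\<in>Field \<theta>. x \<epsilon> \<in> Field r \<and> j \<epsilon> \<in> Field \<theta> \<and>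
           (\<exists>s\<in>S. \<beta> s \<in> underS r (x \<epsilon>) \<and> (\<forall>\<zeta>\<in>underS \<theta> \<epsilon>. s (j \<zeta>) = Some (x \<zeta>)))))))"

text \<open>\<open>saturated\<close> is the usable form of \<open>wsat\<close> being at most
  \<theta>: it speaks of disjoint positive sets that do not have to cover \<open>K\<close>.\<close>

locale weakly_saturated_product = reduced_product K lam I
  for K :: "'k set" and lam :: "'k \<Rightarrow> 'a rel" and I +
  fixes \<theta> :: "'t rel" and H :: "'k \<Rightarrow> 't set"
  assumes theta: "Card_order \<theta>"
    and H_small: "\<And>i. i \<in> K \<Longrightarrow> |H i| <o lam i"
    and H_large: "\<And>\<epsilon>. \<epsilon> \<in> Field \<theta> \<Longrightarrow> {i\<in>K. \<epsilon> \<notin> H i} \<in> I"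
    and saturated: "\<And>V. (\<And>\<epsilon>. \<epsilon> \<in> Field \<theta> \<Longrightarrow> V \<epsilon> \<subseteq> K \<and> V \<epsilon> \<notin> I) \<Longrightarrow>
      \<exists>\<epsilon>\<in>Field \<theta>. \<exists>\<zeta>\<in>Field \<theta>. \<epsilon> \<noteq> \<zeta> \<and> V \<epsilon> \<inter> V \<zeta> \<noteq> {}"
begin

section \<open>Almost disjoint families, suprema over \<open>H i\<close>, and ladders\<close>

lemma theta_wo: "Well_order \<theta>"
  using theta by (rule Card_order_imp_Well_order)

text \<open>If no \<open>V \<epsilon>\<close> were null, the sets
  \<open>V \<epsilon> - N \<epsilon>\<close> would be positive. They are pairwise disjoint because
  an overlap sits in the null set of the smaller index, so each set loses only one null set.\<close>

lemma almost_disjoint: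
  assumes N: "\<And>\<epsilon>. \<epsilon> \<in> Field \<theta> \<Longrightarrow> N \<epsilon> \<in> I"
    and V: "\<And>\<epsilon>. \<epsilon> \<in> Field \<theta> \<Longrightarrow> V \<epsilon> \<subseteq> K"
    and disj: "\<And>\<epsilon> \<zeta>. \<zeta> \<in> underS \<theta> \<epsilon> \<Longrightarrow> V \<zeta> \<inter> V \<epsilon> \<subseteq> N \<zeta>"
  shows "\<exists>\<epsilon>\<in>Field \<theta>. V \<epsilon> \<in> I"
proof (rule ccontr)
  assume no: "\<not> (\<exists>\<epsilon>\<in>Field \<theta>. V \<epsilon> \<in> I)"
  have "V \<epsilon> - N \<epsilon> \<subseteq> K \<and> V \<epsilon> - N \<epsilon> \<notin> I" if e: "\<epsilon> \<in> Field \<theta>" for \<epsilon>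
  proof -
    have "V \<epsilon> - N \<epsilon> \<notin> I"
      using ideal_cover[OF I_ideal _ N[OF e], of "V \<epsilon> - N \<epsilon>" "V \<epsilon>"] no e by blast
    then show ?thesis using V[OF e] by blast
  qed
  then obtain \<epsilon> \<zeta> where e: "\<epsilon> \<in> Field \<theta>" "\<zeta> \<in> Field \<theta>" "\<epsilon> \<noteq> \<zeta>"
    "(V \<epsilon> - N \<epsilon>) \<inter> (V \<zeta> - N \<zeta>) \<noteq> {}"
    using saturated[of "\<lambda>\<epsilon>. V \<epsilon> - N \<epsilon>"] by auto
  show False
    using underS_linear[OF theta_wo e(1,2)] disj[of \<epsilon> \<zeta>] disj[of \<zeta> \<epsilon>] e(3,4) by blast
qed

text \<open>At coordinate \<open>i\<close> only indices in \<open>H i\<close> compete, and these are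
  fewer than \<open>lam i\<close>.\<close>

lemma H_bound:
  assumes T: "T \<subseteq> Field \<theta>" and W: "\<And>j. j \<in> T \<Longrightarrow> W j \<in> P"
  obtains F where "F \<in> P" "\<And>i j. i \<in> K \<Longrightarrow> j \<in> T \<Longrightarrow> j \<in> H i \<Longrightarrow> W j i \<in> underS (lam i) (F i)"
proof -
  let ?A = "\<lambda>i. (\<lambda>j. W j i) ` (T \<inter> H i)"
  have A: "?A i \<subseteq> Field (lam i) \<and> |?A i| <o lam i" if i: "i \<in> K" for i
  proof
    show "?A i \<subseteq> Field (lam i)"
      by (rule image_subsetI, rule P_Field[OF W i]) simp
    show "|?A i| <o lam i"
      by (rule card_image_ordLess, rule card_subset_ordLess[OF _ H_small[OF i]]) simp
  qed
  obtain F where F: "F \<in> P" "\<And>i. i \<in> K \<Longrightarrow> ?A i \<subseteq> underS (lam i) (F i)"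
    using P_bound[of ?A, OF A] by metis
  show ?thesis
    by (rule that[OF F(1)]) (use F(2) in blast)
qed

lemma I_directed:
  assumes X: "X \<subseteq> P" "|X| \<le>o \<theta>"
  obtains g where "g \<in> P" "\<And>f. f \<in> X \<Longrightarrow> LE g f \<in> I"
proof (cases "X = {}")
  case True
  then show ?thesis using that P_nonempty by auto
next
  case False
  obtain W where W: "W ` Field \<theta> = X" by (rule surj_indexed[OF X(2) theta False])
  have WP: "W j \<in> P" if "j \<in> Field \<theta>" for j using W X(1) that by blast
  obtain g where g: "g \<in> P"
    "\<And>i j. i \<in> K \<Longrightarrow> j \<in> Field \<theta> \<Longrightarrow> j \<in> H i \<Longrightarrow> W j i \<in> underS (lam i) (g i)"
    using H_bound[of "Field \<theta>" W, OF subset_refl WP] by metis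
  show ?thesis
  proof (rule that[OF g(1)])
    fix f assume "f \<in> X"
    then obtain j where j: "j \<in> Field \<theta>" "f = W j" using W by blast
    have "K - {i\<in>K. j \<notin> H i} \<subseteq> LT f g" unfolding LT_def j(2) using g(2) j(1) by blast
    then have "LE g f \<subseteq> {i\<in>K. j \<notin> H i}"
      using LT_LE_disjoint[of f g] LE_sub[of g f] WP[OF j(1)] g(1) j(2) by blast
    then show "LE g f \<in> I" by (rule ideal_down[OF I_ideal H_large[OF j(1)]])
  qed
qed

lemma cardSuc_directed: "directed_card P (less_mod K lam I) (cardSuc \<theta>)"
  unfolding directed_iff
proof (intro allI impI)
  fix X assume X: "X \<subseteq> P \<and> |X| <o cardSuc \<theta>"
  then have "|X| \<le>o \<theta>" using cardSuc_ordLeq_ordLess[OF theta card_of_Card_order] by blast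
  then show "\<exists>g\<in>P. \<forall>f\<in>X. LE g f \<in> I" using I_directed[of X] X by metis
qed

lemma theta_less_tcf: "D \<in> U \<Longrightarrow> \<theta> <o tcfU D"
  using directed_tcf[OF _ _ cardSuc_directed cardSuc_Card_order[OF theta]] cardSuc_greater[OF theta]
    ordLess_ordLeq_trans unfolding U_def by blast

text \<open>Each new lower level \<open>F\<close> is built above all earlier upper levels
  \<open>G\<close>. If \<open>u\<close> lay between \<open>F\<close> and \<open>G\<close> at
  coordinate \<open>i\<close> on rungs \<zeta> < \<epsilon> with \<zeta> in \<open>H i\<close>, then
  \<open>u \<le> G \<zeta> < F \<epsilon> \<le> u\<close> at \<open>i\<close>. So the sets where
  \<open>u\<close> is caught are almost disjoint, and one of them is null. The index
  \<open>b\<close> allows whole sequences as levels, with the decisive position chosen only after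
  the ladder is finished.\<close>

lemma ladder:
  fixes \<Phi> :: "('b \<Rightarrow> 'k \<Rightarrow> 'a) \<Rightarrow> ('b \<Rightarrow> 'k \<Rightarrow> 'a) \<Rightarrow> bool"
  assumes step: "\<And>F. \<forall>b. F b \<in> P \<Longrightarrow> \<exists>G. (\<forall>b. G b \<in> P) \<and> \<Phi> F G"
  shows "\<exists>F G. (\<forall>\<epsilon>\<in>Field \<theta>. (\<forall>b. F \<epsilon> b \<in> P \<and> G \<epsilon> b \<in> P) \<and> \<Phi> (F \<epsilon>) (G \<epsilon>)) \<and>
    (\<forall>b. \<forall>u\<in>P. \<exists>\<epsilon>\<in>Field \<theta>. LE (F \<epsilon> b) u \<inter> LE u (G \<epsilon> b) \<in> I)"
proof -
  define \<Psi> where "\<Psi> f \<epsilon> y \<longleftrightarrow> (\<forall>b. fst y b \<in> P \<and> snd y b \<in> P) \<and> \<Phi> (fst y) (snd y) \<and>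
      (\<forall>\<zeta>\<in>underS \<theta> \<epsilon>. \<forall>b. \<forall>i\<in>K. \<zeta> \<in> H i \<longrightarrow> snd (f \<zeta>) b i \<in> underS (lam i) (fst y b i))"
    for f :: "'t \<Rightarrow> ('b \<Rightarrow> 'k \<Rightarrow> 'a) \<times> ('b \<Rightarrow> 'k \<Rightarrow> 'a)" and \<epsilon> y
  have "\<exists>f. \<forall>\<epsilon>\<in>Field \<theta>. \<Psi> f \<epsilon> (f \<epsilon>)"
  proof (rule wo_choice[OF theta_wo])
    fix f g :: "'t \<Rightarrow> ('b \<Rightarrow> 'k \<Rightarrow> 'a) \<times> ('b \<Rightarrow> 'k \<Rightarrow> 'a)" and \<epsilon> y
    assume "\<And>z. z \<in> underS \<theta> \<epsilon> \<Longrightarrow> f z = g z"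
    then show "\<Psi> f \<epsilon> y = \<Psi> g \<epsilon> y" unfolding \<Psi>_def by simp
  next
    fix f :: "'t \<Rightarrow> ('b \<Rightarrow> 'k \<Rightarrow> 'a) \<times> ('b \<Rightarrow> 'k \<Rightarrow> 'a)" and \<epsilon>
    assume IH: "\<And>\<zeta>. \<zeta> \<in> underS \<theta> \<epsilon> \<Longrightarrow> \<Psi> f \<zeta> (f \<zeta>)"
    have "\<exists>F. F \<in> P \<and> (\<forall>i\<in>K. \<forall>\<zeta>\<in>underS \<theta> \<epsilon>. \<zeta> \<in> H i \<longrightarrow> snd (f \<zeta>) b i \<in> underS (lam i) (F i))" for b
      using H_bound[of "underS \<theta> \<epsilon>" "\<lambda>\<zeta>. snd (f \<zeta>) b", OF Order_Relation.underS_Field] IH unfolding \<Psi>_def by metis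
    then obtain F where F: "\<And>b. F b \<in> P"
      "\<And>b i \<zeta>. i \<in> K \<Longrightarrow> \<zeta> \<in> underS \<theta> \<epsilon> \<Longrightarrow> \<zeta> \<in> H i \<Longrightarrow> snd (f \<zeta>) b i \<in> underS (lam i) (F b i)"
      by metis
    have "\<exists>G. (\<forall>b. G b \<in> P) \<and> \<Phi> F G" by (rule step, rule allI, rule F(1))
    then obtain G where "\<forall>b. G b \<in> P" "\<Phi> F G" by blast
    then have "\<Psi> f \<epsilon> (F, G)" unfolding \<Psi>_def using F by simp
    then show "\<exists>y. \<Psi> f \<epsilon> y" ..
  qed
  then obtain f where f: "\<And>\<epsilon>. \<epsilon> \<in> Field \<theta> \<Longrightarrow> \<Psi> f \<epsilon> (f \<epsilon>)" by blast
  show ?thesis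
  proof (intro exI conjI ballI allI)
    fix \<epsilon> b assume "\<epsilon> \<in> Field \<theta>"
    then show "fst (f \<epsilon>) b \<in> P" "snd (f \<epsilon>) b \<in> P" "\<Phi> (fst (f \<epsilon>)) (snd (f \<epsilon>))"
      using f unfolding \<Psi>_def by blast+
  next
    fix b u assume u: "u \<in> P"
    show "\<exists>\<epsilon>\<in>Field \<theta>. LE (fst (f \<epsilon>) b) u \<inter> LE u (snd (f \<epsilon>) b) \<in> I"
    proof (rule almost_disjoint[where N = "\<lambda>\<zeta>. {i\<in>K. \<zeta> \<notin> H i}", OF H_large])
      fix \<epsilon> \<zeta> assume z: "\<zeta> \<in> underS \<theta> \<epsilon>"
      show "LE (fst (f \<zeta>) b) u \<inter> LE u (snd (f \<zeta>) b) \<inter> (LE (fst (f \<epsilon>) b) u \<inter> LE u (snd (f \<epsilon>) b))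
        \<subseteq> {i\<in>K. \<zeta> \<notin> H i}"
      proof
        fix i assume i: "i \<in> LE (fst (f \<zeta>) b) u \<inter> LE u (snd (f \<zeta>) b) \<inter>
          (LE (fst (f \<epsilon>) b) u \<inter> LE u (snd (f \<epsilon>) b))"
        then have iK: "i \<in> K" and le: "(u i, snd (f \<zeta>) b i) \<in> lam i" "(fst (f \<epsilon>) b i, u i) \<in> lam i"
          unfolding LE_def by auto
        have "\<zeta> \<notin> H i"
        proof
          assume "\<zeta> \<in> H i"
          then have "snd (f \<zeta>) b i \<in> underS (lam i) (fst (f \<epsilon>) b i)"
            using f[OF underS_Field_right[OF z]] z iK unfolding \<Psi>_def by blast
          then have "u i \<in> underS (lam i) (u i)"
            using le_underS_trans[OF lam_wo[OF iK] le(1)] underS_le_trans[OF lam_wo[OF iK] _ le(2)]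
            by blast
          then show False using underS_irrefl by fast
        qed
        then show "i \<in> {i\<in>K. \<zeta> \<notin> H i}" using iK by blast
      qed
    qed (use LE_sub in auto)
  qed
qed

subsection \<open>Directedness modulo \<open>J l\<close>\<close>

text \<open>Without a bound, every candidate \<open>F\<close> satisfies \<open>F \<le> f x\<close>
  on a set outside \<open>J l\<close>, hence in some \<open>D\<close> of cofinality at least
  \<open>l\<close>. As \<open>r\<close> is below \<open>l\<close>, the whole sequence has a bound
  \<open>h\<close> modulo \<open>D\<close>, so every later \<open>f y\<close> lies between
  \<open>F\<close> and \<open>h\<close> there. After \<theta> such rungs, one position
  \<open>y\<close> beyond all thresholds contradicts \<open>ladder\<close>; it exists because
  \<theta> is below the regular \<open>r\<close>.\<close>

lemma regular_J_bounded:
  assumes l: "Card_order l" and r: "Cinfinite r" "regularCard r" "r <o l" and tr: "\<theta> <o r"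
    and f: "\<And>x. x \<in> Field r \<Longrightarrow> f x \<in> P"
    and mono: "\<And>x y. x \<in> underS r y \<Longrightarrow> LE (f y) (f x) \<in> J l"
  shows "\<exists>g\<in>P. \<forall>x\<in>Field r. LE g (f x) \<in> J l"
proof (rule ccontr)
  assume no: "\<not> (\<exists>g\<in>P. \<forall>x\<in>Field r. LE g (f x) \<in> J l)"
  define \<Phi> :: "(unit \<Rightarrow> 'k \<Rightarrow> 'a) \<Rightarrow> (unit \<Rightarrow> 'k \<Rightarrow> 'a) \<Rightarrow> bool" where
    "\<Phi> F G \<longleftrightarrow> (\<exists>D\<in>U. \<exists>x\<in>Field r. \<forall>y. x \<in> underS r y \<longrightarrow> LE (F ()) (f y) \<inter> LE (f y) (G ()) \<in> D)" for F G
  have step: "\<exists>G. (\<forall>b. G b \<in> P) \<and> \<Phi> F G" if F: "\<forall>b. F b \<in> P" for F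
  proof -
    obtain x where x: "x \<in> Field r" "LE (F ()) (f x) \<notin> J l" using no F by blast
    obtain D where D: "D \<in> U" "LE (F ()) (f x) \<in> D" "l \<le>o tcfU D" by (rule J_positive[OF LE_sub x(2)])
    have "|Field r| <o tcfU D" using card_of_Field_less r(1) ordLess_ordLeq_trans[OF r(3) D(3)] by blast
    then have "|f ` Field r| <o tcfU D" by (rule card_image_ordLess)
    then obtain h where h: "h \<in> P" "\<And>y. y \<in> Field r \<Longrightarrow> LT (f y) h \<in> D"
      using tcf_bound[OF D(1), of "f ` Field r"] f by (metis image_subsetI imageI)
    have "LE (F ()) (f y) \<inter> LE (f y) h \<in> D" if y: "x \<in> underS r y" for y
    proof (rule U_Int[OF D(1)])
      have yF: "y \<in> Field r" by (rule underS_Field_right[OF y])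
      show "LE (f y) h \<in> D" by (rule U_up[OF D(1) h(2)[OF yF] LT_sub_LE LE_sub])
      have "LE (f y) (f x) \<notin> D" using mono[OF y] J_disjoint[OF D(1,3)] by blast
      then have "LT (f x) (f y) \<in> D" by (rule U_not_mem_LT[OF D(1) f[OF x(1)] f[OF yF]])
      moreover have "LE (F ()) (f x) \<inter> LT (f x) (f y) \<subseteq> LE (F ()) (f y)"
        using LE_LT_trans LT_sub_LE by blast
      ultimately show "LE (F ()) (f y) \<in> D" using U_meet[OF D(1,2) _ _ LE_sub] by blast
    qed
    then have "\<Phi> F (\<lambda>_. h)" unfolding \<Phi>_def using D(1) x(1) by blast
    then show ?thesis using h(1) by (intro exI[of _ "\<lambda>_. h"]) simp
  qed
  have "\<exists>F G. (\<forall>\<epsilon>\<in>Field \<theta>. (\<forall>b. F \<epsilon> b \<in> P \<and> G \<epsilon> b \<in> P) \<and> \<Phi> (F \<epsilon>) (G \<epsilon>)) \<and>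
      (\<forall>b. \<forall>u\<in>P. \<exists>\<epsilon>\<in>Field \<theta>. LE (F \<epsilon> b) u \<inter> LE u (G \<epsilon> b) \<in> I)"
    by (rule ladder, rule step)
  then obtain F G where FG: "\<forall>\<epsilon>\<in>Field \<theta>. (\<forall>b. F \<epsilon> b \<in> P \<and> G \<epsilon> b \<in> P) \<and> \<Phi> (F \<epsilon>) (G \<epsilon>)"
    and small: "\<forall>b. \<forall>u\<in>P. \<exists>\<epsilon>\<in>Field \<theta>. LE (F \<epsilon> b) u \<inter> LE u (G \<epsilon> b) \<in> I"
    by (elim exE conjE)
  have "\<forall>\<epsilon>\<in>Field \<theta>. \<exists>x. x \<in> Field r \<and>
    (\<exists>D\<in>U. \<forall>y. x \<in> underS r y \<longrightarrow> LE (F \<epsilon> ()) (f y) \<inter> LE (f y) (G \<epsilon> ()) \<in> D)"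
    using FG unfolding \<Phi>_def by blast
  from bchoice[OF this] obtain x where x: "\<And>\<epsilon>. \<epsilon> \<in> Field \<theta> \<Longrightarrow> x \<epsilon> \<in> Field r \<and>
    (\<exists>D\<in>U. \<forall>y. x \<epsilon> \<in> underS r y \<longrightarrow> LE (F \<epsilon> ()) (f y) \<inter> LE (f y) (G \<epsilon> ()) \<in> D)" by blast
  have "|x ` Field \<theta>| <o r" by (rule card_image_ordLess[OF card_of_Field_less[OF theta tr]])
  moreover have "x ` Field \<theta> \<subseteq> Field r" using x by blast
  ultimately obtain y where y: "y \<in> Field r" "x ` Field \<theta> \<subseteq> underS r y"
    using regularCard_bound[OF r(1,2)] by metis
  obtain \<epsilon> where e: "\<epsilon> \<in> Field \<theta>" "LE (F \<epsilon> ()) (f y) \<inter> LE (f y) (G \<epsilon> ()) \<in> I"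
    using small f[OF y(1)] by blast
  obtain D where "D \<in> U" "LE (F \<epsilon> ()) (f y) \<inter> LE (f y) (G \<epsilon> ()) \<in> D"
    using x[OF e(1)] y(2) e(1) by blast
  then show False using U_I e(2) by blast
qed

text \<open>Induction on \<open>|X|\<close>. Above \<theta>, the set is dominated by a sequence
  along the cardinal \<open>|X|\<close>, increasing modulo \<open>J l\<close>; its stages exist by
  induction. A regular \<open>|X|\<close> is the previous lemma. If \<open>|X|\<close> is singular,
  a bound for a cofinal set of fewer positions bounds everything.\<close>

lemma J_bounded:
  assumes l: "Card_order l"
  shows "X \<subseteq> P \<Longrightarrow> |X| <o l \<Longrightarrow> \<exists>g\<in>P. \<forall>f\<in>X. LE g f \<in> J l"
proof (induction X rule: wf_induct_rule[OF wf_inv_image[OF wf_ordLess, of card_of]])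
  case (1 X)
  note IH = 1(1) and XP = 1(2) and Xl = 1(3)
  have IH: "\<exists>g\<in>P. \<forall>f\<in>Y. LE g f \<in> J l" if "Y \<subseteq> P" "|Y| <o |X|" for Y
    using IH[of Y] that ordLess_transitive[OF that(2) Xl] by simp
  consider "finite X" | "|X| \<le>o \<theta>" | "infinite X" "\<theta> <o |X|"
    using Card_order_trichotomy[OF theta card_of_Card_order[of X]] by blast
  then show ?case
  proof cases
    case 1
    obtain g where g: "g \<in> P" "\<And>f. f \<in> X \<Longrightarrow> LT f g = K" by (rule P_finite_bound[OF 1 XP]) blast
    have "LE g f = {}" if "f \<in> X" for f
      using LT_LE_disjoint[of f g] g that XP LE_sub[of g f] by blast
    then have "\<forall>f\<in>X. LE g f \<in> J l" using ideal_empty[OF J_ideal, of l] by simp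
    then show ?thesis
    proof (rule bexI[of _ g])
      show "g \<in> P" by (rule g(1))
    qed
  next
    case 2
    obtain g where g: "g \<in> P" "\<And>f. f \<in> X \<Longrightarrow> LE g f \<in> I" by (rule I_directed[OF XP 2]) blast
    show ?thesis
    proof (rule bexI[of _ g])
      show "\<forall>f\<in>X. LE g f \<in> J l" using g(2) I_sub_J by blast
    qed (rule g(1))
  next
    case 3
    let ?r = "|X|"
    have r: "Cinfinite ?r"
      using 3(1) card_of_Card_order[of X] unfolding cinfinite_def Field_card_of by blast
    have wo: "Well_order ?r" by (rule card_of_Well_order)
    have "\<exists>f. \<forall>x\<in>Field ?r. f x \<in> P \<and> (\<forall>h\<in>insert x (f ` underS ?r x). LE (f x) h \<in> J l)"
    proof (rule wo_choice[OF wo])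
      fix f g :: "('k \<Rightarrow> 'a) \<Rightarrow> 'k \<Rightarrow> 'a" and x y
      assume "\<And>z. z \<in> underS ?r x \<Longrightarrow> f z = g z"
      then have "f ` underS ?r x = g ` underS ?r x" by (rule image_cong[OF refl])
      then show "(y \<in> P \<and> (\<forall>h\<in>insert x (f ` underS ?r x). LE y h \<in> J l)) =
        (y \<in> P \<and> (\<forall>h\<in>insert x (g ` underS ?r x). LE y h \<in> J l))" by simp
    next
      fix f :: "('k \<Rightarrow> 'a) \<Rightarrow> 'k \<Rightarrow> 'a" and x
      assume x: "x \<in> Field ?r" and fP: "\<And>y. y \<in> underS ?r x \<Longrightarrow> f y \<in> P \<and>
        (\<forall>h\<in>insert y (f ` underS ?r y). LE (f y) h \<in> J l)"
      have "|f ` underS ?r x| <o ?r"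
        by (rule card_image_ordLess, rule card_of_underS[OF card_of_Card_order x])
      moreover have "|{x}| <o ?r" by (rule card_finite_ordLess[OF r]) simp
      ultimately have "|{x} \<union> f ` underS ?r x| <o ?r" using card_Un_ordLess[OF r] by blast
      moreover have "insert x (f ` underS ?r x) \<subseteq> P" using fP x XP unfolding Field_card_of by blast
      ultimately show "\<exists>y. y \<in> P \<and> (\<forall>h\<in>insert x (f ` underS ?r x). LE y h \<in> J l)"
        using IH[of "insert x (f ` underS ?r x)"] by auto
    qed
    then obtain f where f': "\<forall>x\<in>X. f x \<in> P \<and> (\<forall>h\<in>insert x (f ` underS ?r x). LE (f x) h \<in> J l)"
      unfolding Field_card_of ..
    have f: "\<And>x. x \<in> X \<Longrightarrow> f x \<in> P" "\<And>x. x \<in> X \<Longrightarrow> LE (f x) x \<in> J l" using f' by blast+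
    have mono: "LE (f y) (f x) \<in> J l" if "x \<in> underS ?r y" for x y
      using underS_Field_right[OF that] f' that unfolding Field_card_of by blast
    have trans: "LE g x \<in> J l" if "g \<in> P" "x \<in> X" "LE g (f x) \<in> J l" for g x
      using ideal_LE_trans[OF J_ideal, of x "f x" l g] f[OF that(2)] that XP by blast
    have "\<exists>g\<in>P. \<forall>x\<in>X. LE g (f x) \<in> J l"
    proof (cases "regularCard ?r")
      case True
      show ?thesis
        using regular_J_bounded[OF l r True Xl 3(2), of f] f(1) mono unfolding Field_card_of by blast
    next
      case False
      then obtain Z where Z: "Z \<subseteq> X" "cofinal Z ?r" "\<not> |Z| =o ?r"
        unfolding regularCard_def Field_card_of by blast
      then have "|Z| <o ?r" using card_of_mono1[OF Z(1)] ordLeq_iff_ordLess_or_ordIso by blast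
      then have "|f ` Z| <o ?r" by (rule card_image_ordLess)
      then obtain g where g: "g \<in> P" "\<And>z. z \<in> Z \<Longrightarrow> LE g (f z) \<in> J l"
        using IH[of "f ` Z"] f(1) Z(1) by blast
      have "LE g (f x) \<in> J l" if x: "x \<in> X" for x
      proof -
        obtain z where z: "z \<in> Z" "x \<in> underS ?r z"
          using Z(2) x unfolding cofinal_def underS_def Field_card_of by blast
        show ?thesis
          by (rule ideal_LE_trans[OF J_ideal f(1)[OF x] f(1) mono[OF z(2)] g(2)[OF z(1)]])
            (use Z(1) z(1) in blast)
      qed
      then show ?thesis using g(1) by blast
    qed
    then show ?thesis using trans by blast
  qed
qed

lemma J_directed: "Card_order l \<Longrightarrow> directed_card P (less_mod K lam (J l)) l"
  unfolding directed_iff using J_bounded by blast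

text \<open>Otherwise directedness at the successor of the cofinality of \<open>D\<close> would push
  that cofinality above itself.\<close>

lemma U_meets_J:
  assumes D: "D \<in> U"
  shows "D \<inter> J (cardSuc (tcfU D)) \<noteq> {}"
proof
  note c = tcf_Card_order[OF D]
  assume "D \<inter> J (cardSuc (tcfU D)) = {}"
  then have "cardSuc (tcfU D) \<le>o tcfU D"
    using directed_tcf[OF D _ J_directed] cardSuc_Card_order[OF c] by blast
  then show False using cardSuc_greater[OF c] not_ordLess_ordLeq by blast
qed

subsection \<open>Universal sequences\<close>

definition universal :: "('k \<Rightarrow> 'a) rel \<Rightarrow> (('k \<Rightarrow> 'a) \<Rightarrow> 'k \<Rightarrow> 'a) \<Rightarrow> bool" where
  "universal l f \<longleftrightarrow> (\<forall>\<alpha>\<in>Field l. f \<alpha> \<in> P) \<and> (\<forall>\<beta>. \<forall>\<alpha>\<in>underS l \<beta>. LE (f \<beta>) (f \<alpha>) \<in> J l) \<and>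
    (\<forall>D\<in>U. tcfU D = l \<longrightarrow> (\<forall>q\<in>P. \<exists>\<alpha>\<in>Field l. LT q (f \<alpha>) \<in> D))"

lemma pcf_props:
  assumes "l \<in> pcf K I lam"
  shows pcf_Cinfinite: "Cinfinite l" and pcf_regular: "regularCard l" and theta_less_pcf: "\<theta> <o l"
  using assms tcf_infinite tcf_regular theta_less_tcf unfolding pcf_iff by blast+

text \<open>Given a level \<open>F\<close>, directedness yields a sequence \<open>f\<close> above
  \<open>F\<close> that increases modulo \<open>J l\<close>. It is not universal, so some
  \<open>D\<close> of cofinality \<open>l\<close> has a single \<open>h\<close> above all of
  \<open>f\<close>, hence above all of \<open>F\<close>. A \<open>D\<close>-cofinal sequence becomes
  the next level \<open>G\<close>. Thus \<open>F\<close> stays bounded in \<open>D\<close> while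
  \<open>G\<close> is unbounded, and one \<open>u\<close> can be caught between them on every
  rung.\<close>

lemma universal_exists:
  assumes l: "l \<in> pcf K I lam"
  shows "\<exists>f. universal l f"
proof (rule ccontr)
  assume no: "\<nexists>f. universal l f"
  note linf = pcf_Cinfinite[OF l] and lreg = pcf_regular[OF l] and tl = theta_less_pcf[OF l]
  have lc: "Card_order l" using linf by blast
  have lwo: "Well_order l" by (rule Card_order_imp_Well_order[OF lc])
  define \<Phi> :: "(('k \<Rightarrow> 'a) \<Rightarrow> 'k \<Rightarrow> 'a) \<Rightarrow> (('k \<Rightarrow> 'a) \<Rightarrow> 'k \<Rightarrow> 'a) \<Rightarrow> bool" where
    "\<Phi> F G \<longleftrightarrow> (\<exists>D\<in>U. \<exists>h\<in>P. (\<forall>\<alpha>\<in>Field l. LE (F \<alpha>) h \<in> D) \<and>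
      (\<forall>\<beta>. \<forall>\<alpha>\<in>underS l \<beta>. LT (G \<alpha>) (G \<beta>) \<in> D) \<and> (\<forall>q\<in>P. \<exists>\<alpha>\<in>Field l. LT q (G \<alpha>) \<in> D))" for F G
  have step: "\<exists>G. (\<forall>b. G b \<in> P) \<and> \<Phi> F G" if F: "\<forall>b. F b \<in> P" for F
  proof -
    have "\<exists>f. \<forall>\<alpha>\<in>Field l. f \<alpha> \<in> P \<and> (\<forall>h\<in>insert (F \<alpha>) (f ` underS l \<alpha>). LE (f \<alpha>) h \<in> J l)"
    proof (rule wo_choice[OF lwo])
      fix f g :: "('k \<Rightarrow> 'a) \<Rightarrow> 'k \<Rightarrow> 'a" and x y
      assume "\<And>z. z \<in> underS l x \<Longrightarrow> f z = g z"
      then have "f ` underS l x = g ` underS l x" by (rule image_cong[OF refl])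
      then show "(y \<in> P \<and> (\<forall>h\<in>insert (F x) (f ` underS l x). LE y h \<in> J l)) =
        (y \<in> P \<and> (\<forall>h\<in>insert (F x) (g ` underS l x). LE y h \<in> J l))" by simp
    next
      fix f :: "('k \<Rightarrow> 'a) \<Rightarrow> 'k \<Rightarrow> 'a" and x
      assume x: "x \<in> Field l" and fP: "\<And>y. y \<in> underS l x \<Longrightarrow> f y \<in> P \<and>
        (\<forall>h\<in>insert (F y) (f ` underS l y). LE (f y) h \<in> J l)"
      have "|f ` underS l x| <o l"
        by (rule card_image_ordLess, rule card_of_underS[OF lc x])
      moreover have "|{F x}| <o l" by (rule card_finite_ordLess[OF linf]) simp
      ultimately have "|{F x} \<union> f ` underS l x| <o l" using card_Un_ordLess[OF linf] by blast
      moreover have "insert (F x) (f ` underS l x) \<subseteq> P" using fP F by blast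
      ultimately show "\<exists>y. y \<in> P \<and> (\<forall>h\<in>insert (F x) (f ` underS l x). LE y h \<in> J l)"
        using J_bounded[OF lc, of "insert (F x) (f ` underS l x)"] by auto
    qed
    then obtain f where f': "\<forall>\<alpha>\<in>Field l. f \<alpha> \<in> P \<and>
      (\<forall>h\<in>insert (F \<alpha>) (f ` underS l \<alpha>). LE (f \<alpha>) h \<in> J l)" ..
    have f: "\<And>\<alpha>. \<alpha> \<in> Field l \<Longrightarrow> f \<alpha> \<in> P" "\<And>\<alpha>. \<alpha> \<in> Field l \<Longrightarrow> LE (f \<alpha>) (F \<alpha>) \<in> J l"
      using f' by blast+
    have mono: "\<forall>\<beta>. \<forall>\<alpha>\<in>underS l \<beta>. LE (f \<beta>) (f \<alpha>) \<in> J l"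
    proof (intro allI ballI)
      fix \<alpha> \<beta> assume "\<alpha> \<in> underS l \<beta>"
      then show "LE (f \<beta>) (f \<alpha>) \<in> J l" using f' underS_Field_right[of \<alpha> l \<beta>] by blast
    qed
    have "\<not> universal l f" using no by blast
    then obtain D h where D: "D \<in> U" "tcfU D = l" and h: "h \<in> P" "\<And>\<alpha>. \<alpha> \<in> Field l \<Longrightarrow> LT h (f \<alpha>) \<notin> D"
      unfolding universal_def using f(1) mono by auto
    have disj: "D \<inter> J l = {}" using J_disjoint[OF D(1)] ordLeq_refl[OF lc] D(2) by blast
    have Fh: "LE (F \<alpha>) h \<in> D" if a: "\<alpha> \<in> Field l" for \<alpha>
    proof -
      have "LT (F \<alpha>) (f \<alpha>) \<in> D" using U_not_mem_LT[OF D(1) spec[OF F] f(1)[OF a]] f(2)[OF a] disj by blast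
      moreover have "LE (f \<alpha>) h \<in> D" using U_LT[OF D(1) h(1) f(1)[OF a]] h(2)[OF a] by blast
      moreover have "LT (F \<alpha>) (f \<alpha>) \<inter> LE (f \<alpha>) h \<subseteq> LE (F \<alpha>) h" using LT_LE_trans LT_sub_LE by blast
      ultimately show ?thesis using U_meet[OF D(1) _ _ _ LE_sub] by blast
    qed
    obtain p where p: "\<And>\<alpha>. \<alpha> \<in> Field l \<Longrightarrow> p \<alpha> \<in> P"
      "\<And>\<alpha> \<beta>. \<alpha> \<in> underS l \<beta> \<Longrightarrow> LT (p \<alpha>) (p \<beta>) \<in> D"
      "\<And>q. q \<in> P \<Longrightarrow> \<exists>\<alpha>\<in>Field l. LT q (p \<alpha>) \<in> D"
      by (rule tcf_seq[OF D(1), unfolded D(2)]) blast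
    \<comment> \<open>The ladder is indexed by the whole type, so off \<open>Field l\<close> some
      member of the product is filled in; \<open>h\<close> is at hand.\<close>
    define G where "G \<alpha> = (if \<alpha> \<in> Field l then p \<alpha> else h)" for \<alpha>
    have c1: "\<forall>\<beta>. \<forall>\<alpha>\<in>underS l \<beta>. LT (G \<alpha>) (G \<beta>) \<in> D"
    proof (intro allI ballI)
      fix \<alpha> \<beta> assume "\<alpha> \<in> underS l \<beta>"
      then show "LT (G \<alpha>) (G \<beta>) \<in> D"
        using p(2)[of \<alpha> \<beta>] underS_Field_left[of \<alpha> l \<beta>] underS_Field_right[of \<alpha> l \<beta>]
        unfolding G_def by simp
    qed
    have c2: "\<forall>q\<in>P. \<exists>\<alpha>\<in>Field l. LT q (G \<alpha>) \<in> D"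
    proof
      fix q assume "q \<in> P"
      then obtain \<alpha> where "\<alpha> \<in> Field l" "LT q (p \<alpha>) \<in> D" using p(3) by blast
      then show "\<exists>\<alpha>\<in>Field l. LT q (G \<alpha>) \<in> D" unfolding G_def by (intro bexI[of _ \<alpha>]) simp_all
    qed
    have "\<Phi> F G"
      unfolding \<Phi>_def
    proof (rule bexI[of _ D], rule bexI[of _ h], intro conjI)
      show "\<forall>\<alpha>\<in>Field l. LE (F \<alpha>) h \<in> D" using Fh by blast
    qed (rule c1, rule c2, rule h(1), rule D(1))
    moreover have "\<forall>b. G b \<in> P" using p(1) h(1) unfolding G_def by simp
    ultimately show ?thesis by (intro exI[of _ G] conjI)
  qed
  have "\<exists>F G. (\<forall>\<epsilon>\<in>Field \<theta>. (\<forall>b. F \<epsilon> b \<in> P \<and> G \<epsilon> b \<in> P) \<and> \<Phi> (F \<epsilon>) (G \<epsilon>)) \<and>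
      (\<forall>b. \<forall>u\<in>P. \<exists>\<epsilon>\<in>Field \<theta>. LE (F \<epsilon> b) u \<inter> LE u (G \<epsilon> b) \<in> I)"
    by (rule ladder, rule step)
  then obtain F G where FG: "\<forall>\<epsilon>\<in>Field \<theta>. (\<forall>b. F \<epsilon> b \<in> P \<and> G \<epsilon> b \<in> P) \<and> \<Phi> (F \<epsilon>) (G \<epsilon>)"
    and small: "\<forall>b. \<forall>u\<in>P. \<exists>\<epsilon>\<in>Field \<theta>. LE (F \<epsilon> b) u \<inter> LE u (G \<epsilon> b) \<in> I"
    by (elim exE conjE)
  have "\<forall>\<epsilon>\<in>Field \<theta>. \<exists>Dh. fst Dh \<in> U \<and> snd Dh \<in> P \<and> (\<forall>\<alpha>\<in>Field l. LE (F \<epsilon> \<alpha>) (snd Dh) \<in> fst Dh) \<and>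
      (\<forall>\<beta>. \<forall>\<alpha>\<in>underS l \<beta>. LT (G \<epsilon> \<alpha>) (G \<epsilon> \<beta>) \<in> fst Dh) \<and>
      (\<forall>q\<in>P. \<exists>\<alpha>\<in>Field l. LT q (G \<epsilon> \<alpha>) \<in> fst Dh)"
    using FG unfolding \<Phi>_def by (metis fst_conv snd_conv)
  from bchoice[OF this] obtain Dh where Dh: "\<forall>\<epsilon>\<in>Field \<theta>.
      fst (Dh \<epsilon>) \<in> U \<and> snd (Dh \<epsilon>) \<in> P \<and> (\<forall>\<alpha>\<in>Field l. LE (F \<epsilon> \<alpha>) (snd (Dh \<epsilon>)) \<in> fst (Dh \<epsilon>)) \<and>
      (\<forall>\<beta>. \<forall>\<alpha>\<in>underS l \<beta>. LT (G \<epsilon> \<alpha>) (G \<epsilon> \<beta>) \<in> fst (Dh \<epsilon>)) \<and>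
      (\<forall>q\<in>P. \<exists>\<alpha>\<in>Field l. LT q (G \<epsilon> \<alpha>) \<in> fst (Dh \<epsilon>))" ..
  define D where "D \<epsilon> = fst (Dh \<epsilon>)" for \<epsilon>
  define h where "h \<epsilon> = snd (Dh \<epsilon>)" for \<epsilon>
  have D: "\<And>\<epsilon>. \<epsilon> \<in> Field \<theta> \<Longrightarrow> D \<epsilon> \<in> U" and h: "\<And>\<epsilon>. \<epsilon> \<in> Field \<theta> \<Longrightarrow> h \<epsilon> \<in> P"
    and Fh: "\<And>\<epsilon> \<alpha>. \<epsilon> \<in> Field \<theta> \<Longrightarrow> \<alpha> \<in> Field l \<Longrightarrow> LE (F \<epsilon> \<alpha>) (h \<epsilon>) \<in> D \<epsilon>"
    and GG: "\<And>\<epsilon> \<alpha> \<beta>. \<epsilon> \<in> Field \<theta> \<Longrightarrow> \<alpha> \<in> underS l \<beta> \<Longrightarrow> LT (G \<epsilon> \<alpha>) (G \<epsilon> \<beta>) \<in> D \<epsilon>"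
    and cof: "\<And>\<epsilon> q. \<epsilon> \<in> Field \<theta> \<Longrightarrow> q \<in> P \<Longrightarrow> \<exists>\<alpha>\<in>Field l. LT q (G \<epsilon> \<alpha>) \<in> D \<epsilon>"
    using Dh unfolding D_def h_def by blast+
  \<comment> \<open>One \<open>u\<close> serves all rungs: it lies above every
    \<open>h \<epsilon>\<close> modulo \<open>I\<close>, hence above the row
    \<open>F \<epsilon>\<close> modulo \<open>D \<epsilon>\<close>. The position \<open>b\<close>
    beyond all \<open>a \<epsilon>\<close> then puts \<open>G \<epsilon> b\<close> above
    \<open>u\<close> in every \<open>D \<epsilon>\<close>.\<close>
  have "|h ` Field \<theta>| \<le>o \<theta>" by (rule card_image_ordLeq[OF card_of_Field_leq[OF theta ordLeq_refl[OF theta]]])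
  then obtain u where u: "u \<in> P" "\<And>\<epsilon>. \<epsilon> \<in> Field \<theta> \<Longrightarrow> LE u (h \<epsilon>) \<in> I"
    using I_directed[of "h ` Field \<theta>"] h by (metis image_subsetI imageI)
  have "\<forall>\<epsilon>\<in>Field \<theta>. \<exists>\<alpha>. \<alpha> \<in> Field l \<and> LT u (G \<epsilon> \<alpha>) \<in> D \<epsilon>" using cof[OF _ u(1)] by blast
  from bchoice[OF this] obtain a where a: "\<And>\<epsilon>. \<epsilon> \<in> Field \<theta> \<Longrightarrow> a \<epsilon> \<in> Field l"
    "\<And>\<epsilon>. \<epsilon> \<in> Field \<theta> \<Longrightarrow> LT u (G \<epsilon> (a \<epsilon>)) \<in> D \<epsilon>" by blast
  have "|a ` Field \<theta>| <o l" by (rule card_image_ordLess[OF card_of_Field_less[OF theta tl]])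
  moreover have "a ` Field \<theta> \<subseteq> Field l" using a(1) by blast
  ultimately obtain b where b: "b \<in> Field l" "a ` Field \<theta> \<subseteq> underS l b"
    using regularCard_bound[OF linf lreg] by metis
  obtain \<epsilon> where e: "\<epsilon> \<in> Field \<theta>" and bad: "LE (F \<epsilon> b) u \<inter> LE u (G \<epsilon> b) \<in> I" using small u(1) by blast
  note De = D[OF e]
  have "LT (h \<epsilon>) u \<in> D \<epsilon>" using U_not_mem_LT[OF De h[OF e] u(1)] u(2)[OF e] U_I[OF De] by blast
  moreover have "LE (F \<epsilon> b) (h \<epsilon>) \<inter> LT (h \<epsilon>) u \<subseteq> LE (F \<epsilon> b) u" using LE_LT_trans LT_sub_LE by blast
  ultimately have 1: "LE (F \<epsilon> b) u \<in> D \<epsilon>" using U_meet[OF De Fh[OF e b(1)] _ _ LE_sub] by blast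
  have "LT (G \<epsilon> (a \<epsilon>)) (G \<epsilon> b) \<in> D \<epsilon>" using GG[OF e] b(2) e by blast
  moreover have "LT u (G \<epsilon> (a \<epsilon>)) \<inter> LT (G \<epsilon> (a \<epsilon>)) (G \<epsilon> b) \<subseteq> LE u (G \<epsilon> b)"
    using LE_LT_trans[of u "G \<epsilon> (a \<epsilon>)"] LT_sub_LE by blast
  ultimately have 2: "LE u (G \<epsilon> b) \<in> D \<epsilon>" using U_meet[OF De a(2)[OF e] _ _ LE_sub] by blast
  show False using U_I[OF De U_Int[OF De 1 2]] bad by blast
qed

text \<open>The sets \<open>E \<alpha>\<close> where \<open>f \<alpha>\<close> has not passed
  \<open>q\<close> decrease modulo \<open>J l\<close>. If none were small, an ultrafilter
  \<open>D\<close> through \<open>A\<close> would contain them all and miss \<open>J l\<close>.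
  Because \<open>A\<close> lies in the ideal of the successor of \<open>l\<close>, the cofinality of
  \<open>D\<close> is exactly \<open>l\<close>; universality then gives an \<open>f \<alpha>\<close>
  above \<open>q\<close> modulo \<open>D\<close>, against \<open>E \<alpha> \<in> D\<close>.\<close>

lemma universal_cofinal:
  assumes l: "l \<in> pcf K I lam" and f: "universal l f" and A: "A \<in> J (cardSuc l)" and q: "q \<in> P"
  shows "\<exists>\<alpha>\<in>Field l. \<forall>\<beta>\<in>Field l. (\<alpha>, \<beta>) \<in> l \<longrightarrow> A \<inter> LE (f \<beta>) q \<in> J l"
proof -
  have linf: "Cinfinite l" by (rule pcf_Cinfinite[OF l])
  then have lc: "Card_order l" by blast
  have lwo: "Well_order l" by (rule Card_order_imp_Well_order[OF lc])
  have fP: "\<And>\<alpha>. \<alpha> \<in> Field l \<Longrightarrow> f \<alpha> \<in> P" and mono: "\<And>\<alpha> \<beta>. \<alpha> \<in> underS l \<beta> \<Longrightarrow> LE (f \<beta>) (f \<alpha>) \<in> J l"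
    and univ: "\<And>D. D \<in> U \<Longrightarrow> tcfU D = l \<Longrightarrow> \<exists>\<alpha>\<in>Field l. LT q (f \<alpha>) \<in> D"
    using f q unfolding universal_def by blast+
  have AK: "A \<subseteq> K" by (rule ideal_sub[OF J_ideal A])
  define E where "E \<alpha> = A \<inter> LE (f \<alpha>) q" for \<alpha>
  have dec: "E \<beta> - E \<alpha> \<in> J l" if ab: "\<alpha> \<in> Field l" "\<beta> \<in> Field l" "(\<alpha>, \<beta>) \<in> l" for \<alpha> \<beta>
  proof (cases "\<alpha> = \<beta>")
    case True then show ?thesis using ideal_empty[OF J_ideal] by simp
  next
    case False
    then have "\<alpha> \<in> underS l \<beta>" using ab(3) unfolding underS_def by blast
    moreover have "E \<beta> - E \<alpha> \<subseteq> LE (f \<beta>) (f \<alpha>)"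
      unfolding E_def using LT_compl[OF fP[OF ab(1)] fP[OF ab(2)]] LT_sub_LE[of "f \<alpha>" "f \<beta>"]
        LE_trans[of "f \<alpha>" "f \<beta>" q] LE_sub[of "f \<beta>" q] by blast
    ultimately show ?thesis using ideal_down[OF J_ideal mono] by blast
  qed
  have "\<exists>\<alpha>\<in>Field l. E \<alpha> \<in> J l"
  proof (rule ccontr)
    assume no: "\<not> (\<exists>\<alpha>\<in>Field l. E \<alpha> \<in> J l)"
    \<comment> \<open>An ultrafilter that misses \<open>M\<close> contains every
      \<open>E \<alpha>\<close>, since \<open>K - E \<alpha>\<close> belongs to
      \<open>M\<close>.\<close>
    define M where "M = {X. X \<subseteq> K \<and> (\<exists>\<alpha>\<in>Field l. X \<inter> E \<alpha> \<in> J l)}"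
    obtain \<alpha>0 where a0: "\<alpha>0 \<in> Field l" using linf unfolding cinfinite_def by (metis finite.emptyI equals0I)
    have M: "ideal_on K M"
      unfolding ideal_on_def
    proof (intro conjI ballI allI impI)
      show "M \<subseteq> Pow K" unfolding M_def by blast
      show "{} \<in> M" unfolding M_def using a0 ideal_empty[OF J_ideal] by auto
    next
      fix X Y assume "X \<in> M" "Y \<subseteq> X"
      then obtain \<alpha> where "X \<subseteq> K" "\<alpha> \<in> Field l" "X \<inter> E \<alpha> \<in> J l" "Y \<inter> E \<alpha> \<subseteq> X \<inter> E \<alpha>"
        unfolding M_def by blast
      then show "Y \<in> M" unfolding M_def using ideal_down[OF J_ideal] \<open>Y \<subseteq> X\<close> by blast
    next
      fix X Y assume "X \<in> M" "Y \<in> M"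
      then obtain \<alpha> \<beta> where XY: "X \<subseteq> K" "Y \<subseteq> K" and ab: "\<alpha> \<in> Field l" "\<beta> \<in> Field l"
        and XE: "X \<inter> E \<alpha> \<in> J l" and YE: "Y \<inter> E \<beta> \<in> J l"
        unfolding M_def by blast
      have "\<exists>\<gamma>\<in>Field l. (\<alpha>, \<gamma>) \<in> l \<and> (\<beta>, \<gamma>) \<in> l"
        using underS_linear[OF lwo ab] wo_le_refl[OF lwo ab(1)] wo_le_refl[OF lwo ab(2)]
          underS_imp_le[of \<alpha> l \<beta>] underS_imp_le[of \<beta> l \<alpha>] ab by metis
      then obtain \<gamma> where g: "\<gamma> \<in> Field l" "(\<alpha>, \<gamma>) \<in> l" "(\<beta>, \<gamma>) \<in> l" by blast
      have 1: "X \<inter> E \<gamma> \<in> J l"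
        by (rule ideal_cover[OF J_ideal XE dec[OF ab(1) g(1,2)]]) blast
      have 2: "Y \<inter> E \<gamma> \<in> J l"
        by (rule ideal_cover[OF J_ideal YE dec[OF ab(2) g(1,3)]]) blast
      have "(X \<union> Y) \<inter> E \<gamma> \<in> J l" by (rule ideal_cover[OF J_ideal 1 2]) blast
      then show "X \<union> Y \<in> M" unfolding M_def using XY g(1) by blast
    qed
    have JM: "J l \<subseteq> M" unfolding M_def using a0 ideal_down[OF J_ideal] ideal_sub[OF J_ideal] by blast
    have "A \<notin> M"
    proof
      assume "A \<in> M"
      then obtain \<alpha> where "\<alpha> \<in> Field l" "A \<inter> E \<alpha> \<in> J l" unfolding M_def by blast
      moreover have "A \<inter> E \<alpha> = E \<alpha>" unfolding E_def by blast
      ultimately show False using no by simp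
    qed
    then obtain D where D: "D \<in> U" "A \<in> D" "D \<inter> M = {}"
      using exists_U[OF M _ AK] JM I_sub_J[of l] by (metis subset_trans)
    have "D \<inter> J l = {}" using D(3) JM by blast
    then have "l \<le>o tcfU D" using directed_tcf[OF D(1) _ J_directed[OF lc] lc] by blast
    moreover have "\<not> cardSuc l \<le>o tcfU D" using A D unfolding J_iff by blast
    then have "tcfU D <o cardSuc l"
      using Card_order_trichotomy[OF tcf_Card_order[OF D(1)] cardSuc_Card_order[OF lc]] by blast
    then have "tcfU D \<le>o l" using cardSuc_ordLeq_ordLess[OF lc tcf_Card_order[OF D(1)]] by blast
    ultimately have "tcfU D =o l" unfolding ordIso_iff_ordLeq by blast
    then have "tcfU D = l" using l tcf_eq[OF D(1)] unfolding pcf_iff by blast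
    then obtain \<alpha> where \<alpha>: "\<alpha> \<in> Field l" "LT q (f \<alpha>) \<in> D" using univ[OF D(1)] by blast
    have "(K - E \<alpha>) \<inter> E \<alpha> = {}" by blast
    then have "(K - E \<alpha>) \<inter> E \<alpha> \<in> J l" using ideal_empty[OF J_ideal] by simp
    then have "K - E \<alpha> \<in> M" unfolding M_def using \<alpha>(1) by blast
    then have "E \<alpha> \<in> D" using D(3) U_cases[OF D(1), of "E \<alpha>"] AK unfolding E_def by blast
    then have "LT q (f \<alpha>) \<inter> E \<alpha> \<noteq> {}" using U_disj[OF D(1) \<alpha>(2)] by blast
    then show False unfolding E_def using LT_LE_disjoint[OF q fP[OF \<alpha>(1)]] by blast
  qed
  then obtain \<alpha> where \<alpha>: "\<alpha> \<in> Field l" "E \<alpha> \<in> J l" by blast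
  have "E \<beta> \<in> J l" if "\<beta> \<in> Field l" "(\<alpha>, \<beta>) \<in> l" for \<beta>
    by (rule ideal_cover[OF J_ideal \<alpha>(2) dec[OF \<alpha>(1) that]]) blast
  then show ?thesis using \<alpha>(1) unfolding E_def by blast
qed

subsection \<open>Generators\<close>

lemma universal_has_tcf:
  assumes l: "l \<in> pcf K I lam" and f: "universal l f" and A: "A \<in> J (cardSuc l)"
  shows "has_tcf (card_prod A lam) (less_mod A lam (J l)) l"
  unfolding has_tcf_def
proof (intro exI conjI ballI)
  have AK: "A \<subseteq> K" by (rule ideal_sub[OF J_ideal A])
  have fP: "\<And>\<alpha>. \<alpha> \<in> Field l \<Longrightarrow> f \<alpha> \<in> P" and mono: "\<And>\<alpha> \<beta>. \<alpha> \<in> underS l \<beta> \<Longrightarrow> LE (f \<beta>) (f \<alpha>) \<in> J l"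
    using f unfolding universal_def by blast+
  {
    fix \<alpha> assume a: "\<alpha> \<in> Field l"
    show "restrict (f \<alpha>) A \<in> card_prod A lam"
      unfolding card_prod_def using P_Field[OF fP[OF a]] AK by auto
  next
    fix \<alpha> \<beta> assume b: "\<beta> \<in> Field l" and a: "\<alpha> \<in> underS l \<beta>"
    have "{i\<in>A. restrict (f \<alpha>) A i \<notin> underS (lam i) (restrict (f \<beta>) A i)} \<subseteq> K - LT (f \<alpha>) (f \<beta>)"
      unfolding LT_def using AK by auto
    then show "less_mod A lam (J l) (restrict (f \<alpha>) A) (restrict (f \<beta>) A)"
      unfolding less_mod_def LT_compl[OF fP[OF underS_Field_left[OF a]] fP[OF b]]
      by (rule ideal_down[OF J_ideal mono[OF a]])
  next
    fix q assume q: "q \<in> card_prod A lam"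
    obtain p0 where p0: "p0 \<in> P" using P_nonempty by blast
    define q' where "q' = (\<lambda>i\<in>K. if i \<in> A then q i else p0 i)"
    have q': "q' \<in> P"
      unfolding q'_def card_prod_def
      using q P_Field[OF p0] unfolding card_prod_def by (auto dest: PiE_mem)
    obtain \<alpha> where a: "\<alpha> \<in> Field l" "\<forall>\<beta>\<in>Field l. (\<alpha>, \<beta>) \<in> l \<longrightarrow> A \<inter> LE (f \<beta>) q' \<in> J l"
      using universal_cofinal[OF l f A q'] by blast
    have "(\<alpha>, \<alpha>) \<in> l"
      using wo_le_refl[OF Card_order_imp_Well_order a(1)] pcf_Cinfinite[OF l] by blast
    then have "A \<inter> LE (f \<alpha>) q' \<in> J l" using a by blast
    moreover have "{i\<in>A. q i \<notin> underS (lam i) (restrict (f \<alpha>) A i)} \<subseteq> A \<inter> (K - LT q' (f \<alpha>))"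
      unfolding LT_def q'_def using AK by auto
    ultimately have "less_mod A lam (J l) q (restrict (f \<alpha>) A)"
      unfolding less_mod_def LT_compl[OF q' fP[OF a(1)]] using ideal_down[OF J_ideal] by blast
    then show "\<exists>\<alpha>\<in>Field l. less_mod A lam (J l) q (restrict (f \<alpha>) A)" using a(1) by blast
  }
qed

lemma weakest_pcf: "weakest_pcf_th K I lam (cardSuc \<theta>)"
  unfolding weakest_pcf_th_def using cardSuc_directed J_directed by blast

lemma pcf_bound:
  assumes l: "l \<in> pcf K I lam" and X: "X \<subseteq> P" "|X| \<le>o l"
  shows "\<exists>g\<in>P. \<forall>f\<in>X. LE g f \<in> J (cardSuc l)"
proof -
  have lc: "Card_order l" using pcf_Cinfinite[OF l] by blast
  have "|X| <o cardSuc l" by (rule ordLeq_ordLess_trans[OF X(2) cardSuc_greater[OF lc]])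
  then show ?thesis by (rule J_bounded[OF cardSuc_Card_order[OF lc] X(1)])
qed

text \<open>The generators lie in the ideal of the successor of \<mu> because \<open>g \<mu>\<close>
  bounds the universal sequence there. Conversely, on any \<open>A\<close> of that ideal the
  sequence is cofinal, so some \<open>f \<mu> \<alpha>\<close> passes \<open>g \<mu>\<close> on
  \<open>A\<close>, and \<open>A\<close> is contained in \<open>B \<mu> \<alpha>\<close> modulo
  \<open>J \<mu>\<close>.\<close>

lemma weak_pcf: "weak_pcf_th K I lam (cardSuc \<theta>)"
proof -
  have "\<forall>\<mu>\<in>pcf K I lam. \<exists>fg. universal \<mu> (fst fg) \<and> snd fg \<in> P \<and>
    (\<forall>\<alpha>\<in>Field \<mu>. LE (snd fg) (fst fg \<alpha>) \<in> J (cardSuc \<mu>))"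
  proof
    fix \<mu> assume \<mu>: "\<mu> \<in> pcf K I lam"
    have \<mu>c: "Card_order \<mu>" using pcf_Cinfinite[OF \<mu>] by blast
    obtain f where f: "universal \<mu> f" using universal_exists[OF \<mu>] by blast
    have "f ` Field \<mu> \<subseteq> P" using f unfolding universal_def by blast
    moreover have "|f ` Field \<mu>| \<le>o \<mu>"
      by (rule card_image_ordLeq[OF card_of_Field_leq[OF \<mu>c ordLeq_refl[OF \<mu>c]]])
    ultimately obtain g where "g \<in> P" "\<forall>h\<in>f ` Field \<mu>. LE g h \<in> J (cardSuc \<mu>)"
      using pcf_bound[OF \<mu>] by blast
    then show "\<exists>fg. universal \<mu> (fst fg) \<and> snd fg \<in> P \<and>
      (\<forall>\<alpha>\<in>Field \<mu>. LE (snd fg) (fst fg \<alpha>) \<in> J (cardSuc \<mu>))"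
      using f by (intro exI[of _ "(f, g)"]) simp
  qed
  from bchoice[OF this] obtain fg where fg: "\<forall>\<mu>\<in>pcf K I lam. universal \<mu> (fst (fg \<mu>)) \<and> snd (fg \<mu>) \<in> P \<and>
    (\<forall>\<alpha>\<in>Field \<mu>. LE (snd (fg \<mu>)) (fst (fg \<mu>) \<alpha>) \<in> J (cardSuc \<mu>))" ..
  define f where "f \<mu> = fst (fg \<mu>)" for \<mu>
  define g where "g \<mu> = snd (fg \<mu>)" for \<mu>
  have f: "\<And>\<mu>. \<mu> \<in> pcf K I lam \<Longrightarrow> universal \<mu> (f \<mu>)" and g: "\<And>\<mu>. \<mu> \<in> pcf K I lam \<Longrightarrow> g \<mu> \<in> P"
    and Jg: "\<And>\<mu> \<alpha>. \<mu> \<in> pcf K I lam \<Longrightarrow> \<alpha> \<in> Field \<mu> \<Longrightarrow> LE (g \<mu>) (f \<mu> \<alpha>) \<in> J (cardSuc \<mu>)"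
    using fg unfolding f_def g_def by blast+
  define B where "B \<mu> \<alpha> = LE (g \<mu>) (f \<mu> \<alpha>)" for \<mu> \<alpha>
  have fP: "f \<mu> \<alpha> \<in> P" if "\<mu> \<in> pcf K I lam" "\<alpha> \<in> Field \<mu>" for \<mu> \<alpha>
    using f[OF that(1)] that(2) unfolding universal_def by blast
  have mono: "B \<mu> \<alpha> - B \<mu> \<beta> \<in> J \<mu>" if \<mu>: "\<mu> \<in> pcf K I lam" and b: "\<beta> \<in> Field \<mu>" and a: "\<alpha> \<in> underS \<mu> \<beta>"
    for \<mu> \<alpha> \<beta>
  proof -
    note a' = underS_Field_left[OF a]
    have "LE (f \<mu> \<beta>) (f \<mu> \<alpha>) \<in> J \<mu>" using f[OF \<mu>] a unfolding universal_def by blast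
    moreover have "B \<mu> \<alpha> - B \<mu> \<beta> \<subseteq> LE (f \<mu> \<beta>) (f \<mu> \<alpha>)"
      unfolding B_def using LT_compl[OF fP[OF \<mu> a'] fP[OF \<mu> b]] LT_sub_LE[of "f \<mu> \<alpha>" "f \<mu> \<beta>"]
        LE_trans[of "g \<mu>" "f \<mu> \<alpha>" "f \<mu> \<beta>"] LE_sub[of "g \<mu>" "f \<mu> \<alpha>"] by blast
    ultimately show ?thesis by (rule ideal_down[OF J_ideal])
  qed
  have gen: "\<exists>C\<in>B \<mu> ` Field \<mu>. A - C \<in> J \<mu>" if \<mu>: "\<mu> \<in> pcf K I lam" and A: "A \<in> J (cardSuc \<mu>)" for \<mu> A
  proof -
    obtain \<alpha> where a: "\<alpha> \<in> Field \<mu>" "\<forall>\<beta>\<in>Field \<mu>. (\<alpha>, \<beta>) \<in> \<mu> \<longrightarrow> A \<inter> LE (f \<mu> \<beta>) (g \<mu>) \<in> J \<mu>"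
      using universal_cofinal[OF \<mu> f[OF \<mu>] A g[OF \<mu>]] by blast
    have "(\<alpha>, \<alpha>) \<in> \<mu>"
      using wo_le_refl[OF Card_order_imp_Well_order a(1)] pcf_Cinfinite[OF \<mu>] by blast
    then have "A \<inter> LE (f \<mu> \<alpha>) (g \<mu>) \<in> J \<mu>" using a by blast
    moreover have "A - B \<mu> \<alpha> \<subseteq> A \<inter> LE (f \<mu> \<alpha>) (g \<mu>)"
      unfolding B_def using LE_compl[OF g[OF \<mu>] fP[OF \<mu> a(1)]] LT_sub_LE[of "f \<mu> \<alpha>" "g \<mu>"]
        ideal_sub[OF J_ideal A] by blast
    ultimately have "A - B \<mu> \<alpha> \<in> J \<mu>" using ideal_down[OF J_ideal] by blast
    then show ?thesis using a(1) by blast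
  qed
  have sub: "B \<mu> ` Field \<mu> \<subseteq> J (cardSuc \<mu>)" if "\<mu> \<in> pcf K I lam" for \<mu>
    unfolding B_def using Jg[OF that] by blast
  have eq: "(\<Union>\<mu>\<in>{\<mu>. \<mu> \<in> pcf K I lam \<and> \<mu> <o l}. B \<mu> ` Field \<mu>) =
    {B \<mu> \<alpha> |\<mu> \<alpha>. \<mu> \<in> pcf K I lam \<and> \<mu> <o l \<and> \<alpha> \<in> Field \<mu>}" for l :: "('k \<Rightarrow> 'a) set rel" by blast
  have "J l = ideal_plus K I {B \<mu> \<alpha> |\<mu> \<alpha>. \<mu> \<in> pcf K I lam \<and> \<mu> <o l \<and> \<alpha> \<in> Field \<mu>}"
    if "Card_order l" for l :: "('k \<Rightarrow> 'a) set rel"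
    unfolding eq[symmetric] by (rule ideal_plus_J[OF sub gen U_meets_J that])
  moreover have "has_tcf (card_prod (B \<mu> \<alpha>) lam) (less_mod (B \<mu> \<alpha>) lam (J \<mu>)) \<mu>"
    if "\<mu> \<in> pcf K I lam" "\<alpha> \<in> Field \<mu>" for \<mu> \<alpha>
    by (rule universal_has_tcf[OF that(1) f[OF that(1)]]) (use Jg[OF that] in \<open>simp add: B_def\<close>)
  moreover have "B \<mu> \<alpha> \<subseteq> K" for \<mu> \<alpha> unfolding B_def by (rule LE_sub)
  ultimately show ?thesis
    unfolding weak_pcf_th_def using weakest_pcf mono by (intro conjI exI[of _ B]) simp_all
qed

text \<open>
  If \<open>g\<close> bounds the functions \<open>F s\<close> modulo \<open>J (cardSuc l)\<close> and no \<open>LE g (F s)\<close> is a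
  generator, then above each \<open>LE g (F s)\<close> the universal sequence still exceeds \<open>g\<close> on a positive
  set; along a guessed chain these positive sets are almost disjoint.
\<close>

lemma generator_exists:
  assumes l: "l \<in> pcf K I lam" and guess: "guessing \<theta> l"
  shows "\<exists>C\<in>J (cardSuc l). \<forall>A\<in>J (cardSuc l). A - C \<in> J l"
proof (rule ccontr)
  assume no: "\<not> ?thesis"
  have lc: "Card_order l" using pcf_Cinfinite[OF l] by blast
  have lwo: "Well_order l" by (rule Card_order_imp_Well_order[OF lc])
  obtain f where f: "universal l f" using universal_exists[OF l] by blast
  have fP: "\<And>\<alpha>. \<alpha> \<in> Field l \<Longrightarrow> f \<alpha> \<in> P" using f unfolding universal_def by blast
  obtain S where S: "|S| \<le>o l" "\<forall>s\<in>S. \<forall>j b. s j = Some b \<longrightarrow> b \<in> Field l"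
    and S_guess: "\<forall>\<beta>. (\<forall>s\<in>S. \<beta> s \<in> Field l) \<longrightarrow>
        (\<exists>x j. (\<forall>\<epsilon>\<in>Field \<theta>. x \<epsilon> \<in> Field l \<and> j \<epsilon> \<in> Field \<theta> \<and>
           (\<exists>s\<in>S. \<beta> s \<in> underS l (x \<epsilon>) \<and> (\<forall>\<zeta>\<in>underS \<theta> \<epsilon>. s (j \<zeta>) = Some (x \<zeta>)))))"
    using guess unfolding guessing_def by (elim exE conjE)
  \<comment> \<open>\<open>F s\<close> passes, at \<open>i\<close>, every recorded function whose
    label lies in \<open>H i\<close>, whether or not a later chain uses it.\<close>
  have "\<forall>s\<in>S. \<exists>F. F \<in> P \<and> (\<forall>i\<in>K. \<forall>j\<in>Field \<theta> \<inter> H i. \<forall>b. s j = Some b \<longrightarrow> f b i \<in> underS (lam i) (F i))"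
  proof
    fix s assume s: "s \<in> S"
    have W: "f (the (s j)) \<in> P" if "j \<in> {j\<in>Field \<theta>. s j \<noteq> None}" for j
      using that S(2) s fP by auto
    obtain F where F: "F \<in> P" "\<And>i j. i \<in> K \<Longrightarrow> j \<in> {j\<in>Field \<theta>. s j \<noteq> None} \<Longrightarrow> j \<in> H i \<Longrightarrow>
        f (the (s j)) i \<in> underS (lam i) (F i)"
      by (rule H_bound[of "{j\<in>Field \<theta>. s j \<noteq> None}" "\<lambda>j. f (the (s j))", OF _ W]) auto
    have "\<forall>i\<in>K. \<forall>j\<in>Field \<theta> \<inter> H i. \<forall>b. s j = Some b \<longrightarrow> f b i \<in> underS (lam i) (F i)"
    proof (intro ballI allI impI)
      fix i j b assume "i \<in> K" "j \<in> Field \<theta> \<inter> H i" "s j = Some b"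
      then show "f b i \<in> underS (lam i) (F i)" using F(2)[of i j] by simp
    qed
    then show "\<exists>F. F \<in> P \<and> (\<forall>i\<in>K. \<forall>j\<in>Field \<theta> \<inter> H i. \<forall>b. s j = Some b \<longrightarrow> f b i \<in> underS (lam i) (F i))"
      using F(1) by blast
  qed
  from bchoice[OF this] obtain F where F: "\<forall>s\<in>S. F s \<in> P \<and>
      (\<forall>i\<in>K. \<forall>j\<in>Field \<theta> \<inter> H i. \<forall>b. s j = Some b \<longrightarrow> f b i \<in> underS (lam i) (F s i))" ..
  have "F ` S \<subseteq> P" using F by blast
  moreover have "|F ` S| \<le>o l" by (rule card_image_ordLeq[OF S(1)])
  ultimately obtain g where g: "g \<in> P" "\<forall>h\<in>F ` S. LE g h \<in> J (cardSuc l)"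
    using pcf_bound[OF l] by blast
  \<comment> \<open>Origin of the challenge: the candidate \<open>LE g (F s)\<close> fails, with
    witness \<open>A\<close>. On \<open>A\<close> the universal sequence eventually passes
    \<open>g\<close>, so past the challenge \<open>g\<close> sits between \<open>F s\<close> and the
    sequence on a positive set.\<close>
  have "\<forall>s\<in>S. \<exists>\<alpha>. \<alpha> \<in> Field l \<and> (\<forall>\<beta>. \<alpha> \<in> underS l \<beta> \<longrightarrow> LE (F s) g \<inter> LE g (f \<beta>) \<notin> J l)"
  proof
    fix s assume s: "s \<in> S"
    then have "LE g (F s) \<in> J (cardSuc l)" using g(2) by blast
    then obtain A where A: "A \<in> J (cardSuc l)" "A - LE g (F s) \<notin> J l" using no by blast
    obtain \<alpha> where a: "\<alpha> \<in> Field l" "\<forall>\<beta>\<in>Field l. (\<alpha>, \<beta>) \<in> l \<longrightarrow> A \<inter> LE (f \<beta>) g \<in> J l"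
      using universal_cofinal[OF l f A(1) g(1)] by blast
    have "LE (F s) g \<inter> LE g (f \<beta>) \<notin> J l" if b: "\<alpha> \<in> underS l \<beta>" for \<beta>
    proof
      assume m: "LE (F s) g \<inter> LE g (f \<beta>) \<in> J l"
      note bF = underS_Field_right[OF b]
      have "A \<inter> LE (f \<beta>) g \<in> J l" using a(2) bF underS_imp_le[OF b] by blast
      moreover have "A - LE g (F s) \<subseteq> (A \<inter> LE (f \<beta>) g) \<union> (LE (F s) g \<inter> LE g (f \<beta>))"
      proof -
        have "F s \<in> P" using F s by blast
        then show ?thesis
          using LE_compl[OF g(1), of "F s"] LE_compl[OF g(1) fP[OF bF]] LT_sub_LE[of "F s" g]
            LT_sub_LE[of "f \<beta>" g] ideal_sub[OF J_ideal A(1)] by auto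
      qed
      ultimately have "A - LE g (F s) \<in> J l" using ideal_cover[OF J_ideal _ m] by blast
      then show False using A(2) by blast
    qed
    then show "\<exists>\<alpha>. \<alpha> \<in> Field l \<and> (\<forall>\<beta>. \<alpha> \<in> underS l \<beta> \<longrightarrow> LE (F s) g \<inter> LE g (f \<beta>) \<notin> J l)"
      using a(1) by blast
  qed
  from bchoice[OF this] obtain \<beta> where \<beta>: "\<forall>s\<in>S. \<beta> s \<in> Field l \<and>
      (\<forall>x. \<beta> s \<in> underS l x \<longrightarrow> LE (F s) g \<inter> LE g (f x) \<notin> J l)" ..
  then have "\<forall>s\<in>S. \<beta> s \<in> Field l" by blast
  then obtain x j where xj: "\<forall>\<epsilon>\<in>Field \<theta>. x \<epsilon> \<in> Field l \<and> j \<epsilon> \<in> Field \<theta> \<and>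
      (\<exists>s\<in>S. \<beta> s \<in> underS l (x \<epsilon>) \<and> (\<forall>\<zeta>\<in>underS \<theta> \<epsilon>. s (j \<zeta>) = Some (x \<zeta>)))"
    using S_guess by (elim allE[of _ \<beta>] impE exE)
  then have "\<forall>\<epsilon>\<in>Field \<theta>. \<exists>s. s \<in> S \<and> \<beta> s \<in> underS l (x \<epsilon>) \<and> (\<forall>\<zeta>\<in>underS \<theta> \<epsilon>. s (j \<zeta>) = Some (x \<zeta>))"
    by blast
  from bchoice[OF this] obtain s where s: "\<forall>\<epsilon>\<in>Field \<theta>. s \<epsilon> \<in> S \<and> \<beta> (s \<epsilon>) \<in> underS l (x \<epsilon>) \<and>
      (\<forall>\<zeta>\<in>underS \<theta> \<epsilon>. s \<epsilon> (j \<zeta>) = Some (x \<zeta>))" ..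
  define V where "V \<epsilon> = LE (F (s \<epsilon>)) g \<inter> LE g (f (x \<epsilon>))" for \<epsilon>
  have V: "V \<epsilon> \<notin> I" if "\<epsilon> \<in> Field \<theta>" for \<epsilon>
    unfolding V_def using s \<beta> that I_sub_J[of l] by blast
  have "\<exists>\<epsilon>\<in>Field \<theta>. V \<epsilon> \<in> I"
  \<comment> \<open>On an overlap with \<open>j \<zeta>\<close> in \<open>H i\<close> the record
    gives the impossible \<open>g \<le> f (x \<zeta>) < F (s \<epsilon>) \<le> g\<close> at
    \<open>i\<close>.\<close>
  proof (rule almost_disjoint[where N = "\<lambda>\<zeta>. {i\<in>K. j \<zeta> \<notin> H i}"])
    fix \<epsilon> assume "\<epsilon> \<in> Field \<theta>"
    then show "{i\<in>K. j \<epsilon> \<notin> H i} \<in> I" using H_large xj by blast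
    show "V \<epsilon> \<subseteq> K" unfolding V_def using LE_sub by blast
  next
    fix \<epsilon> \<zeta> assume z: "\<zeta> \<in> underS \<theta> \<epsilon>"
    note e = underS_Field_right[OF z] and z' = underS_Field_left[OF z]
    show "V \<zeta> \<inter> V \<epsilon> \<subseteq> {i\<in>K. j \<zeta> \<notin> H i}"
    proof
      fix i assume i: "i \<in> V \<zeta> \<inter> V \<epsilon>"
      then have iK: "i \<in> K" and le: "(g i, f (x \<zeta>) i) \<in> lam i" "(F (s \<epsilon>) i, g i) \<in> lam i"
        unfolding V_def LE_def by auto
      have "j \<zeta> \<notin> H i"
      proof
        assume "j \<zeta> \<in> H i"
        moreover have "j \<zeta> \<in> Field \<theta>" using xj z' by blast
        moreover have "s \<epsilon> (j \<zeta>) = Some (x \<zeta>)" "s \<epsilon> \<in> S" using s e z by blast+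
        ultimately have lt: "f (x \<zeta>) i \<in> underS (lam i) (F (s \<epsilon>) i)" using F iK by blast
        have "g i \<in> underS (lam i) (g i)"
          by (rule le_underS_trans[OF lam_wo[OF iK] le(1) underS_le_trans[OF lam_wo[OF iK] lt le(2)]])
        then show False using underS_irrefl by fast
      qed
      then show "i \<in> {i\<in>K. j \<zeta> \<notin> H i}" using iK by blast
    qed
  qed
  then show False using V by blast
qed

lemma pcf_generators:
  assumes guess: "\<And>l. l \<in> pcf K I lam \<Longrightarrow> guessing \<theta> l"
  shows "pcf_th K I lam (cardSuc \<theta>)"
proof -
  have "\<forall>l\<in>pcf K I lam. \<exists>C. C \<in> J (cardSuc l) \<and> (\<forall>A\<in>J (cardSuc l). A - C \<in> J l)"
    using generator_exists guess by blast
  from bchoice[OF this] obtain B where B: "\<forall>l\<in>pcf K I lam. B l \<in> J (cardSuc l) \<and>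
    (\<forall>A\<in>J (cardSuc l). A - B l \<in> J l)" ..
  have BK: "B \<mu> \<subseteq> K" if "\<mu> \<in> pcf K I lam" for \<mu> using B that ideal_sub[OF J_ideal] by blast
  have eq: "(\<Union>\<mu>\<in>{\<mu>. \<mu> \<in> pcf K I lam \<and> \<mu> <o l}. {B \<mu>}) =
    {B \<mu> |\<mu>. \<mu> \<in> pcf K I lam \<and> \<mu> <o l}" for l :: "('k \<Rightarrow> 'a) set rel" by blast
  have "J l = ideal_plus K I {B \<mu> |\<mu>. \<mu> \<in> pcf K I lam \<and> \<mu> <o l}"
    if "Card_order l" for l :: "('k \<Rightarrow> 'a) set rel"
    unfolding eq[symmetric] by (rule ideal_plus_J[OF _ _ U_meets_J that]) (use B in blast)+
  \<comment> \<open>Otherwise the ideals of \<mu> and of its successor would coincide, but an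
    ultrafilter of cofinality \<mu> meets the second and misses the first.\<close>
  moreover have "B \<mu> \<notin> J \<mu>" if \<mu>: "\<mu> \<in> pcf K I lam" for \<mu>
  proof
    assume m: "B \<mu> \<in> J \<mu>"
    obtain D where D: "D \<in> U" "\<mu> = tcfU D" using \<mu> unfolding pcf_iff by blast
    obtain A where A: "A \<in> D" "A \<in> J (cardSuc \<mu>)" using U_meets_J[OF D(1)] D(2) by blast
    have "A - B \<mu> \<in> J \<mu>" using B \<mu> A(2) by blast
    then have "A \<in> J \<mu>" by (rule ideal_cover[OF J_ideal m]) blast
    then show False
      using J_disjoint[OF D(1) ordLeq_refl[OF tcf_Card_order[OF D(1)]]] A(1) D(2) by blast
  qed
  moreover have "has_tcf (card_prod (B \<mu>) lam) (less_mod (B \<mu>) lam (J \<mu>)) \<mu>"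
    if \<mu>: "\<mu> \<in> pcf K I lam" for \<mu>
  proof -
    obtain f where f: "universal \<mu> f" using universal_exists[OF \<mu>] by blast
    show ?thesis by (rule universal_has_tcf[OF \<mu> f]) (use B \<mu> in blast)
  qed
  ultimately show ?thesis
    unfolding pcf_th_def using weakest_pcf BK by (intro conjI exI[of _ B]) simp_all
qed

end


section \<open>The hypothesis on the sequence, the ideal and the cardinal\<close>

text \<open>The minimum is attained because a partition of \<open>K\<close> is an image of
  \<open>K\<close>, so none has the size of the successor of \<open>|K|\<close>.\<close>

lemma wsat_props:
  fixes K :: "'k set"
  shows "Card_order (wsat K I)" "wsat K I \<noteq> {}"
    "\<not> (\<exists>P. partition_on K P \<and> P \<subseteq> positive_sets K I \<and> |P| =o wsat K I)"
proof -
  let ?Q = "\<lambda>r. r \<noteq> {} \<and> \<not> (\<exists>P. partition_on K P \<and> P \<subseteq> positive_sets K I \<and> |P| =o r)"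
  have "\<not> |P| =o cardSuc |K|" if P: "partition_on K P" for P
  proof
    assume eq: "|P| =o cardSuc |K|"
    have "P \<subseteq> (\<lambda>k. THE p. p \<in> P \<and> k \<in> p) ` K"
    proof
      fix p assume p: "p \<in> P"
      then have "p \<noteq> {}" using P unfolding partition_on_def by metis
      then obtain k where k: "k \<in> p" by auto
      have "(THE p. p \<in> P \<and> k \<in> p) = p"
        using P p k unfolding partition_on_def disjoint_def by (intro the_equality) blast+
      moreover have "k \<in> K" using P p k unfolding partition_on_def by blast
      ultimately show "p \<in> (\<lambda>k. THE p. p \<in> P \<and> k \<in> p) ` K" by (intro image_eqI) auto
    qed
    from card_of_mono1[OF this] have "|P| \<le>o |K|" by (rule ordLeq_transitive[OF _ card_of_image])
    then have "cardSuc |K| \<le>o |K|" by (rule ordIso_ordLeq_trans[OF ordIso_symmetric[OF eq]])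
    then show False using cardSuc_greater[OF card_of_Card_order[of K]] not_ordLess_ordLeq by blast
  qed
  moreover have "cardSuc |K| \<noteq> {}"
    using Field_cardSuc_not_empty[OF card_of_Card_order[of K]] by auto
  ultimately have Q: "?Q (cardSuc |K| )" by blast
  note l = least_card_props[of "cardSuc |K|" ?Q, OF cardSuc_Card_order[OF card_of_Card_order] Q,
      folded wsat_def]
  show "Card_order (wsat K I)" by (rule l(1))
  show "wsat K I \<noteq> {}" "\<not> (\<exists>P. partition_on K P \<and> P \<subseteq> positive_sets K I \<and> |P| =o wsat K I)"
    using l(2) by blast+
qed

context reduced_product
begin

text \<open>A disjoint family of \<theta> positive sets would yield a forbidden partition: keep
  \<open>wsat\<close> many of them and replace the one at \<open>w0\<close> by everything the others
  leave uncovered.\<close>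

lemma wsat_saturated:
  assumes theta: "Card_order \<theta>" and wsat: "wsat K I \<le>o \<theta>"
    and V: "\<And>\<epsilon>. \<epsilon> \<in> Field \<theta> \<Longrightarrow> V \<epsilon> \<subseteq> K \<and> V \<epsilon> \<notin> I"
  shows "\<exists>\<epsilon>\<in>Field \<theta>. \<exists>\<zeta>\<in>Field \<theta>. \<epsilon> \<noteq> \<zeta> \<and> V \<epsilon> \<inter> V \<zeta> \<noteq> {}"
proof (rule ccontr)
  assume no: "\<not> ?thesis"
  let ?w = "wsat K I"
  have disj: "V \<epsilon> \<inter> V \<zeta> = {}" if "\<epsilon> \<in> Field \<theta>" "\<zeta> \<in> Field \<theta>" "\<epsilon> \<noteq> \<zeta>" for \<epsilon> \<zeta>
    using no that by blast
  have "|Field ?w| \<le>o \<theta>" by (rule card_of_Field_leq[OF wsat_props(1) wsat])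
  then obtain m where m: "inj_on m (Field ?w)" "m ` Field ?w \<subseteq> Field \<theta>"
    by (rule inj_indexed[OF _ theta])
  obtain w0 where w0: "w0 \<in> Field ?w" using wsat_props(2)[of K I] unfolding Field_def by fast
  define R where "R = (\<Union>y\<in>Field ?w - {w0}. V (m y))"
  define p where "p x = (if x = w0 then K - R else V (m x))" for x
  have mF: "m x \<in> Field \<theta>" if "x \<in> Field ?w" for x using m(2) that by blast
  have dm: "V (m x) \<inter> V (m y) = {}" if "x \<in> Field ?w" "y \<in> Field ?w" "x \<noteq> y" for x y
    using disj[OF mF[OF that(1)] mF[OF that(2)]] inj_onD[OF m(1) _ that(1,2)] that(3) by blast
  have pK: "p x \<subseteq> K" if "x \<in> Field ?w" for x using V[OF mF[OF that]] unfolding p_def by auto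
  have pI: "p x \<notin> I" if x: "x \<in> Field ?w" for x
  proof (cases "x = w0")
    case True
    have "V (m w0) \<subseteq> K - R"
      using V[OF mF[OF w0]] dm[OF w0] unfolding R_def by blast
    then show ?thesis using True V[OF mF[OF w0]] ideal_down[OF I_ideal] unfolding p_def by auto
  next
    case False
    then show ?thesis using V[OF mF[OF x]] unfolding p_def by simp
  qed
  have pd: "p x \<inter> p y = {}" if xy: "x \<in> Field ?w" "y \<in> Field ?w" "x \<noteq> y" for x y
    using dm[OF xy] xy unfolding p_def R_def by auto
  have pne: "p x \<noteq> {}" if "x \<in> Field ?w" for x using pI[OF that] ideal_empty[OF I_ideal] by metis
  have "inj_on p (Field ?w)"
  proof (rule inj_onI)
    fix x y assume "x \<in> Field ?w" "y \<in> Field ?w" "p x = p y"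
    then show "x = y" using pd[of x y] pne[of x] by (metis Int_absorb)
  qed
  then have "|Field ?w| =o |p ` Field ?w|"
    by (intro card_of_ordIsoI[of p]) (simp add: bij_betw_def)
  then have card: "|p ` Field ?w| =o ?w"
    by (rule ordIso_transitive[OF ordIso_symmetric card_of_Field_ordIso[OF wsat_props(1)]])
  have "partition_on K (p ` Field ?w)"
  proof (rule partition_onI)
    show "\<Union> (p ` Field ?w) = K"
    proof
      show "\<Union> (p ` Field ?w) \<subseteq> K" using pK by blast
      show "K \<subseteq> \<Union> (p ` Field ?w)"
      proof
        fix k assume k: "k \<in> K"
        show "k \<in> \<Union> (p ` Field ?w)"
        proof (cases "k \<in> R")
          case True
          then obtain y where "y \<in> Field ?w" "y \<noteq> w0" "k \<in> V (m y)" unfolding R_def by blast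
          then have "k \<in> p y" unfolding p_def by simp
          then show ?thesis using \<open>y \<in> Field ?w\<close> by blast
        next
          case False
          then have "k \<in> p w0" using k unfolding p_def by simp
          then show ?thesis using w0 by blast
        qed
      qed
    qed
    show "{} \<notin> p ` Field ?w" using pne by blast
    fix A B assume "A \<in> p ` Field ?w" "B \<in> p ` Field ?w" "A \<noteq> B"
    then show "disjnt A B" using pd unfolding disjnt_def by blast
  qed
  moreover have "p ` Field ?w \<subseteq> positive_sets K I"
    unfolding positive_sets_def using pK pI by blast
  ultimately show False using wsat_props(3)[of K I] card by blast
qed

section \<open>What the two alternatives of the hypothesis provide\<close>

lemma min_card_le: "i \<in> K \<Longrightarrow> min_card K lam \<le>o lam i"
  using least_card_props(3)[of "lam i" "\<lambda>\<mu>. \<exists>i\<in>K. \<mu> =o lam i" "lam i"] lam ordIso_refl[of "lam i"]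
  unfolding min_card_def by blast

lemma less_min_card_directed:
  assumes s: "Card_order s" "s <o min_card K lam"
  shows "directed_card P (less_mod K lam I) (cardSuc s)"
  unfolding directed_iff
proof (intro allI impI)
  fix X assume X: "X \<subseteq> P \<and> |X| <o cardSuc s"
  then have Xs: "|X| \<le>o s" using cardSuc_ordLeq_ordLess[OF s(1) card_of_Card_order] by blast
  have small: "|X| <o lam i" if "i \<in> K" for i
    by (rule ordLess_ordLeq_trans[OF ordLeq_ordLess_trans[OF Xs s(2)] min_card_le[OF that]])
  obtain g where g: "g \<in> P" "\<And>i. i \<in> K \<Longrightarrow> (\<lambda>f. f i) ` X \<subseteq> underS (lam i) (g i)"
  proof (rule P_bound[where A = "\<lambda>i. (\<lambda>f. f i) ` X"])
    fix i assume i: "i \<in> K"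
    show "(\<lambda>f. f i) ` X \<subseteq> Field (lam i) \<and> |(\<lambda>f. f i) ` X| <o lam i"
    proof
      show "(\<lambda>f. f i) ` X \<subseteq> Field (lam i)"
        by (rule image_subsetI, rule P_Field[OF _ i]) (use X in blast)
      show "|(\<lambda>f. f i) ` X| <o lam i" by (rule card_image_ordLess[OF small[OF i]])
    qed
  qed (rule that)
  have "LE g f \<in> I" if f: "f \<in> X" for f
  proof -
    have "LT f g = K" using g(2) f unfolding LT_def by blast
    moreover have "f \<in> P" using X f by blast
    ultimately have "LE g f = {}" using LT_LE_disjoint[of f g] g(1) LE_sub[of g f] by blast
    then show ?thesis using ideal_empty[OF I_ideal] by simp
  qed
  then show "\<exists>g\<in>P. \<forall>f\<in>X. LE g f \<in> I" using g(1) by blast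
qed

text \<open>\<open>liminf_card\<close> minimises over cardinals on the type of the factors, whereas
  \<open>c\<close> may live elsewhere. If \<open>c\<close> fits into that type it is copied there;
  otherwise the universe of the type, which bounds all factors, is below \<open>c\<close> and takes
  its place.\<close>

lemma below_liminf_small:
  assumes theta: "Card_order \<theta>" and lim: "\<theta> \<le>o liminf_card K I lam" and c: "Card_order c" "c <o \<theta>"
  shows "{i\<in>K. lam i \<le>o c} \<in> I"
proof (rule ccontr)
  assume no: "{i\<in>K. lam i \<le>o c} \<notin> I"
  let ?Q = "\<lambda>\<mu> :: 'a rel. {i\<in>K. lam i \<le>o \<mu>} \<in> positive_sets K I"
  have univ: "lam i \<le>o |UNIV :: 'a set|" if "i \<in> K" for i
  proof -
    have "|Field (lam i)| =o lam i" using card_of_Field_ordIso lam[OF that] by blast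
    from ordIso_ordLeq_trans[OF ordIso_symmetric[OF this] card_of_mono1[OF subset_UNIV]]
    show ?thesis .
  qed
  then have "{i\<in>K. lam i \<le>o |UNIV :: 'a set|} = K" by blast
  then have Q: "?Q |UNIV :: 'a set|" unfolding positive_sets_def using K_notin_I by simp
  note l = least_card_props[of "|UNIV :: 'a set|" ?Q, OF card_of_Card_order Q, folded liminf_card_def]
  obtain \<mu> :: "'a rel" where \<mu>: "Card_order \<mu>" "?Q \<mu>" "\<mu> \<le>o c"
  proof (cases "c \<le>o |UNIV :: 'a set|")
    case True
    then obtain B :: "'a set" where B: "|B| =o c" by (rule card_leq_obtain[OF _ c(1)])
    have "lam i \<le>o c \<longleftrightarrow> lam i \<le>o |B|" for i
      using ordLeq_ordIso_trans[OF _ B, of "lam i"]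
        ordLeq_ordIso_trans[OF _ ordIso_symmetric[OF B], of "lam i"] by blast
    then have "?Q |B|" using no unfolding positive_sets_def by auto
    then show ?thesis using that[of "|B|"] card_of_Card_order ordIso_imp_ordLeq[OF B] by blast
  next
    case False
    then have "|UNIV :: 'a set| \<le>o c"
      using Card_order_trichotomy[OF card_of_Card_order[of "UNIV :: 'a set"] c(1)] ordLess_imp_ordLeq
      by blast
    then show ?thesis using that[of "|UNIV :: 'a set|"] card_of_Card_order Q by blast
  qed
  have "\<theta> \<le>o c" by (rule ordLeq_transitive[OF ordLeq_transitive[OF lim l(3)[OF \<mu>(1,2)]] \<mu>(3)])
  then show False using c(2) not_ordLess_ordLeq by blast
qed

text \<open>
  In case \<open>(\<beta>)\<close> the bound of the \<open>\<theta>\<close> constant functions singles out, for almost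
  every \<open>i\<close>, an initial segment of \<open>\<theta>\<close> of size less than \<open>lam i\<close>.
\<close>

lemma liminf_approximation:
  assumes theta: "Card_order \<theta>" and lim: "\<theta> \<le>o liminf_card K I lam"
    and dir: "directed_card P (le_mod K lam I) (cardSuc \<theta>)"
  shows "\<exists>H. (\<forall>i\<in>K. |H i| <o lam i) \<and> (\<forall>\<epsilon>\<in>Field \<theta>. {i\<in>K. \<epsilon> \<notin> H i} \<in> I)"
proof -
  have two: "Well_order \<theta>" using theta by (rule Card_order_imp_Well_order)
  \<comment> \<open>Factors of size at most \<theta> are read inside \<theta> through
    \<open>\<phi> i\<close>. The image misses \<epsilon> only where the factor is no larger than
    \<open>|underS \<theta> \<epsilon>|\<close>; this cardinal is below \<theta>, so that happens on
    a null set.\<close>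
  have "\<forall>i. \<exists>\<phi>. lam i \<le>o \<theta> \<longrightarrow> embed (lam i) \<theta> \<phi>" unfolding ordLeq_def by blast
  from choice[OF this] obtain \<phi> where \<phi>: "\<forall>i. lam i \<le>o \<theta> \<longrightarrow> embed (lam i) \<theta> (\<phi> i)" ..
  define N where "N \<epsilon> = {i\<in>K. lam i \<le>o |underS \<theta> \<epsilon>|}" for \<epsilon>
  have N: "N \<epsilon> \<in> I" if "\<epsilon> \<in> Field \<theta>" for \<epsilon>
    unfolding N_def
    by (rule below_liminf_small[OF theta lim card_of_Card_order card_of_underS[OF theta that]])
  have onto: "\<epsilon> \<in> \<phi> i ` Field (lam i)"
    if i: "i \<in> K" "lam i \<le>o \<theta>" "i \<notin> N \<epsilon>" and e: "\<epsilon> \<in> Field \<theta>" for i \<epsilon>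
  proof (rule ccontr)
    assume out: "\<epsilon> \<notin> \<phi> i ` Field (lam i)"
    have emb: "embed (lam i) \<theta> (\<phi> i)" using \<phi> i(2) by blast
    have of: "wo_rel.ofilter \<theta> (\<phi> i ` Field (lam i))"
      by (rule embed_Field_ofilter[OF lam_wo[OF i(1)] two emb])
    have "\<phi> i ` Field (lam i) \<subseteq> underS \<theta> \<epsilon>"
    proof
      fix y assume y: "y \<in> \<phi> i ` Field (lam i)"
      have sub: "\<phi> i ` Field (lam i) \<subseteq> Field \<theta>" "under \<theta> y \<subseteq> \<phi> i ` Field (lam i)"
        using of y two unfolding wo_rel_def[symmetric] by (auto simp: Order_Relation.ofilter_def)
      then have "\<epsilon> \<notin> under \<theta> y" using out by blast
      then have "(\<epsilon>, y) \<notin> \<theta>" unfolding under_def by blast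
      then show "y \<in> underS \<theta> \<epsilon>" using not_underS_iff[OF two, of y \<epsilon>] sub(1) y e by blast
    qed
    then have "|\<phi> i ` Field (lam i)| \<le>o |underS \<theta> \<epsilon>|" by (rule card_of_mono1)
    moreover have "|Field (lam i)| \<le>o |\<phi> i ` Field (lam i)|"
      using embed_inj_on[OF lam_wo[OF i(1)] emb] card_of_ordLeq[of "Field (lam i)"] by blast
    ultimately have "|Field (lam i)| \<le>o |underS \<theta> \<epsilon>|" using ordLeq_transitive by blast
    moreover have "|Field (lam i)| =o lam i" using card_of_Field_ordIso lam[OF i(1)] by blast
    ultimately have "lam i \<le>o |underS \<theta> \<epsilon>|" using ordIso_ordLeq_trans[OF ordIso_symmetric] by blast
    then show False using i(1,3) unfolding N_def by blast
  qed
  \<comment> \<open>The constant function \<epsilon>, read back through \<open>\<phi> i\<close>,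
    with an arbitrary value where \<epsilon> is not in the image.\<close>
  have "\<exists>c. c \<in> P \<and> (\<forall>i\<in>K. \<epsilon> \<in> \<phi> i ` Field (lam i) \<longrightarrow> \<phi> i (c i) = \<epsilon>)" for \<epsilon>
  proof -
    let ?Q = "\<lambda>i x. \<epsilon> \<in> \<phi> i ` Field (lam i) \<longrightarrow> \<phi> i x = \<epsilon>"
    have ex: "\<exists>x\<in>Field (lam i). ?Q i x" if i: "i \<in> K" for i
    proof (cases "\<epsilon> \<in> \<phi> i ` Field (lam i)")
      case False
      have "Field (lam i) \<noteq> {}" using lam[OF i] unfolding cinfinite_def by auto
      then show ?thesis using False by blast
    qed auto
    show ?thesis
    proof (rule P_choice[of ?Q, OF ex])
      fix c assume "c \<in> P" and "\<And>i. i \<in> K \<Longrightarrow> ?Q i (c i)"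
      then show "\<exists>c. c \<in> P \<and> (\<forall>i\<in>K. ?Q i (c i))" by (intro exI[of _ c] conjI ballI)
    qed
  qed
  then have "\<forall>\<epsilon>. \<exists>c. c \<in> P \<and> (\<forall>i\<in>K. \<epsilon> \<in> \<phi> i ` Field (lam i) \<longrightarrow> \<phi> i (c i) = \<epsilon>)" ..
  from choice[OF this] obtain c
    where c: "\<forall>\<epsilon>. c \<epsilon> \<in> P \<and> (\<forall>i\<in>K. \<epsilon> \<in> \<phi> i ` Field (lam i) \<longrightarrow> \<phi> i (c \<epsilon> i) = \<epsilon>)" ..
  have "|c ` Field \<theta>| \<le>o \<theta>" by (rule card_image_ordLeq[OF card_of_Field_leq[OF theta ordLeq_refl[OF theta]]])
  then have "|c ` Field \<theta>| <o cardSuc \<theta>" by (rule ordLeq_ordLess_trans[OF _ cardSuc_greater[OF theta]])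
  moreover have "c ` Field \<theta> \<subseteq> P" using c by blast
  ultimately obtain h where h: "h \<in> P" "\<forall>f\<in>c ` Field \<theta>. le_mod K lam I f h"
    using dir unfolding directed_card_def by blast
  have hc: "LT h (c \<epsilon>) \<in> I" if "\<epsilon> \<in> Field \<theta>" for \<epsilon>
    using h(2) that le_mod_iff[of "c \<epsilon>" h I] c h(1) by blast
  \<comment> \<open>\<open>h\<close> bounds the constants only weakly. Passing strictly above it
    puts them into the segments below \<open>h' i\<close>, which are smaller than the cardinal
    \<open>lam i\<close>.\<close>
  obtain h' where h': "h' \<in> P" "LT h h' = K" by (rule P_above[OF h(1)])
  define H where "H i = (if lam i \<le>o \<theta> then \<phi> i ` underS (lam i) (h' i) else Field \<theta>)" for i
  have "|H i| <o lam i" if i: "i \<in> K" for i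
  proof (cases "lam i \<le>o \<theta>")
    case True
    have "Card_order (lam i)" using lam[OF i] by blast
    then have "|\<phi> i ` underS (lam i) (h' i)| <o lam i"
      by (rule card_image_ordLess[OF card_of_underS[OF _ P_Field[OF h'(1) i]]])
    then show ?thesis using True unfolding H_def by simp
  next
    case False
    then have "\<theta> <o lam i" using Card_order_trichotomy[OF theta, of "lam i"] lam[OF i] by blast
    then show ?thesis using False card_of_Field_less[OF theta] unfolding H_def by simp
  qed
  moreover have "{i\<in>K. \<epsilon> \<notin> H i} \<in> I" if e: "\<epsilon> \<in> Field \<theta>" for \<epsilon>
  proof (rule ideal_cover[OF I_ideal N[OF e] hc[OF e]], rule subsetI, rule ccontr)
    fix i assume i: "i \<in> {i\<in>K. \<epsilon> \<notin> H i}" and out: "i \<notin> N \<epsilon> \<union> LT h (c \<epsilon>)"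
    then have iK: "i \<in> K" and eH: "\<epsilon> \<notin> H i" by auto
    have le: "lam i \<le>o \<theta>" using eH e unfolding H_def by (cases "lam i \<le>o \<theta>") simp_all
    have "\<epsilon> \<in> \<phi> i ` Field (lam i)" using onto[OF iK le _ e] out by blast
    then have ce: "\<phi> i (c \<epsilon> i) = \<epsilon>" using c iK by blast
    have "c \<epsilon> \<in> P" using c by blast
    then have "i \<in> LE (c \<epsilon>) h" using LT_compl[OF h(1), of "c \<epsilon>"] out iK by blast
    then have "i \<in> LT (c \<epsilon>) h'" using LE_LT_trans[of "c \<epsilon>" h h'] h'(2) iK by blast
    then have "c \<epsilon> i \<in> underS (lam i) (h' i)" unfolding LT_def by blast
    then have "\<phi> i (c \<epsilon> i) \<in> H i" using le unfolding H_def by simp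
    then show False using ce eH by simp
  qed
  ultimately show ?thesis by blast
qed

lemma star_condition_abstract:
  assumes theta: "Card_order \<theta>" and star: "star_condition K I lam \<theta>"
  shows "\<exists>H. weakly_saturated_product K lam I \<theta> H"
proof -
  have wsat: "wsat K I \<le>o \<theta>" using star unfolding star_condition_def by blast
  have "\<exists>H. (\<forall>i\<in>K. |H i| <o lam i) \<and> (\<forall>\<epsilon>\<in>Field \<theta>. {i\<in>K. \<epsilon> \<notin> H i} \<in> I)"
  proof (cases "\<theta> <o min_card K lam")
    case True
    have "|Field \<theta>| <o lam i" if "i \<in> K" for i
      by (rule card_of_Field_less[OF theta ordLess_ordLeq_trans[OF True min_card_le[OF that]]])
    then show ?thesis using ideal_empty[OF I_ideal] by (intro exI[of _ "\<lambda>_. Field \<theta>"]) simp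
  next
    case False
    then show ?thesis
      using star liminf_approximation[OF theta] unfolding star_condition_def by blast
  qed
  then obtain H where H: "\<forall>i\<in>K. |H i| <o lam i" "\<forall>\<epsilon>\<in>Field \<theta>. {i\<in>K. \<epsilon> \<notin> H i} \<in> I"
    by (elim exE conjE)
  have "weakly_saturated_product K lam I \<theta> H"
  proof unfold_locales
    fix V :: "'b \<Rightarrow> 'k set"
    assume "\<And>\<epsilon>. \<epsilon> \<in> Field \<theta> \<Longrightarrow> V \<epsilon> \<subseteq> K \<and> V \<epsilon> \<notin> I"
    then show "\<exists>\<epsilon>\<in>Field \<theta>. \<exists>\<zeta>\<in>Field \<theta>. \<epsilon> \<noteq> \<zeta> \<and> V \<epsilon> \<inter> V \<zeta> \<noteq> {}"
      by (rule wsat_saturated[OF theta wsat])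
  qed (use theta H in simp_all)
  then show ?thesis by blast
qed


section \<open>Comparison of the four properties\<close>

text \<open>Constant families work; as each \<open>Field \<mu>\<close> is nonempty, no generator
  gets lost.\<close>

lemma pcf_imp_weak_pcf:
  assumes "pcf_th K I lam \<theta>"
  shows "weak_pcf_th K I lam \<theta>"
proof -
  obtain B :: "('k \<Rightarrow> 'a) rel \<Rightarrow> 'k set" where w: "weakest_pcf_th K I lam \<theta>"
    and B: "\<forall>\<mu> \<in> pcf K I lam. B \<mu> \<subseteq> K"
    "\<forall>l :: ('k \<Rightarrow> 'a) set rel. Card_order l \<longrightarrow>
           J l = ideal_plus K I {B \<mu> | \<mu>. \<mu> \<in> pcf K I lam \<and> \<mu> <o l}"
    "\<forall>\<mu> \<in> pcf K I lam. B \<mu> \<notin> J \<mu> \<and> has_tcf (card_prod (B \<mu>) lam) (less_mod (B \<mu>) lam (J \<mu>)) \<mu>"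
    using assms unfolding pcf_th_def by (elim exE conjE)
  have ne: "\<exists>\<alpha>. \<alpha> \<in> Field \<mu>" if "\<mu> \<in> pcf K I lam" for \<mu>
  proof -
    have "infinite (Field \<mu>)" using that tcf_infinite unfolding pcf_iff cinfinite_def by blast
    then show ?thesis by (metis finite.emptyI equals0I)
  qed
  have eq: "{B \<mu> | \<mu> \<alpha>. \<mu> \<in> pcf K I lam \<and> \<mu> <o l \<and> \<alpha> \<in> Field \<mu>} =
    {B \<mu> | \<mu>. \<mu> \<in> pcf K I lam \<and> \<mu> <o l}" for l :: "('k \<Rightarrow> 'a) set rel"
    using ne by blast
  show ?thesis
    unfolding weak_pcf_th_def
  proof (intro conjI exI[of _ "\<lambda>\<mu> _. B \<mu>"])
    show "weakest_pcf_th K I lam \<theta>" by (rule w)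
  qed (use B eq ideal_empty[OF J_ideal] in auto)
qed

text \<open>Let \<open>l\<close> be the cofinality of \<open>D\<close>. Directedness at the
  successor of \<open>l\<close> makes \<open>D\<close> meet the ideal of that successor, so
  \<open>D\<close> contains one of its generators, since otherwise the dual ideal of
  \<open>D\<close> would include this whole ideal. The cardinal of the generator cannot be below
  \<open>l\<close>, as \<open>D\<close> misses \<open>J l\<close>, hence it is
  \<open>l\<close>.\<close>

lemma weak_pcf_imp_weaker_pcf:
  assumes theta: "Card_order \<theta>" and weak: "weak_pcf_th K I lam \<theta>"
  shows "weaker_pcf_th K I lam \<theta>"
proof -
  obtain B :: "('k \<Rightarrow> 'a) rel \<Rightarrow> ('k \<Rightarrow> 'a) \<Rightarrow> 'k set" where w: "weakest_pcf_th K I lam \<theta>"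
    and BK: "\<forall>\<mu> \<in> pcf K I lam. \<forall>\<alpha> \<in> Field \<mu>. B \<mu> \<alpha> \<subseteq> K"
    and gen: "\<forall>l :: ('k \<Rightarrow> 'a) set rel. Card_order l \<longrightarrow>
           J l = ideal_plus K I {B \<mu> \<alpha> | \<mu> \<alpha>. \<mu> \<in> pcf K I lam \<and> \<mu> <o l \<and> \<alpha> \<in> Field \<mu>}"
    and B: "\<forall>\<mu> \<in> pcf K I lam. \<forall>\<alpha> \<in> Field \<mu>.
           has_tcf (card_prod (B \<mu> \<alpha>) lam) (less_mod (B \<mu> \<alpha>) lam (J \<mu>)) \<mu>"
    using weak unfolding weak_pcf_th_def by (elim exE conjE)
  have dir: "directed_card P (less_mod K lam (J l)) l" if "Card_order l" "\<theta> \<le>o l"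
    for l :: "('k \<Rightarrow> 'a) set rel"
    using w that unfolding weakest_pcf_th_def by blast
  have main: "\<theta> \<le>o tcfU D \<and> (\<exists>C \<in> D \<inter> J (cardSuc (tcfU D)) - J (tcfU D).
      has_tcf (card_prod C lam) (less_mod C lam (J (tcfU D))) (tcfU D))"
    if ultra: "ultrafilter_on K D" and disj: "D \<inter> J \<theta> = {}" for D
  proof -
    have D: "D \<in> U" by (rule U_of_disjoint[OF ultra disj])
    let ?l = "tcfU D"
    have lc: "Card_order ?l" by (rule tcf_Card_order[OF D])
    have sc: "Card_order (cardSuc ?l)" by (rule cardSuc_Card_order[OF lc])
    \<comment> \<open>Directedness is given only for cardinals on the type of sets of functions. If
      \<theta> is too large for that type, it exceeds every true cofinality; then \<open>K\<close>
      lies in \<open>J \<theta>\<close> and no such \<open>D\<close> exists.\<close>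
    have le: "\<theta> \<le>o ?l"
    proof (cases "\<theta> \<le>o |UNIV :: ('k \<Rightarrow> 'a) set set|")
      case True
      then obtain A :: "('k \<Rightarrow> 'a) set set" where A: "|A| =o \<theta>" by (rule card_leq_obtain[OF _ theta])
      have "directed_card P (less_mod K lam (J |A| )) |A|"
        by (rule dir[OF card_of_Card_order ordIso_imp_ordLeq[OF ordIso_symmetric[OF A]]])
      moreover have "D \<inter> J |A| = {}" unfolding J_cong[OF A] by (rule disj)
      ultimately have "|A| \<le>o ?l" using directed_tcf[OF D _ _ card_of_Card_order] by blast
      then show ?thesis by (rule ordIso_ordLeq_trans[OF ordIso_symmetric[OF A]])
    next
      case False
      then have big: "|UNIV :: ('k \<Rightarrow> 'a) set set| <o \<theta>"
        using Card_order_trichotomy[OF card_of_Card_order theta] by blast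
      have "\<not> \<theta> \<le>o tcfU E" if E: "E \<in> U" for E
      proof
        assume "\<theta> \<le>o tcfU E"
        then have "|UNIV :: ('k \<Rightarrow> 'a) set set| <o tcfU E" by (rule ordLess_ordLeq_trans[OF big])
        moreover have "tcfU E <o cardSuc (tcfU E)" by (rule cardSuc_greater[OF tcf_Card_order[OF E]])
        moreover have "cardSuc (tcfU E) \<le>o |UNIV :: ('k \<Rightarrow> 'a) set set|"
          by (rule ordIso_ordLeq_trans[OF ordIso_symmetric[OF card_of_Field_ordIso] card_of_mono1[OF subset_UNIV]])
            (rule cardSuc_Card_order[OF tcf_Card_order[OF E]])
        ultimately have "tcfU E <o tcfU E"
          using ordLess_transitive ordLess_ordLeq_trans by metis
        then show False using ordLess_irreflexive by blast
      qed
      then have "K \<in> J \<theta>" unfolding J_iff by blast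
      then show ?thesis using disj U_K[OF D] by blast
    qed
    have "\<not> D \<inter> J (cardSuc ?l) = {}"
    proof
      assume "D \<inter> J (cardSuc ?l) = {}"
      moreover have "\<theta> \<le>o cardSuc ?l"
        by (rule ordLeq_transitive[OF le ordLess_imp_ordLeq[OF cardSuc_greater[OF lc]]])
      ultimately have "cardSuc ?l \<le>o ?l" using directed_tcf[OF D _ dir[OF sc] sc] by blast
      then show False using cardSuc_greater[OF lc] not_ordLess_ordLeq by blast
    qed
    let ?X = "{B \<mu> \<alpha> | \<mu> \<alpha>. \<mu> \<in> pcf K I lam \<and> \<mu> <o cardSuc ?l \<and> \<alpha> \<in> Field \<mu>}"
    have JX: "J (cardSuc ?l) = ideal_plus K I ?X" using gen sc by blast
    have disjl: "D \<inter> J ?l = {}" by (rule J_disjoint[OF D ordLeq_refl[OF lc]])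
    have "\<exists>C\<in>?X. C \<in> D"
    proof (rule ccontr)
      assume no: "\<not> (\<exists>C\<in>?X. C \<in> D)"
      let ?M = "Pow K - D"
      have "ideal_on K ?M"
        unfolding ideal_on_def
      proof (intro conjI ballI allI impI)
        show "?M \<subseteq> Pow K" "{} \<in> ?M" using U_empty[OF D] by blast+
      next
        fix A C assume "A \<in> ?M" "C \<subseteq> A"
        then show "C \<in> ?M" using U_up[OF D, of C A] by blast
      next
        fix A C assume "A \<in> ?M" "C \<in> ?M"
        then show "A \<union> C \<in> ?M" using U_Un[OF D, of A C] by blast
      qed
      moreover have "I \<subseteq> ?M" using U_I[OF D] ideal_sub[OF I_ideal] by auto
      moreover have "?X \<subseteq> ?M"
      proof
        fix C assume C: "C \<in> ?X"
        then have "C \<subseteq> K" using BK by auto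
        moreover have "C \<notin> D" using no C by blast
        ultimately show "C \<in> ?M" by simp
      qed
      ultimately have "ideal_plus K I ?X \<subseteq> ?M" unfolding ideal_plus_def by (intro Inter_lower) simp
      then show False using \<open>\<not> D \<inter> J (cardSuc ?l) = {}\<close> JX by auto
    qed
    then obtain \<mu> \<alpha> where \<mu>: "\<mu> \<in> pcf K I lam" "\<mu> <o cardSuc ?l" "\<alpha> \<in> Field \<mu>" "B \<mu> \<alpha> \<in> D" by blast
    obtain E where E: "E \<in> U" "\<mu> = tcfU E" using \<mu>(1) unfolding pcf_iff by blast
    have \<mu>c: "Card_order \<mu>" using tcf_Card_order[OF E(1)] E(2) by simp
    have "J (cardSuc ?l) \<supseteq> ?X" unfolding JX ideal_plus_def by blast
    then have mem: "B \<mu> \<alpha> \<in> J (cardSuc ?l)" using \<mu> by blast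
    have "\<not> \<mu> <o ?l"
    proof
      assume less: "\<mu> <o ?l"
      have s\<mu>: "Card_order (cardSuc \<mu>)" by (rule cardSuc_Card_order[OF \<mu>c])
      have "cardSuc \<mu> \<le>o ?l" by (rule cardSuc_least[OF \<mu>c lc less])
      then have "J (cardSuc \<mu>) \<subseteq> J ?l" by (rule J_mono)
      moreover have "B \<mu> \<alpha> \<in> ideal_plus K I {B \<mu>' \<alpha> | \<mu>' \<alpha>. \<mu>' \<in> pcf K I lam \<and> \<mu>' <o cardSuc \<mu> \<and> \<alpha> \<in> Field \<mu>'}"
        unfolding ideal_plus_def using \<mu>(1,3) cardSuc_greater[OF \<mu>c] by blast
      then have "B \<mu> \<alpha> \<in> J (cardSuc \<mu>)" using gen s\<mu> by blast
      ultimately show False using disjl \<mu>(4) by blast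
    qed
    then have "?l \<le>o \<mu>" using Card_order_trichotomy[OF \<mu>c lc] by blast
    moreover have "\<mu> \<le>o ?l" using \<mu>(2) cardSuc_ordLeq_ordLess[OF lc \<mu>c] by blast
    ultimately have "tcfU E =o ?l" unfolding ordIso_iff_ordLeq E(2) by blast
    then have eq: "\<mu> = ?l" using tcf_eq[OF E(1) D] E(2) by blast
    have "has_tcf (card_prod (B \<mu> \<alpha>) lam) (less_mod (B \<mu> \<alpha>) lam (J ?l)) ?l"
      using B \<mu>(1,3) unfolding eq by blast
    moreover have "B \<mu> \<alpha> \<in> D \<inter> J (cardSuc ?l) - J ?l" using \<mu>(4) mem disjl by blast
    ultimately show ?thesis using le by blast
  qed
  show ?thesis
    unfolding weaker_pcf_th_def Let_def J_le_def using w main by blast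
qed

end


section \<open>Guessing families\<close>

lemma guessing_ordIso:
  assumes g: "guessing \<theta> r" and iso: "r =o r'"
  shows "guessing \<theta> r'"
proof -
  obtain f where f: "iso r r' f" using iso unfolding ordIso_def by blast
  have wo: "Well_order r" using iso unfolding ordIso_def by blast
  have bij: "bij_betw f (Field r) (Field r')" and emb: "embed r r' f" using f unfolding iso_def by blast+
  have lt: "f \<alpha> \<in> underS r' (f \<beta>)" if "\<alpha> \<in> underS r \<beta>" for \<alpha> \<beta>
    using embed_underS[OF wo emb underS_Field_right[OF that]] that unfolding bij_betw_def by blast
  have fF: "f x \<in> Field r'" if "x \<in> Field r" for x using bij_betwE[OF bij] that by blast
  define h where "h = inv_into (Field r) f"
  have h: "h y \<in> Field r" "f (h y) = y" if "y \<in> Field r'" for y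
    using that bij unfolding h_def bij_betw_def
    by (auto intro: inv_into_into f_inv_into_f)
  obtain S where S: "|S| \<le>o r" "\<forall>s\<in>S. \<forall>j b. s j = Some b \<longrightarrow> b \<in> Field r"
    and S_guess: "\<forall>\<beta>. (\<forall>s\<in>S. \<beta> s \<in> Field r) \<longrightarrow>
        (\<exists>x j. (\<forall>\<epsilon>\<in>Field \<theta>. x \<epsilon> \<in> Field r \<and> j \<epsilon> \<in> Field \<theta> \<and>
           (\<exists>s\<in>S. \<beta> s \<in> underS r (x \<epsilon>) \<and> (\<forall>\<zeta>\<in>underS \<theta> \<epsilon>. s (j \<zeta>) = Some (x \<zeta>)))))"
    using g unfolding guessing_def by (elim exE conjE)
  define m where "m s = map_option f \<circ> s" for s :: "'a \<Rightarrow> 'b option"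
  show ?thesis
    unfolding guessing_def
  proof (intro exI[of _ "m ` S"] conjI ballI allI impI)
    show "|m ` S| \<le>o r'" by (rule ordLeq_ordIso_trans[OF card_image_ordLeq[OF S(1)] iso])
  next
    fix s j b assume "s \<in> m ` S" "s j = Some b"
    then show "b \<in> Field r'" using S(2) fF unfolding m_def by fastforce
  next
    fix \<beta> assume \<beta>: "\<forall>s\<in>m ` S. \<beta> s \<in> Field r'"
    have "\<forall>s\<in>S. h (\<beta> (m s)) \<in> Field r" using \<beta> h(1) by blast
    then obtain x j where xj: "\<forall>\<epsilon>\<in>Field \<theta>. x \<epsilon> \<in> Field r \<and> j \<epsilon> \<in> Field \<theta> \<and>
        (\<exists>s\<in>S. h (\<beta> (m s)) \<in> underS r (x \<epsilon>) \<and> (\<forall>\<zeta>\<in>underS \<theta> \<epsilon>. s (j \<zeta>) = Some (x \<zeta>)))"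
      using S_guess by (elim allE[of _ "\<lambda>s. h (\<beta> (m s))"] impE exE)
    have "\<forall>\<epsilon>\<in>Field \<theta>. f (x \<epsilon>) \<in> Field r' \<and> j \<epsilon> \<in> Field \<theta> \<and>
        (\<exists>s\<in>m ` S. \<beta> s \<in> underS r' (f (x \<epsilon>)) \<and> (\<forall>\<zeta>\<in>underS \<theta> \<epsilon>. s (j \<zeta>) = Some (f (x \<zeta>))))"
    proof
      fix \<epsilon> assume e: "\<epsilon> \<in> Field \<theta>"
      obtain s where s: "s \<in> S" "h (\<beta> (m s)) \<in> underS r (x \<epsilon>)" "\<forall>\<zeta>\<in>underS \<theta> \<epsilon>. s (j \<zeta>) = Some (x \<zeta>)"
        using xj e by blast
      have "f (h (\<beta> (m s))) = \<beta> (m s)" using h(2) \<beta> s(1) by blast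
      then have "\<beta> (m s) \<in> underS r' (f (x \<epsilon>))" using lt[OF s(2)] by simp
      moreover have "\<forall>\<zeta>\<in>underS \<theta> \<epsilon>. m s (j \<zeta>) = Some (f (x \<zeta>))" using s(3) unfolding m_def by simp
      ultimately show "f (x \<epsilon>) \<in> Field r' \<and> j \<epsilon> \<in> Field \<theta> \<and>
        (\<exists>s\<in>m ` S. \<beta> s \<in> underS r' (f (x \<epsilon>)) \<and> (\<forall>\<zeta>\<in>underS \<theta> \<epsilon>. s (j \<zeta>) = Some (f (x \<zeta>))))"
        using s(1) xj e fF by blast
    qed
    then show "\<exists>x j. (\<forall>\<epsilon>\<in>Field \<theta>. x \<epsilon> \<in> Field r' \<and> j \<epsilon> \<in> Field \<theta> \<and>
        (\<exists>s\<in>m ` S. \<beta> s \<in> underS r' (x \<epsilon>) \<and> (\<forall>\<zeta>\<in>underS \<theta> \<epsilon>. s (j \<zeta>) = Some (x \<zeta>))))"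
      by (intro exI[of _ "\<lambda>\<epsilon>. f (x \<epsilon>)"] exI[of _ j])
  qed
qed

lemma card_Times_ordLeq:
  assumes "Cinfinite r" "|A| \<le>o r" "|B| \<le>o r"
  shows "|A \<times> B| \<le>o r"
  using card_of_Times_ordLeq_infinite_Field[of r A B] assms unfolding cinfinite_def by blast

lemma card_finite_maps:
  assumes r: "Cinfinite r" and "finite T"
  shows "|{s :: 't \<Rightarrow> 'l option. dom s \<subseteq> T \<and> ran s \<subseteq> Field r}| \<le>o r"
  using assms(2)
proof (induction T)
  case empty
  have "{s :: 't \<Rightarrow> 'l option. dom s \<subseteq> {} \<and> ran s \<subseteq> Field r} \<subseteq> {Map.empty}" by auto
  then have "finite {s :: 't \<Rightarrow> 'l option. dom s \<subseteq> {} \<and> ran s \<subseteq> Field r}"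
    using finite_subset by blast
  then show ?case by (rule ordLess_imp_ordLeq[OF card_finite_ordLess[OF r]])
next
  case (insert t T)
  let ?M = "\<lambda>T. {s :: 't \<Rightarrow> 'l option. dom s \<subseteq> T \<and> ran s \<subseteq> Field r}"
  have "?M (insert t T) \<subseteq> (\<lambda>(s, v). s(t := v)) ` (?M T \<times> ({None} \<union> Some ` Field r))"
  proof
    fix s assume s: "s \<in> ?M (insert t T)"
    have "s = (\<lambda>(s, v). s(t := v)) (s(t := None), s t)" by simp
    moreover have "s(t := None) \<in> ?M T" using s by (auto simp: ran_def)
    moreover have "s t \<in> {None} \<union> Some ` Field r" using s by (cases "s t") (auto simp: ran_def)
    ultimately show "s \<in> (\<lambda>(s, v). s(t := v)) ` (?M T \<times> ({None} \<union> Some ` Field r))" by blast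
  qed
  then have sub: "|?M (insert t T)| \<le>o |(\<lambda>(s, v). s(t := v)) ` (?M T \<times> ({None} \<union> Some ` Field r))|"
    by (rule card_of_mono1)
  have vals: "|{None} \<union> Some ` Field r| \<le>o r"
  proof -
    have rc: "Card_order r" using r by blast
    have 1: "|{None :: 'l option}| \<le>o r" by (rule ordLess_imp_ordLeq[OF card_finite_ordLess[OF r]]) simp
    have 2: "|Some ` Field r| \<le>o r"
      by (rule card_image_ordLeq[OF card_of_Field_leq[OF rc ordLeq_refl[OF rc]]])
    show ?thesis
      using card_of_Un_ordLeq_infinite_Field[OF _ 1 2 rc] r unfolding cinfinite_def by blast
  qed
  show ?case
    by (rule ordLeq_transitive[OF sub card_image_ordLeq[OF card_Times_ordLeq[OF r insert.IH vals]]])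
qed

text \<open>For finite \<theta> all partial maps together are no more than \<open>r\<close>, so
  every one can be supplied. Each \<open>x \<epsilon>\<close> is put above the challenge of its own
  past, with the identity as labelling.\<close>

lemma guessing_finite:
  assumes theta: "Well_order \<theta>" "finite (Field \<theta>)" and r: "Cinfinite r"
  shows "guessing \<theta> r"
  unfolding guessing_def
proof (intro exI[of _ "{s. dom s \<subseteq> Field \<theta> \<and> ran s \<subseteq> Field r}"] conjI ballI allI impI)
  show "|{s :: 'a \<Rightarrow> 'b option. dom s \<subseteq> Field \<theta> \<and> ran s \<subseteq> Field r}| \<le>o r"
    by (rule card_finite_maps[OF r theta(2)])
next
  fix s j b assume "s \<in> {s :: 'a \<Rightarrow> 'b option. dom s \<subseteq> Field \<theta> \<and> ran s \<subseteq> Field r}" "s j = Some b"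
  then show "b \<in> Field r" by (auto simp: ran_def)
next
  let ?S = "{s :: 'a \<Rightarrow> 'b option. dom s \<subseteq> Field \<theta> \<and> ran s \<subseteq> Field r}"
  fix \<beta> assume \<beta>: "\<forall>s\<in>?S. \<beta> s \<in> Field r"
  define c where "c x \<epsilon> j = (if j \<in> underS \<theta> \<epsilon> then Some (x j) else None)" for x :: "'a \<Rightarrow> 'b" and \<epsilon> j
  have cS: "c x \<epsilon> \<in> ?S" if "\<And>\<zeta>. \<zeta> \<in> underS \<theta> \<epsilon> \<Longrightarrow> x \<zeta> \<in> Field r" for x \<epsilon>
    using that by (auto simp: c_def dom_def ran_def split: if_splits dest: underS_Field_left)
  have "\<exists>x. \<forall>\<epsilon>\<in>Field \<theta>. x \<epsilon> \<in> Field r \<and> \<beta> (c x \<epsilon>) \<in> underS r (x \<epsilon>)"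
  proof (rule wo_choice[OF theta(1)])
    fix f g :: "'a \<Rightarrow> 'b" and \<epsilon> y
    assume "\<And>z. z \<in> underS \<theta> \<epsilon> \<Longrightarrow> f z = g z"
    then have "c f \<epsilon> = c g \<epsilon>" unfolding c_def by (intro ext) simp
    then show "(y \<in> Field r \<and> \<beta> (c f \<epsilon>) \<in> underS r y) = (y \<in> Field r \<and> \<beta> (c g \<epsilon>) \<in> underS r y)" by simp
  next
    fix f :: "'a \<Rightarrow> 'b" and \<epsilon>
    assume "\<And>\<zeta>. \<zeta> \<in> underS \<theta> \<epsilon> \<Longrightarrow> f \<zeta> \<in> Field r \<and> \<beta> (c f \<zeta>) \<in> underS r (f \<zeta>)"
    then have "c f \<epsilon> \<in> ?S" by (intro cS) blast
    then have "\<beta> (c f \<epsilon>) \<in> Field r" using \<beta> by blast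
    then obtain y where "y \<in> Field r" "\<beta> (c f \<epsilon>) \<in> underS r y" by (rule Cinfinite_limit[OF r])
    then show "\<exists>y. y \<in> Field r \<and> \<beta> (c f \<epsilon>) \<in> underS r y" by blast
  qed
  then obtain x where x: "\<forall>\<epsilon>\<in>Field \<theta>. x \<epsilon> \<in> Field r \<and> \<beta> (c x \<epsilon>) \<in> underS r (x \<epsilon>)" ..
  have "\<forall>\<epsilon>\<in>Field \<theta>. x \<epsilon> \<in> Field r \<and> id \<epsilon> \<in> Field \<theta> \<and>
    (\<exists>s\<in>?S. \<beta> s \<in> underS r (x \<epsilon>) \<and> (\<forall>\<zeta>\<in>underS \<theta> \<epsilon>. s (id \<zeta>) = Some (x \<zeta>)))"
  proof
    fix \<epsilon> assume e: "\<epsilon> \<in> Field \<theta>"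
    have "c x \<epsilon> \<in> ?S" by (rule cS) (use x underS_Field_left in \<open>auto dest: underS_Field_left\<close>)
    moreover have "\<forall>\<zeta>\<in>underS \<theta> \<epsilon>. c x \<epsilon> (id \<zeta>) = Some (x \<zeta>)" unfolding c_def by simp
    ultimately show "x \<epsilon> \<in> Field r \<and> id \<epsilon> \<in> Field \<theta> \<and>
      (\<exists>s\<in>?S. \<beta> s \<in> underS r (x \<epsilon>) \<and> (\<forall>\<zeta>\<in>underS \<theta> \<epsilon>. s (id \<zeta>) = Some (x \<zeta>)))"
      using x e by auto
  qed
  then show "\<exists>x j. \<forall>\<epsilon>\<in>Field \<theta>. x \<epsilon> \<in> Field r \<and> j \<epsilon> \<in> Field \<theta> \<and>
    (\<exists>s\<in>?S. \<beta> s \<in> underS r (x \<epsilon>) \<and> (\<forall>\<zeta>\<in>underS \<theta> \<epsilon>. s (j \<zeta>) = Some (x \<zeta>)))"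
    by (intro exI[of _ x] exI[of _ id])
qed


subsection \<open>Closure points\<close>

text \<open>Clubs are handled through functions that generate them: larger functions give smaller
  sets, so intersecting clubs becomes bounding functions pointwise. The least element of
  \<open>r\<close> always belongs.\<close>

definition closure_points :: "'l rel \<Rightarrow> ('l \<Rightarrow> 'l) \<Rightarrow> 'l set" where
  "closure_points r \<phi> = {\<gamma>\<in>Field r. \<forall>\<nu>\<in>underS r \<gamma>. \<phi> \<nu> \<in> underS r \<gamma>}"

lemma closure_points_sub: "closure_points r \<phi> \<subseteq> Field r"
  unfolding closure_points_def by blast

text \<open>Iterate \<omega> times above \<alpha> and take the least strict bound, which exists as
  \<open>r\<close> is regular and uncountable. Every point below it lies below some
  \<open>t k\<close>, so its image lies below a later one.\<close>

lemma closure_points_cofinal: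
  assumes r: "Cinfinite r" "regularCard r" and unc: "natLeq <o r"
    and \<phi>: "\<And>\<nu>. \<nu> \<in> Field r \<Longrightarrow> \<phi> \<nu> \<in> Field r" and \<alpha>: "\<alpha> \<in> Field r"
  obtains \<gamma> where "\<gamma> \<in> closure_points r \<phi>" "\<alpha> \<in> underS r \<gamma>"
proof -
  have rc: "Card_order r" and wo: "Well_order r" using r Card_order_imp_Well_order by blast+
  have "\<exists>y. y \<in> Field r \<and> insert x (\<phi> ` underS r x) \<subseteq> underS r y" if x: "x \<in> Field r" for x
  proof -
    have "|\<phi> ` underS r x| <o r" by (rule card_image_ordLess[OF card_of_underS[OF rc x]])
    moreover have "|{x}| <o r" by (rule card_finite_ordLess[OF r(1)]) simp
    ultimately have "|{x} \<union> \<phi> ` underS r x| <o r" using card_Un_ordLess[OF r(1)] by blast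
    then have card: "|insert x (\<phi> ` underS r x)| <o r" by simp
    have sub: "insert x (\<phi> ` underS r x) \<subseteq> Field r" using x \<phi> underS_Field_left[of _ r x] by blast
    obtain y where "y \<in> Field r" "insert x (\<phi> ` underS r x) \<subseteq> underS r y"
      by (rule regularCard_bound[OF r sub card])
    then show ?thesis by blast
  qed
  then have "\<forall>x\<in>Field r. \<exists>y. y \<in> Field r \<and> insert x (\<phi> ` underS r x) \<subseteq> underS r y" by blast
  from bchoice[OF this] obtain n where
    n: "\<forall>x\<in>Field r. n x \<in> Field r \<and> insert x (\<phi> ` underS r x) \<subseteq> underS r (n x)" ..
  define t where "t k = (n ^^ k) \<alpha>" for k
  have tF: "t k \<in> Field r" for k by (induction k) (use \<alpha> n in \<open>auto simp: t_def\<close>)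
  have tS: "t (Suc k) = n (t k)" for k unfolding t_def by simp
  have tlt: "t k \<in> underS r (t (Suc k))" "\<phi> ` underS r (t k) \<subseteq> underS r (t (Suc k))" for k
    using n tF[of k] unfolding tS by blast+
  have "|range t| \<le>o natLeq"
    by (rule ordLeq_ordIso_trans[OF card_of_image card_of_nat])
  then have card: "|range t| <o r" by (rule ordLeq_ordLess_trans[OF _ unc])
  have sub: "range t \<subseteq> Field r" using tF by blast
  obtain b where b: "b \<in> Field r" "range t \<subseteq> underS r b"
    by (rule regularCard_bound[OF r sub card])
  let ?B = "{b\<in>Field r. range t \<subseteq> underS r b}"
  have B: "?B \<subseteq> Field r" "?B \<noteq> {}" using b by blast+
  obtain \<gamma> where \<gamma>: "\<gamma> \<in> ?B" "\<And>b. b \<in> ?B \<Longrightarrow> (\<gamma>, b) \<in> r" by (rule least_in[OF wo B]) blast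
  have \<gamma>F: "\<gamma> \<in> Field r" and t\<gamma>: "\<And>k. t k \<in> underS r \<gamma>" using \<gamma>(1) by blast+
  have "\<phi> \<nu> \<in> underS r \<gamma>" if \<nu>: "\<nu> \<in> underS r \<gamma>" for \<nu>
  proof -
    have "\<nu> \<notin> ?B"
    proof
      assume "\<nu> \<in> ?B"
      then have "(\<gamma>, \<nu>) \<in> r" by (rule \<gamma>(2))
      then show False using underS_le_trans[OF wo \<nu>] underS_irrefl by fast
    qed
    then obtain k where "t k \<notin> underS r \<nu>" using underS_Field_left[OF \<nu>] by blast
    then have "(\<nu>, t k) \<in> r" using not_underS_iff[OF wo tF underS_Field_left[OF \<nu>]] by blast
    then have "\<nu> \<in> underS r (t (Suc k))" by (rule le_underS_trans[OF wo _ tlt(1)])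
    then have "\<phi> \<nu> \<in> underS r (t (Suc (Suc k)))" using tlt(2)[of "Suc k"] by blast
    then show ?thesis by (rule underS_trans[OF wo _ t\<gamma>])
  qed
  then have "\<gamma> \<in> closure_points r \<phi>" unfolding closure_points_def using \<gamma>F by blast
  moreover have "\<alpha> \<in> underS r \<gamma>" using t\<gamma>[of 0] unfolding t_def by simp
  ultimately show ?thesis by (rule that)
qed

lemma closure_points_club:
  assumes r: "Cinfinite r" "regularCard r" and unc: "natLeq <o r"
    and \<phi>: "\<And>\<nu>. \<nu> \<in> Field r \<Longrightarrow> \<phi> \<nu> \<in> Field r"
  shows "club_in r (closure_points r \<phi>)"
  unfolding club_in_def
proof (intro conjI ballI impI)
  have wo: "Well_order r" using r Card_order_imp_Well_order by blast
  show "closure_points r \<phi> \<subseteq> Field r" by (rule closure_points_sub)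
  show "cofinal (closure_points r \<phi>) r"
    unfolding cofinal_def
  proof
    fix \<alpha> assume \<alpha>: "\<alpha> \<in> Field r"
    obtain \<gamma> where "\<gamma> \<in> closure_points r \<phi>" "\<alpha> \<in> underS r \<gamma>"
      by (rule closure_points_cofinal[of r \<phi> \<alpha>, OF r unc \<phi> \<alpha>])
    then show "\<exists>\<gamma>\<in>closure_points r \<phi>. \<alpha> \<noteq> \<gamma> \<and> (\<alpha>, \<gamma>) \<in> r" unfolding underS_def by blast
  qed
  fix \<delta> assume \<delta>: "\<delta> \<in> Field r" and lim: "underS r \<delta> \<noteq> {} \<and>
    (\<forall>\<alpha>\<in>underS r \<delta>. \<exists>\<beta>\<in>closure_points r \<phi> \<inter> underS r \<delta>. \<alpha> \<in> underS r \<beta>)"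
  have "\<phi> \<nu> \<in> underS r \<delta>" if "\<nu> \<in> underS r \<delta>" for \<nu>
  proof -
    obtain \<beta> where \<beta>: "\<beta> \<in> closure_points r \<phi>" "\<beta> \<in> underS r \<delta>" "\<nu> \<in> underS r \<beta>"
      using lim \<open>\<nu> \<in> underS r \<delta>\<close> by blast
    have "\<phi> \<nu> \<in> underS r \<beta>" using \<beta>(1,3) unfolding closure_points_def by blast
    then show ?thesis by (rule underS_trans[OF wo _ \<beta>(2)])
  qed
  then show "\<delta> \<in> closure_points r \<phi>" unfolding closure_points_def using \<delta> by blast
qed

lemma infinite_cardSuc:
  assumes "Card_order \<theta>" "infinite (Field \<theta>)"
  shows "Cinfinite (cardSuc \<theta>)" "regularCard (cardSuc \<theta>)" "natLeq <o cardSuc \<theta>"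
proof -
  show "Cinfinite (cardSuc \<theta>)"
    using assms cardSuc_Card_order cardSuc_finite unfolding cinfinite_def by blast
  show "regularCard (cardSuc \<theta>)" by (rule infinite_cardSuc_regularCard[OF assms(2,1)])
  have "natLeq \<le>o \<theta>" using natLeq_ordLeq_cinfinite[of \<theta>] assms unfolding cinfinite_def by blast
  then show "natLeq <o cardSuc \<theta>" by (rule ordLeq_ordLess_trans[OF _ cardSuc_greater[OF assms(1)]])
qed


subsection \<open>Guessing from a continuity condition\<close>

text \<open>\<open>a b\<close> is a proper initial segment of the well-ordered set
  \<open>a x\<close>. Order types can therefore serve as labels.\<close>

lemma coherent_otp_inj:
  assumes r: "Well_order r" and x: "a x \<subseteq> Field r" and b: "b \<in> a x" "a b = a x \<inter> underS r b"
  shows "\<not> Restr r (a b) =o Restr r (a x)"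
proof
  assume iso: "Restr r (a b) =o Restr r (a x)"
  let ?R = "Restr r (a x)"
  have wo: "Well_order ?R" by (rule Well_order_Restr[OF r])
  have F: "Field ?R = a x"
    using Refl_Field_Restr2[of r "a x"] x r unfolding order_on_defs by blast
  have "underS ?R b = a b" unfolding b(2) underS_def using b(1) by blast
  then have "Restr ?R (underS ?R b) = Restr r (a b)" using b(2) by blast
  moreover have "Restr ?R (underS ?R b) <o ?R"
    by (rule underS_Restr_ordLess[OF wo]) (use F b(1) in blast)
  ultimately show False using not_ordLess_ordIso iso by metis
qed

text \<open>Label \<open>b\<close> by the order type of \<open>a b\<close>, which coherence makes
  injective on each \<open>a \<delta>\<close>; the record at \<alpha> then depends on \<alpha>
  alone, whichever \<delta> is guessed later. The challenges, read as a function of the point of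
  record, have a club of closure points, and the members of \<open>a \<delta>\<close> separated by
  this club supply the chain.\<close>

lemma continuity_guessing:
  assumes theta: "Card_order \<theta>" and cc: "continuity_condition (cardSuc \<theta>) \<theta> a"
  shows "guessing \<theta> (cardSuc \<theta>)"
proof -
  let ?r = "cardSuc \<theta>"
  have r: "Cinfinite ?r" "regularCard ?r" using cc unfolding continuity_condition_def by blast+
  have wo: "Well_order ?r" using r Card_order_imp_Well_order by blast
  have two: "Well_order \<theta>" by (rule Card_order_imp_Well_order[OF theta])
  have inf: "infinite (Field \<theta>)" using r(1) cardSuc_finite[OF theta] unfolding cinfinite_def by blast
  have tinf: "Cinfinite \<theta>" using inf theta unfolding cinfinite_def by blast
  obtain T where T: "T \<subseteq> Field ?r"
    and a: "\<forall>\<alpha>\<in>Field ?r. a \<alpha> \<subseteq> underS ?r \<alpha> \<and> Restr ?r (a \<alpha>) \<le>o \<theta> \<and> (\<forall>\<beta>\<in>a \<alpha>. a \<beta> = a \<alpha> \<inter> underS ?r \<beta>)"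
    and clubs: "\<forall>E. club_in ?r E \<longrightarrow> (\<exists>\<delta>\<in>T. \<theta> =o Restr ?r
           {\<alpha> \<in> a \<delta>. Restr ?r (a \<alpha>) <o \<theta> \<and>
              \<not> (\<exists>\<beta> \<in> a \<delta> \<inter> underS ?r \<alpha>. {\<gamma>. \<beta> \<in> underS ?r \<gamma> \<and> \<gamma> \<in> underS ?r \<alpha>} \<inter> E = {})})"
    using cc unfolding continuity_condition_def by (elim exE conjE)
  have aF: "a \<alpha> \<subseteq> Field ?r" if "\<alpha> \<in> Field ?r" for \<alpha>
    using a that underS_Field_left[of _ ?r \<alpha>] by blast
  have "\<forall>b. \<exists>t. Restr ?r (a b) <o \<theta> \<longrightarrow> t \<in> Field \<theta> \<and> Restr ?r (a b) =o Restr \<theta> (underS \<theta> t)"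
    using ordLess_iff_ordIso_Restr[OF two Well_order_Restr[OF wo]] by blast
  from choice[OF this] obtain ot where
    ot: "\<forall>b. Restr ?r (a b) <o \<theta> \<longrightarrow> ot b \<in> Field \<theta> \<and> Restr ?r (a b) =o Restr \<theta> (underS \<theta> (ot b))" ..
  have inj: "b = c" if \<delta>: "\<delta> \<in> Field ?r" and b: "b \<in> a \<delta>" "Restr ?r (a b) <o \<theta>"
    and c: "c \<in> a \<delta>" "Restr ?r (a c) <o \<theta>" and eq: "ot b = ot c" for \<delta> b c
  proof (rule ccontr)
    assume ne: "b \<noteq> c"
    have iso: "Restr ?r (a b) =o Restr ?r (a c)"
      using ot b(2) c(2) eq ordIso_symmetric ordIso_transitive by metis
    have F: "b \<in> Field ?r" "c \<in> Field ?r" using aF[OF \<delta>] b(1) c(1) by blast+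
    have ab: "a b = a \<delta> \<inter> underS ?r b" "a c = a \<delta> \<inter> underS ?r c" using a \<delta> b(1) c(1) by blast+
    consider "b \<in> underS ?r c" | "c \<in> underS ?r b" using underS_linear[OF wo F] ne by blast
    then show False
    proof cases
      case 1
      then have "b \<in> a c" using ab(2) b(1) by blast
      moreover then have "a b = a c \<inter> underS ?r b" using a F(2) by blast
      ultimately show False using coherent_otp_inj[of ?r a c b, OF wo aF[OF F(2)]] iso by blast
    next
      case 2
      then have "c \<in> a b" using ab(1) c(1) by blast
      moreover then have "a c = a b \<inter> underS ?r c" using a F(1) by blast
      ultimately show False using coherent_otp_inj[of ?r a b c, OF wo aF[OF F(1)]] ordIso_symmetric[OF iso] by blast
    qed
  qed
  define Q where "Q \<alpha> t b \<longleftrightarrow> b \<in> insert \<alpha> (a \<alpha>) \<and> Restr ?r (a b) <o \<theta> \<and> ot b = t" for \<alpha> t b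
  define s where "s \<alpha> t = (if \<exists>b. Q \<alpha> t b then Some (SOME b. Q \<alpha> t b) else None)" for \<alpha> t
  have s_in: "b \<in> insert \<alpha> (a \<alpha>)" if "s \<alpha> t = Some b" for \<alpha> t b
  proof -
    have "\<exists>b. Q \<alpha> t b" "b = (SOME b. Q \<alpha> t b)" using that unfolding s_def by (auto split: if_splits)
    then have "Q \<alpha> t b" using someI_ex[of "Q \<alpha> t"] by simp
    then show ?thesis unfolding Q_def by blast
  qed
  have s_eq: "s \<alpha> (ot b) = Some b"
    if \<delta>: "\<delta> \<in> Field ?r" "\<alpha> \<in> a \<delta>" and b: "b \<in> insert \<alpha> (a \<alpha>)" "Restr ?r (a b) <o \<theta>" for \<delta> \<alpha> b
  proof -
    have sub: "insert \<alpha> (a \<alpha>) \<subseteq> a \<delta>" using a \<delta> by blast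
    have Qb: "Q \<alpha> (ot b) b" unfolding Q_def using b by blast
    then have Qs: "Q \<alpha> (ot b) (SOME b'. Q \<alpha> (ot b) b')" by (rule someI)
    then have "(SOME b'. Q \<alpha> (ot b) b') = b"
      using inj[OF \<delta>(1), of "SOME b'. Q \<alpha> (ot b) b'" b] sub b unfolding Q_def by blast
    then show ?thesis using Qb unfolding s_def by auto
  qed
  show ?thesis
    unfolding guessing_def
  proof (intro exI[of _ "s ` Field ?r"] conjI ballI allI impI)
    show "|s ` Field ?r| \<le>o ?r"
      by (rule card_image_ordLeq[OF card_of_Field_leq[OF conjunct2[OF r(1)] ordLeq_refl[OF conjunct2[OF r(1)]]]])
  next
    fix u t b assume "u \<in> s ` Field ?r" "u t = Some b"
    then show "b \<in> Field ?r" using s_in aF by blast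
  next
    fix \<beta> assume \<beta>: "\<forall>s\<in>s ` Field ?r. \<beta> s \<in> Field ?r"
    let ?\<phi> = "\<lambda>\<nu>. \<beta> (s \<nu>)"
    let ?E = "closure_points ?r ?\<phi>"
    have "club_in ?r ?E"
      by (rule closure_points_club[OF r infinite_cardSuc(3)[OF theta inf]]) (use \<beta> in blast)
    then obtain \<delta> where \<delta>: "\<delta> \<in> T" and iso: "\<theta> =o Restr ?r
           {\<alpha> \<in> a \<delta>. Restr ?r (a \<alpha>) <o \<theta> \<and>
              \<not> (\<exists>\<beta> \<in> a \<delta> \<inter> underS ?r \<alpha>. {\<gamma>. \<beta> \<in> underS ?r \<gamma> \<and> \<gamma> \<in> underS ?r \<alpha>} \<inter> ?E = {})}"
      using clubs by blast
    define W where "W = {\<alpha> \<in> a \<delta>. Restr ?r (a \<alpha>) <o \<theta> \<and>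
              \<not> (\<exists>\<beta> \<in> a \<delta> \<inter> underS ?r \<alpha>. {\<gamma>. \<beta> \<in> underS ?r \<gamma> \<and> \<gamma> \<in> underS ?r \<alpha>} \<inter> ?E = {})}"
    have \<delta>F: "\<delta> \<in> Field ?r" using \<delta> T by blast
    obtain k where k: "iso \<theta> (Restr ?r W) k" using iso unfolding W_def[symmetric] ordIso_def by blast
    have kW: "k \<epsilon> \<in> W" if "\<epsilon> \<in> Field \<theta>" for \<epsilon>
      using k that Field_Restr_subset[of ?r W] unfolding iso_def bij_betw_def by blast
    have klt: "k \<zeta> \<in> underS ?r (k \<epsilon>)" if z: "\<zeta> \<in> underS \<theta> \<epsilon>" for \<zeta> \<epsilon>
    proof -
      have "embed \<theta> (Restr ?r W) k" using k unfolding iso_def by blast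
      from embed_underS[OF two this underS_Field_right[OF z]]
      have "k \<zeta> \<in> underS (Restr ?r W) (k \<epsilon>)" using z unfolding bij_betw_def by blast
      then show ?thesis unfolding underS_def by blast
    qed
    have "\<exists>y. y \<in> Field \<theta> \<and> \<epsilon> \<in> underS \<theta> y \<and> (\<forall>z. \<epsilon> \<in> underS \<theta> z \<longrightarrow> (y, z) \<in> \<theta>)" if e: "\<epsilon> \<in> Field \<theta>" for \<epsilon>
    proof -
      let ?A = "{y\<in>Field \<theta>. \<epsilon> \<in> underS \<theta> y}"
      have A: "?A \<subseteq> Field \<theta>" "?A \<noteq> {}" using Cinfinite_limit[OF tinf e] by blast+
      obtain y where "y \<in> ?A" "\<And>z. z \<in> ?A \<Longrightarrow> (y, z) \<in> \<theta>" by (rule least_in[OF two A]) blast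
      then show ?thesis using underS_Field_right[of \<epsilon> \<theta>] by blast
    qed
    then have "\<forall>\<epsilon>\<in>Field \<theta>. \<exists>y. y \<in> Field \<theta> \<and> \<epsilon> \<in> underS \<theta> y \<and> (\<forall>z. \<epsilon> \<in> underS \<theta> z \<longrightarrow> (y, z) \<in> \<theta>)" by blast
    from bchoice[OF this] obtain sc where sc: "\<forall>\<epsilon>\<in>Field \<theta>. sc \<epsilon> \<in> Field \<theta> \<and> \<epsilon> \<in> underS \<theta> (sc \<epsilon>) \<and>
      (\<forall>z. \<epsilon> \<in> underS \<theta> z \<longrightarrow> (sc \<epsilon>, z) \<in> \<theta>)" ..
    \<comment> \<open>The shift by one separates reading from answering: the record is read at
      \<open>k \<epsilon>\<close>, and a closure point lies between \<open>k \<epsilon>\<close> and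
      \<open>x \<epsilon>\<close>. If \<open>sc \<zeta> = \<epsilon>\<close>, then
      \<open>x \<zeta>\<close> is the reading point itself, hence the \<open>insert\<close> in
      \<open>Q\<close>.\<close>
    define x where "x \<epsilon> = k (sc \<epsilon>)" for \<epsilon>
    have xW: "x \<epsilon> \<in> W" if "\<epsilon> \<in> Field \<theta>" for \<epsilon> unfolding x_def using kW sc that by blast
    have "\<forall>\<epsilon>\<in>Field \<theta>. x \<epsilon> \<in> Field ?r \<and> ot (x \<epsilon>) \<in> Field \<theta> \<and>
      (\<exists>u\<in>s ` Field ?r. \<beta> u \<in> underS ?r (x \<epsilon>) \<and> (\<forall>\<zeta>\<in>underS \<theta> \<epsilon>. u (ot (x \<zeta>)) = Some (x \<zeta>)))"
    proof
      fix \<epsilon> assume e: "\<epsilon> \<in> Field \<theta>"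
      have xe: "x \<epsilon> \<in> a \<delta>" "Restr ?r (a (x \<epsilon>)) <o \<theta>" using xW[OF e] unfolding W_def by blast+
      have ke: "k \<epsilon> \<in> a \<delta>" using kW[OF e] unfolding W_def by blast
      have keF: "k \<epsilon> \<in> Field ?r" using ke aF[OF \<delta>F] by blast
      have "k \<epsilon> \<in> underS ?r (x \<epsilon>)" unfolding x_def using klt sc e by blast
      then have "{\<gamma>. k \<epsilon> \<in> underS ?r \<gamma> \<and> \<gamma> \<in> underS ?r (x \<epsilon>)} \<inter> ?E \<noteq> {}"
        using xW[OF e] ke unfolding W_def by blast
      then obtain \<gamma> where \<gamma>: "\<gamma> \<in> ?E" "k \<epsilon> \<in> underS ?r \<gamma>" "\<gamma> \<in> underS ?r (x \<epsilon>)" by blast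
      have "\<beta> (s (k \<epsilon>)) \<in> underS ?r \<gamma>" using \<gamma>(1,2) unfolding closure_points_def by blast
      then have "\<beta> (s (k \<epsilon>)) \<in> underS ?r (x \<epsilon>)" by (rule underS_trans[OF wo _ \<gamma>(3)])
      moreover have "s (k \<epsilon>) (ot (x \<zeta>)) = Some (x \<zeta>)" if z: "\<zeta> \<in> underS \<theta> \<epsilon>" for \<zeta>
      proof (rule s_eq[OF \<delta>F ke])
        note zF = underS_Field_left[OF z]
        have xz: "x \<zeta> \<in> a \<delta>" using xW[OF zF] unfolding W_def by blast
        show "Restr ?r (a (x \<zeta>)) <o \<theta>" using xW[OF zF] unfolding W_def by blast
        have "(sc \<zeta>, \<epsilon>) \<in> \<theta>" using sc zF z by blast
        then consider "sc \<zeta> = \<epsilon>" | "sc \<zeta> \<in> underS \<theta> \<epsilon>" unfolding underS_def by blast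
        then show "x \<zeta> \<in> insert (k \<epsilon>) (a (k \<epsilon>))"
        proof cases
          case 2
          have "x \<zeta> \<in> underS ?r (k \<epsilon>)" unfolding x_def by (rule klt[OF 2])
          moreover have "a (k \<epsilon>) = a \<delta> \<inter> underS ?r (k \<epsilon>)" using a \<delta>F ke by blast
          ultimately show ?thesis using xz by blast
        qed (simp add: x_def)
      qed
      moreover have "ot (x \<epsilon>) \<in> Field \<theta>" using ot xe(2) by blast
      moreover have "x \<epsilon> \<in> Field ?r" using xe(1) aF[OF \<delta>F] by blast
      ultimately show "x \<epsilon> \<in> Field ?r \<and> ot (x \<epsilon>) \<in> Field \<theta> \<and>
        (\<exists>u\<in>s ` Field ?r. \<beta> u \<in> underS ?r (x \<epsilon>) \<and> (\<forall>\<zeta>\<in>underS \<theta> \<epsilon>. u (ot (x \<zeta>)) = Some (x \<zeta>)))"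
        using keF by (intro conjI bexI[of _ "s (k \<epsilon>)"]) simp_all
    qed
    then show "\<exists>x j. \<forall>\<epsilon>\<in>Field \<theta>. x \<epsilon> \<in> Field ?r \<and> j \<epsilon> \<in> Field \<theta> \<and>
      (\<exists>u\<in>s ` Field ?r. \<beta> u \<in> underS ?r (x \<epsilon>) \<and> (\<forall>\<zeta>\<in>underS \<theta> \<epsilon>. u (j \<zeta>) = Some (x \<zeta>)))"
      by (intro exI[of _ x] exI[of _ "\<lambda>\<epsilon>. ot (x \<epsilon>)"])
  qed
qed


subsection \<open>Partial squares\<close>

text \<open>\<open>y \<epsilon>\<close> is the point at which the earlier chain will be read: it
  lies above all earlier \<open>x\<close>, and \<open>x \<epsilon>\<close> clears both it and the
  challenges \<open>G (y \<epsilon>)\<close> posed there.\<close>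

lemma interleaved_chain:
  assumes theta: "Card_order \<theta>" and r: "Cinfinite r" "regularCard r" "\<theta> <o r"
    and G: "\<And>y. y \<in> Field r \<Longrightarrow> G y \<subseteq> Field r \<and> |G y| <o r"
    and C: "C \<subseteq> Field r" "\<And>\<alpha>. \<alpha> \<in> Field r \<Longrightarrow> \<exists>\<gamma>\<in>C. \<alpha> \<in> underS r \<gamma>"
  shows "\<exists>x y. \<forall>\<epsilon>\<in>Field \<theta>. x \<epsilon> \<in> C \<and> y \<epsilon> \<in> underS r (x \<epsilon>) \<and> G (y \<epsilon>) \<subseteq> underS r (x \<epsilon>) \<and>
    (\<forall>\<zeta>\<in>underS \<theta> \<epsilon>. x \<zeta> \<in> underS r (y \<epsilon>))"
proof -
  have wo: "Well_order r" using r(1) Card_order_imp_Well_order by blast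
  define Q where "Q f \<epsilon> p \<longleftrightarrow> fst p \<in> C \<and> snd p \<in> underS r (fst p) \<and> G (snd p) \<subseteq> underS r (fst p) \<and>
    (\<forall>\<zeta>\<in>underS \<theta> \<epsilon>. fst (f \<zeta>) \<in> underS r (snd p))" for f :: "'a \<Rightarrow> 'b \<times> 'b" and \<epsilon> p
  have "\<exists>f. \<forall>\<epsilon>\<in>Field \<theta>. Q f \<epsilon> (f \<epsilon>)"
  proof (rule wo_choice[OF Card_order_imp_Well_order[OF theta]])
    fix f g :: "'a \<Rightarrow> 'b \<times> 'b" and \<epsilon> p
    assume "\<And>z. z \<in> underS \<theta> \<epsilon> \<Longrightarrow> f z = g z"
    then show "Q f \<epsilon> p = Q g \<epsilon> p" unfolding Q_def by simp
  next
    fix f :: "'a \<Rightarrow> 'b \<times> 'b" and \<epsilon>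
    assume e: "\<epsilon> \<in> Field \<theta>" and IH: "\<And>\<zeta>. \<zeta> \<in> underS \<theta> \<epsilon> \<Longrightarrow> Q f \<zeta> (f \<zeta>)"
    let ?A = "(\<lambda>\<zeta>. fst (f \<zeta>)) ` underS \<theta> \<epsilon>"
    have A: "?A \<subseteq> Field r" using IH C(1) unfolding Q_def by blast
    have "|?A| <o r"
      by (rule card_image_ordLess[OF ordLess_transitive[OF card_of_underS[OF theta e] r(3)]])
    then obtain y where y: "y \<in> Field r" "?A \<subseteq> underS r y" by (rule regularCard_bound[OF r(1,2) A])
    have "|{y}| <o r" by (rule card_finite_ordLess[OF r(1)]) simp
    then have Gy: "|{y} \<union> G y| <o r" using card_Un_ordLess[OF r(1)] G[OF y(1)] by blast
    have "{y} \<union> G y \<subseteq> Field r" using y(1) G[OF y(1)] by blast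
    then obtain b where b: "b \<in> Field r" "{y} \<union> G y \<subseteq> underS r b"
      by (rule regularCard_bound[OF r(1,2) _ Gy])
    obtain \<gamma> where \<gamma>: "\<gamma> \<in> C" "b \<in> underS r \<gamma>" using C(2)[OF b(1)] by blast
    have "{y} \<union> G y \<subseteq> underS r \<gamma>" using b(2) underS_trans[OF wo _ \<gamma>(2)] by blast
    then have "Q f \<epsilon> (\<gamma>, y)" unfolding Q_def using \<gamma>(1) y(2) by auto
    then show "\<exists>p. Q f \<epsilon> p" ..
  qed
  then obtain f where "\<forall>\<epsilon>\<in>Field \<theta>. Q f \<epsilon> (f \<epsilon>)" ..
  then show ?thesis unfolding Q_def by (intro exI[of _ "\<lambda>\<epsilon>. fst (f \<epsilon>)"] exI[of _ "\<lambda>\<epsilon>. snd (f \<epsilon>)"])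
qed

lemma card_underS_cardSuc:
  assumes "Card_order \<theta>"
  shows "|underS (cardSuc \<theta>) \<eta>| \<le>o \<theta>"
proof (cases "\<eta> \<in> Field (cardSuc \<theta>)")
  case True
  then show ?thesis
    using card_of_underS[OF cardSuc_Card_order[OF assms] True]
      cardSuc_ordLeq_ordLess[OF assms card_of_Card_order] by blast
next
  case False
  show ?thesis unfolding underS_empty[OF False] by (rule Card_order_empty[OF assms])
qed

text \<open>Sets of size \<theta> can have order types beyond \<theta>, so these cannot be labels
  themselves. A rank \<open>ot\<close> into \<open>\<theta>\<^sup>+\<close>, increasing along
  membership, plays their role; \<eta> bounds the ranks in \<open>a \<delta>\<close>, and an
  injection of \<eta> into \<theta> turns ranks into labels. By coherence ranks are injective on
  \<open>a \<delta>\<close>, so a label determines its point.\<close>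

lemma coherent_enumeration:
  fixes r :: "'l rel" and \<theta> :: "'t rel"
  assumes theta: "Card_order \<theta>" "infinite (Field \<theta>)" and r: "Well_order r"
    and a: "\<And>\<alpha>. a \<alpha> \<subseteq> underS r \<alpha>" "\<And>\<alpha>. |a \<alpha>| \<le>o \<theta>"
    and coh: "\<And>\<alpha> \<beta>. \<beta> \<in> a \<alpha> \<Longrightarrow> a \<beta> = a \<alpha> \<inter> underS r \<beta>"
  shows "\<exists>s. (\<forall>y \<eta> t b. s y \<eta> t = Some b \<longrightarrow> t \<in> Field \<theta> \<and> b \<in> a y) \<and>
    (\<forall>\<delta>. \<exists>\<eta>\<in>Field (cardSuc \<theta>). \<exists>j. (\<forall>x\<in>a \<delta>. j x \<in> Field \<theta>) \<and>
      (\<forall>y\<in>a \<delta>. \<forall>x\<in>a y. s y \<eta> (j x) = Some x))"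
proof -
  let ?\<mu> = "cardSuc \<theta>"
  note \<mu> = infinite_cardSuc[OF theta]
  have less: "|A| <o ?\<mu>" if "|A| \<le>o \<theta>" for A :: "'x set"
    by (rule ordLeq_ordLess_trans[OF that cardSuc_greater[OF theta(1)]])
  have "\<exists>ot. \<forall>b\<in>Field r. ot b \<in> Field ?\<mu> \<and> ot ` a b \<subseteq> underS ?\<mu> (ot b)"
  proof (rule regular_recursion[OF r \<mu>(1,2)])
    fix f g :: "'l \<Rightarrow> 't set" and x
    assume "\<And>z. z \<in> underS r x \<Longrightarrow> f z = g z"
    then show "f ` a x = g ` a x" using a(1) by (intro image_cong[OF refl]) blast
  next
    fix f :: "'l \<Rightarrow> 't set" and x
    assume "\<And>z. z \<in> underS r x \<Longrightarrow> f z \<in> Field ?\<mu>"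
    then show "f ` a x \<subseteq> Field ?\<mu> \<and> |f ` a x| <o ?\<mu>"
      using a(1) card_image_ordLess[OF less[OF a(2)]] by blast
  qed
  then obtain ot where ot: "\<forall>b\<in>Field r. ot b \<in> Field ?\<mu> \<and> ot ` a b \<subseteq> underS ?\<mu> (ot b)" ..
  have "\<forall>\<eta>. \<exists>j. inj_on j (underS ?\<mu> \<eta>) \<and> j ` underS ?\<mu> \<eta> \<subseteq> Field \<theta>"
  proof
    fix \<eta>
    obtain j where "inj_on j (underS ?\<mu> \<eta>)" "j ` underS ?\<mu> \<eta> \<subseteq> Field \<theta>"
      by (rule inj_indexed[OF card_underS_cardSuc[OF theta(1)] theta(1)])
    then show "\<exists>j. inj_on j (underS ?\<mu> \<eta>) \<and> j ` underS ?\<mu> \<eta> \<subseteq> Field \<theta>" by blast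
  qed
  from choice[OF this] obtain j where
    j: "\<forall>\<eta>. inj_on (j \<eta>) (underS ?\<mu> \<eta>) \<and> j \<eta> ` underS ?\<mu> \<eta> \<subseteq> Field \<theta>" ..
  define Q where "Q y \<eta> t b \<longleftrightarrow> b \<in> a y \<and> ot b \<in> underS ?\<mu> \<eta> \<and> j \<eta> (ot b) = t" for y \<eta> t b
  define s where "s y \<eta> t = (if \<exists>b. Q y \<eta> t b then Some (SOME b. Q y \<eta> t b) else None)" for y \<eta> t
  have s1: "t \<in> Field \<theta> \<and> b \<in> a y" if "s y \<eta> t = Some b" for y \<eta> t b
  proof -
    have "\<exists>b. Q y \<eta> t b" "b = (SOME b. Q y \<eta> t b)" using that unfolding s_def by (auto split: if_splits)
    then have "Q y \<eta> t b" using someI_ex[of "Q y \<eta> t"] by simp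
    then show ?thesis unfolding Q_def using j by blast
  qed
  have s2: "\<exists>\<eta>\<in>Field ?\<mu>. \<exists>j. (\<forall>x\<in>a \<delta>. j x \<in> Field \<theta>) \<and> (\<forall>y\<in>a \<delta>. \<forall>x\<in>a y. s y \<eta> (j x) = Some x)" for \<delta>
  proof -
    have aF: "a \<delta> \<subseteq> Field r" using a(1) underS_Field_left by fast
    have sub: "ot ` a \<delta> \<subseteq> Field ?\<mu>" using aF ot by blast
    obtain \<eta> where \<eta>: "\<eta> \<in> Field ?\<mu>" "ot ` a \<delta> \<subseteq> underS ?\<mu> \<eta>"
      by (rule regularCard_bound[OF \<mu>(1,2) sub card_image_ordLess[OF less[OF a(2)]]])
    have lt: "ot c \<in> underS ?\<mu> (ot b)" if "b \<in> a \<delta>" "c \<in> a \<delta>" "c \<in> underS r b" for b c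
      using coh[OF that(1)] that ot aF by blast
    have inj: "b = c" if bc: "b \<in> a \<delta>" "c \<in> a \<delta>" "ot b = ot c" for b c
    proof (rule ccontr)
      assume "b \<noteq> c"
      then consider "b \<in> underS r c" | "c \<in> underS r b"
        using underS_linear[OF r, of b c] aF bc(1,2) by blast
      then show False
        using lt[OF bc(1,2)] lt[OF bc(2,1)] bc(3) underS_irrefl[of "ot c" ?\<mu>] by cases simp_all
    qed
    have "s y \<eta> (j \<eta> (ot x)) = Some x" if y: "y \<in> a \<delta>" and x: "x \<in> a y" for x y
    proof -
      have sub: "a y \<subseteq> a \<delta>" using coh[OF y] by blast
      have Qx: "Q y \<eta> (j \<eta> (ot x)) x" unfolding Q_def using x \<eta>(2) sub by blast
      then have "Q y \<eta> (j \<eta> (ot x)) (SOME b. Q y \<eta> (j \<eta> (ot x)) b)" by (rule someI)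
      then have b: "(SOME b. Q y \<eta> (j \<eta> (ot x)) b) \<in> a y"
        "j \<eta> (ot (SOME b. Q y \<eta> (j \<eta> (ot x)) b)) = j \<eta> (ot x)" unfolding Q_def by blast+
      have "ot (SOME b. Q y \<eta> (j \<eta> (ot x)) b) = ot x"
        by (rule inj_onD[of "j \<eta>" "underS ?\<mu> \<eta>", OF _ b(2)]) (use j \<eta>(2) sub b(1) x in blast)+
      then have "(SOME b. Q y \<eta> (j \<eta> (ot x)) b) = x" using inj sub b(1) x by blast
      then show ?thesis using Qx unfolding s_def by auto
    qed
    moreover have "j \<eta> (ot x) \<in> Field \<theta>" if "x \<in> a \<delta>" for x using j \<eta>(2) that by blast
    ultimately show ?thesis using \<eta>(1) by (intro bexI[of _ \<eta>] exI[of _ "\<lambda>x. j \<eta> (ot x)"] conjI ballI)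
  qed
  show ?thesis by (intro exI[of _ s] conjI allI impI) (use s1 s2 in blast)+
qed

text \<open>A decoder that sees only the point \<open>y\<close> and the parameter \<open>p\<close>:
  for every small \<open>X\<close> one parameter and one labelling recover, at each of its points,
  the part of \<open>X\<close> below that point.\<close>

definition square_family ::
    "'t rel \<Rightarrow> 'l rel \<Rightarrow> 'p set \<Rightarrow> ('l \<Rightarrow> 'p \<Rightarrow> 't \<Rightarrow> 'l option) \<Rightarrow> bool" where
  "square_family \<theta> \<sigma> Q s \<longleftrightarrow>
    (\<forall>y p t b. s y p t = Some b \<longrightarrow> t \<in> Field \<theta> \<and> b \<in> underS \<sigma> y) \<and>
    (\<forall>X. X \<subseteq> Field \<sigma> \<and> |X| \<le>o \<theta> \<longrightarrow> (\<exists>p\<in>Q. \<exists>j. (\<forall>x\<in>X. j x \<in> Field \<theta>) \<and>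
      (\<forall>y\<in>X. \<forall>x\<in>X. x \<in> underS \<sigma> y \<longrightarrow> s y p (j x) = Some x)))"

text \<open>
  With injections \<open>h \<alpha>\<close> of \<open>\<alpha>\<close> into \<open>\<theta>\<^sup>+\<close>, the sets \<open>A i \<alpha> = {b < \<alpha>. h \<alpha> b < i}\<close> are coherent at
  \<open>\<alpha>\<close> for a club of \<open>i < \<theta>\<^sup>+\<close>, and they exhaust \<open>\<alpha>\<close>.
\<close>

lemma square_family_exists:
  fixes \<theta> :: "'t rel"
  assumes theta: "Card_order \<theta>" "infinite (Field \<theta>)"
  shows "\<exists>s. square_family \<theta> (cardSuc (cardSuc \<theta>)) (Field (cardSuc \<theta>) \<times> Field (cardSuc \<theta>)) s"
proof -
  let ?\<mu> = "cardSuc \<theta>"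
  let ?\<sigma> = "cardSuc ?\<mu>"
  note \<mu> = infinite_cardSuc[OF theta]
  have \<mu>c: "Card_order ?\<mu>" and \<mu>inf: "infinite (Field ?\<mu>)" using \<mu>(1) unfolding cinfinite_def by blast+
  note \<sigma> = infinite_cardSuc[OF \<mu>c \<mu>inf]
  have \<sigma>wo: "Well_order ?\<sigma>" and \<mu>wo: "Well_order ?\<mu>"
    using \<sigma>(1) \<mu>(1) Card_order_imp_Well_order by blast+
  have less: "|A| <o ?\<mu>" if "|A| \<le>o \<theta>" for A :: "'x set"
    by (rule ordLeq_ordLess_trans[OF that cardSuc_greater[OF theta(1)]])
  have "\<forall>\<alpha>. \<exists>h. inj_on h (underS ?\<sigma> \<alpha>) \<and> h ` underS ?\<sigma> \<alpha> \<subseteq> Field ?\<mu>"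
  proof
    fix \<alpha>
    obtain h where "inj_on h (underS ?\<sigma> \<alpha>)" "h ` underS ?\<sigma> \<alpha> \<subseteq> Field ?\<mu>"
      by (rule inj_indexed[OF card_underS_cardSuc[OF \<mu>c] \<mu>c])
    then show "\<exists>h. inj_on h (underS ?\<sigma> \<alpha>) \<and> h ` underS ?\<sigma> \<alpha> \<subseteq> Field ?\<mu>" by blast
  qed
  from choice[OF this] obtain h where
    h: "\<forall>\<alpha>. inj_on (h \<alpha>) (underS ?\<sigma> \<alpha>) \<and> h \<alpha> ` underS ?\<sigma> \<alpha> \<subseteq> Field ?\<mu>" ..
  have hF: "h \<alpha> b \<in> Field ?\<mu>" if "b \<in> underS ?\<sigma> \<alpha>" for \<alpha> b
    using spec[OF h, of \<alpha>] that by blast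
  have card_h: "|{b\<in>underS ?\<sigma> \<alpha>. h \<alpha> b \<in> B}| \<le>o \<theta>" if B: "|B| \<le>o \<theta>" for \<alpha> B
  proof -
    have "inj_on (h \<alpha>) {b\<in>underS ?\<sigma> \<alpha>. h \<alpha> b \<in> B}"
      by (rule inj_on_subset[OF conjunct1[OF spec[OF h, of \<alpha>]]]) blast
    then have "|{b\<in>underS ?\<sigma> \<alpha>. h \<alpha> b \<in> B}| \<le>o |B|"
      using card_of_ordLeq[of "{b\<in>underS ?\<sigma> \<alpha>. h \<alpha> b \<in> B}" B] by blast
    then show ?thesis by (rule ordLeq_transitive[OF _ B])
  qed
  define A where "A i \<alpha> = {b\<in>underS ?\<sigma> \<alpha>. h \<alpha> b \<in> underS ?\<mu> i}" for i \<alpha>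
  define good where "good i \<alpha> \<longleftrightarrow> (\<forall>b\<in>A i \<alpha>. A i b = A i \<alpha> \<inter> underS ?\<sigma> b)" for i \<alpha>
  have A_card: "|A i \<alpha>| \<le>o \<theta>" for i \<alpha>
    unfolding A_def by (rule card_h[OF card_underS_cardSuc[OF theta(1)]])
  have ex_good: "\<exists>i\<in>Field ?\<mu>. i0 \<in> underS ?\<mu> i \<and> good i \<delta>" if i0: "i0 \<in> Field ?\<mu>" for i0 \<delta>
  proof -
    define B where "B \<nu> = {b\<in>underS ?\<sigma> \<delta>. h \<delta> b \<in> under ?\<mu> \<nu>}" for \<nu>
    define G where "G \<nu> = (\<Union>b\<in>B \<nu>. h \<delta> ` {c\<in>underS ?\<sigma> b. h b c \<in> under ?\<mu> \<nu>} \<union> h b ` (B \<nu> \<inter> underS ?\<sigma> b))" for \<nu>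
    have card_under: "|under ?\<mu> \<nu>| \<le>o \<theta>" if \<nu>: "\<nu> \<in> Field ?\<mu>" for \<nu>
    proof -
      obtain y where y: "\<nu> \<in> underS ?\<mu> y" by (rule Cinfinite_limit[OF \<mu>(1) \<nu>]) blast
      have "under ?\<mu> \<nu> \<subseteq> underS ?\<mu> y" unfolding under_def using le_underS_trans[OF \<mu>wo _ y] by blast
      then show ?thesis by (rule ordLeq_transitive[OF card_of_mono1 card_underS_cardSuc[OF theta(1)]])
    qed
    have B_card: "|B \<nu>| <o ?\<mu>" if "\<nu> \<in> Field ?\<mu>" for \<nu>
      unfolding B_def by (rule less[OF card_h[OF card_under[OF that]]])
    have G_card: "|G \<nu>| <o ?\<mu>" if \<nu>: "\<nu> \<in> Field ?\<mu>" for \<nu>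
      unfolding G_def
    proof (rule card_UN_ordLess[OF \<mu>(1,2) B_card[OF \<nu>]])
      fix b
      have 1: "|h \<delta> ` {c\<in>underS ?\<sigma> b. h b c \<in> under ?\<mu> \<nu>}| <o ?\<mu>"
        by (rule card_image_ordLess[OF less[OF card_h[OF card_under[OF \<nu>]]]])
      have 2: "|h b ` (B \<nu> \<inter> underS ?\<sigma> b)| <o ?\<mu>"
        by (rule card_image_ordLess[OF card_subset_ordLess[OF Int_lower1 B_card[OF \<nu>]]])
      show "|h \<delta> ` {c\<in>underS ?\<sigma> b. h b c \<in> under ?\<mu> \<nu>} \<union> h b ` (B \<nu> \<inter> underS ?\<sigma> b)| <o ?\<mu>"
        by (rule card_Un_ordLess[OF \<mu>(1) 1 2])
    qed
    have G_Field: "G \<nu> \<subseteq> Field ?\<mu>" for \<nu>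
    proof -
      have "h \<delta> c \<in> Field ?\<mu>" if "b \<in> B \<nu>" "c \<in> underS ?\<sigma> b" for b c
      proof (rule hF, rule underS_trans[OF \<sigma>wo that(2)])
        show "b \<in> underS ?\<sigma> \<delta>" using that(1) unfolding B_def by blast
      qed
      then show ?thesis unfolding G_def using hF by blast
    qed
    have "\<forall>\<nu>\<in>Field ?\<mu>. \<exists>y. y \<in> Field ?\<mu> \<and> G \<nu> \<subseteq> underS ?\<mu> y"
    proof
      fix \<nu> assume "\<nu> \<in> Field ?\<mu>"
      then obtain y where "y \<in> Field ?\<mu>" "G \<nu> \<subseteq> underS ?\<mu> y"
        by (rule regularCard_bound[OF \<mu>(1,2) G_Field G_card])
      then show "\<exists>y. y \<in> Field ?\<mu> \<and> G \<nu> \<subseteq> underS ?\<mu> y" by blast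
    qed
    from bchoice[OF this] obtain \<phi> where \<phi>: "\<forall>\<nu>\<in>Field ?\<mu>. \<phi> \<nu> \<in> Field ?\<mu> \<and> G \<nu> \<subseteq> underS ?\<mu> (\<phi> \<nu>)" ..
    have \<phi>F: "\<And>\<nu>. \<nu> \<in> Field ?\<mu> \<Longrightarrow> \<phi> \<nu> \<in> Field ?\<mu>" using \<phi> by blast
    obtain i where i: "i \<in> closure_points ?\<mu> \<phi>" "i0 \<in> underS ?\<mu> i"
      by (rule closure_points_cofinal[of ?\<mu> \<phi> i0, OF \<mu> \<phi>F i0])
    have clos: "g \<in> underS ?\<mu> i" if "\<nu> \<in> underS ?\<mu> i" "g \<in> G \<nu>" for \<nu> g
    proof -
      have "g \<in> underS ?\<mu> (\<phi> \<nu>)" using \<phi> that(2) underS_Field_left[OF that(1)] by blast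
      moreover have "\<phi> \<nu> \<in> underS ?\<mu> i" using i(1) that(1) unfolding closure_points_def by blast
      ultimately show ?thesis by (rule underS_trans[OF \<mu>wo])
    qed
    have max: "\<exists>\<nu>\<in>underS ?\<mu> i. u \<in> under ?\<mu> \<nu> \<and> v \<in> under ?\<mu> \<nu>"
      if uv: "u \<in> underS ?\<mu> i" "v \<in> underS ?\<mu> i" for u v
    proof -
      note F = underS_Field_left[OF uv(1)] underS_Field_left[OF uv(2)]
      show ?thesis
        using underS_linear[OF \<mu>wo F] wo_le_refl[OF \<mu>wo F(1)] wo_le_refl[OF \<mu>wo F(2)]
          underS_imp_le[of u ?\<mu> v] underS_imp_le[of v ?\<mu> u] uv unfolding under_def by blast
    qed
    have "good i \<delta>"
      unfolding good_def
    proof (intro ballI set_eqI iffI)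
      fix b c assume b: "b \<in> A i \<delta>" and c: "c \<in> A i b"
      have b\<delta>: "b \<in> underS ?\<sigma> \<delta>" "h \<delta> b \<in> underS ?\<mu> i" using b unfolding A_def by blast+
      have cb: "c \<in> underS ?\<sigma> b" "h b c \<in> underS ?\<mu> i" using c unfolding A_def by blast+
      obtain \<nu> where \<nu>: "\<nu> \<in> underS ?\<mu> i" "h \<delta> b \<in> under ?\<mu> \<nu>" "h b c \<in> under ?\<mu> \<nu>"
        using max[OF b\<delta>(2) cb(2)] by blast
      have "h \<delta> c \<in> G \<nu>" unfolding G_def B_def using b\<delta>(1) cb(1) \<nu>(2,3) by blast
      then have "h \<delta> c \<in> underS ?\<mu> i" by (rule clos[OF \<nu>(1)])
      then show "c \<in> A i \<delta> \<inter> underS ?\<sigma> b"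
        unfolding A_def using underS_trans[OF \<sigma>wo cb(1) b\<delta>(1)] cb(1) by blast
    next
      fix b c assume b: "b \<in> A i \<delta>" and c: "c \<in> A i \<delta> \<inter> underS ?\<sigma> b"
      have b\<delta>: "b \<in> underS ?\<sigma> \<delta>" "h \<delta> b \<in> underS ?\<mu> i" using b unfolding A_def by blast+
      have c\<delta>: "c \<in> underS ?\<sigma> \<delta>" "h \<delta> c \<in> underS ?\<mu> i" "c \<in> underS ?\<sigma> b" using c unfolding A_def by blast+
      obtain \<nu> where \<nu>: "\<nu> \<in> underS ?\<mu> i" "h \<delta> b \<in> under ?\<mu> \<nu>" "h \<delta> c \<in> under ?\<mu> \<nu>"
        using max[OF b\<delta>(2) c\<delta>(2)] by blast
      have "h b c \<in> G \<nu>" unfolding G_def B_def using b\<delta>(1) c\<delta>(1,3) \<nu>(2,3) by blast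
      then have "h b c \<in> underS ?\<mu> i" by (rule clos[OF \<nu>(1)])
      then show "c \<in> A i b" unfolding A_def using c\<delta>(3) by blast
    qed
    then show ?thesis using i(2) underS_Field_right[OF i(2)] by blast
  qed
  \<comment> \<open>Emptying the sets that are not good makes coherence unconditional, since
    goodness passes from \<alpha> to the members of \<open>A i \<alpha>\<close>.\<close>
  define a where "a i \<alpha> = (if good i \<alpha> then A i \<alpha> else {})" for i \<alpha>
  have a1: "a i \<alpha> \<subseteq> underS ?\<sigma> \<alpha>" for i \<alpha> unfolding a_def A_def by auto
  have a2: "|a i \<alpha>| \<le>o \<theta>" for i \<alpha>
    unfolding a_def by (cases "good i \<alpha>") (simp_all add: A_card Card_order_empty[OF theta(1)])
  have a3: "a i \<beta> = a i \<alpha> \<inter> underS ?\<sigma> \<beta>" if b: "\<beta> \<in> a i \<alpha>" for i \<alpha> \<beta>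
  proof -
    have g: "good i \<alpha>" and bA: "\<beta> \<in> A i \<alpha>" using b unfolding a_def by (auto split: if_splits)
    have eq: "A i \<beta> = A i \<alpha> \<inter> underS ?\<sigma> \<beta>" using g bA unfolding good_def by blast
    have "good i \<beta>"
      unfolding good_def
    proof
      fix c assume c: "c \<in> A i \<beta>"
      then have "c \<in> A i \<alpha>" "c \<in> underS ?\<sigma> \<beta>" using eq by blast+
      then have "A i c = A i \<alpha> \<inter> underS ?\<sigma> c" "underS ?\<sigma> c \<subseteq> underS ?\<sigma> \<beta>"
        using g underS_trans[OF \<sigma>wo] unfolding good_def by blast+
      then show "A i c = A i \<beta> \<inter> underS ?\<sigma> c" using eq by blast
    qed
    then show ?thesis using eq g unfolding a_def by simp
  qed
  have "\<forall>i. \<exists>s. (\<forall>y \<eta> t b. s y \<eta> t = Some b \<longrightarrow> t \<in> Field \<theta> \<and> b \<in> a i y) \<and>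
    (\<forall>\<delta>. \<exists>\<eta>\<in>Field ?\<mu>. \<exists>j. (\<forall>x\<in>a i \<delta>. j x \<in> Field \<theta>) \<and> (\<forall>y\<in>a i \<delta>. \<forall>x\<in>a i y. s y \<eta> (j x) = Some x))"
    by (intro allI coherent_enumeration[OF theta \<sigma>wo a1 a2 a3])
  from choice[OF this] obtain s where s: "\<forall>i. (\<forall>y \<eta> t b. s i y \<eta> t = Some b \<longrightarrow> t \<in> Field \<theta> \<and> b \<in> a i y) \<and>
    (\<forall>\<delta>. \<exists>\<eta>\<in>Field ?\<mu>. \<exists>j. (\<forall>x\<in>a i \<delta>. j x \<in> Field \<theta>) \<and> (\<forall>y\<in>a i \<delta>. \<forall>x\<in>a i y. s i y \<eta> (j x) = Some x))" ..
  \<comment> \<open>In a parameter pair the first entry selects the coherent layer and the second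
    bounds the ranks.\<close>
  have "square_family \<theta> ?\<sigma> (Field ?\<mu> \<times> Field ?\<mu>) (\<lambda>y p. s (fst p) y (snd p))"
    unfolding square_family_def
  proof (intro conjI allI impI)
    fix y p t b assume "s (fst p) y (snd p) t = Some b"
    then have "t \<in> Field \<theta> \<and> b \<in> a (fst p) y" using s by blast
    then show "t \<in> Field \<theta>" "b \<in> underS ?\<sigma> y" using a1 by blast+
  next
    fix X assume X: "X \<subseteq> Field ?\<sigma> \<and> |X| \<le>o \<theta>"
    have XF: "X \<subseteq> Field ?\<sigma>" using X by blast
    have "|X| <o ?\<sigma>"
      using ordLess_transitive[OF less cardSuc_greater[OF \<mu>c]] X by blast
    then obtain \<delta> where \<delta>: "\<delta> \<in> Field ?\<sigma>" "X \<subseteq> underS ?\<sigma> \<delta>" by (rule regularCard_bound[OF \<sigma>(1,2) XF])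
    have "h \<delta> ` X \<subseteq> Field ?\<mu>" using hF \<delta>(2) by blast
    moreover have "|h \<delta> ` X| <o ?\<mu>" by (rule card_image_ordLess[OF less]) (use X in blast)
    ultimately obtain i0 where i0: "i0 \<in> Field ?\<mu>" "h \<delta> ` X \<subseteq> underS ?\<mu> i0"
      by (rule regularCard_bound[OF \<mu>(1,2)])
    obtain i where i: "i \<in> Field ?\<mu>" "i0 \<in> underS ?\<mu> i" "good i \<delta>" using ex_good[OF i0(1)] by blast
    have Xa: "X \<subseteq> a i \<delta>"
      using \<delta>(2) i0(2) underS_trans[OF \<mu>wo _ i(2)] i(3) unfolding a_def A_def by auto
    obtain \<eta> j where \<eta>: "\<eta> \<in> Field ?\<mu>" and j: "\<forall>x\<in>a i \<delta>. j x \<in> Field \<theta>"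
      "\<forall>y\<in>a i \<delta>. \<forall>x\<in>a i y. s i y \<eta> (j x) = Some x"
      using spec[OF conjunct2[OF spec[OF s, of i]], of \<delta>] by (elim bexE exE conjE)
    have "s i y \<eta> (j x) = Some x" if "y \<in> X" "x \<in> X" "x \<in> underS ?\<sigma> y" for x y
    proof -
      have "y \<in> a i \<delta>" "x \<in> a i \<delta>" using Xa that by blast+
      moreover then have "x \<in> a i y" using a3[of y i \<delta>] that(3) by blast
      ultimately show ?thesis using j(2) by blast
    qed
    then show "\<exists>p\<in>Field ?\<mu> \<times> Field ?\<mu>. \<exists>j. (\<forall>x\<in>X. j x \<in> Field \<theta>) \<and>
      (\<forall>y\<in>X. \<forall>x\<in>X. x \<in> underS ?\<sigma> y \<longrightarrow> s (fst p) y (snd p) (j x) = Some x)"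
      using \<eta> i(1) j(1) Xa by (intro bexI[of _ "(i, \<eta>)"] exI[of _ j]) auto
  qed
  then show ?thesis by blast
qed

text \<open>The parameter that decodes the chain is known only once the chain is complete. So
  \<open>x \<epsilon>\<close> clears the challenges of all parameters at
  \<open>y \<epsilon>\<close>, which is possible as \<open>|Q|\<close> is below \<sigma>; afterwards
  the family is applied to all \<open>x\<close> and \<open>y\<close> together.\<close>

lemma square_guessing:
  fixes \<theta> :: "'t rel" and \<sigma> :: "'l rel"
  assumes theta: "Card_order \<theta>" "infinite (Field \<theta>)"
    and \<sigma>: "Cinfinite \<sigma>" "regularCard \<sigma>" and less: "\<theta> <o \<sigma>"
    and Q: "|Q| <o \<sigma>" and s: "square_family \<theta> \<sigma> Q s"
  shows "guessing \<theta> \<sigma>"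
  unfolding guessing_def
proof (intro exI[of _ "(\<lambda>(y, p). s y p) ` (Field \<sigma> \<times> Q)"] conjI ballI allI impI)
  let ?S = "(\<lambda>(y, p). s y p) ` (Field \<sigma> \<times> Q)"
  have \<sigma>c: "Card_order \<sigma>" using \<sigma>(1) by blast
  have \<sigma>wo: "Well_order \<sigma>" by (rule Card_order_imp_Well_order[OF \<sigma>c])
  show "|?S| \<le>o \<sigma>"
    by (rule card_image_ordLeq[OF card_Times_ordLeq[OF \<sigma>(1) card_of_Field_leq[OF \<sigma>c ordLeq_refl[OF \<sigma>c]]
      ordLess_imp_ordLeq[OF Q]]])
  have s1: "\<And>y p t b. s y p t = Some b \<Longrightarrow> t \<in> Field \<theta> \<and> b \<in> underS \<sigma> y"
    and s2: "\<And>X. X \<subseteq> Field \<sigma> \<Longrightarrow> |X| \<le>o \<theta> \<Longrightarrow> \<exists>p\<in>Q. \<exists>j. (\<forall>x\<in>X. j x \<in> Field \<theta>) \<and>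
      (\<forall>y\<in>X. \<forall>x\<in>X. x \<in> underS \<sigma> y \<longrightarrow> s y p (j x) = Some x)"
    using s unfolding square_family_def by blast+
  {
    fix u t b assume "u \<in> ?S" "u t = Some b"
    then obtain y p where "s y p t = Some b" by auto
    then show "b \<in> Field \<sigma>" using s1 underS_Field_left by fast
  }
  fix \<beta> assume \<beta>: "\<forall>s\<in>?S. \<beta> s \<in> Field \<sigma>"
  have "\<exists>x y. \<forall>\<epsilon>\<in>Field \<theta>. x \<epsilon> \<in> Field \<sigma> \<and> y \<epsilon> \<in> underS \<sigma> (x \<epsilon>) \<and>
    (\<lambda>p. \<beta> (s (y \<epsilon>) p)) ` Q \<subseteq> underS \<sigma> (x \<epsilon>) \<and> (\<forall>\<zeta>\<in>underS \<theta> \<epsilon>. x \<zeta> \<in> underS \<sigma> (y \<epsilon>))"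
  proof (rule interleaved_chain[OF theta(1) \<sigma> less])
    fix y assume "y \<in> Field \<sigma>"
    then show "(\<lambda>p. \<beta> (s y p)) ` Q \<subseteq> Field \<sigma> \<and> |(\<lambda>p. \<beta> (s y p)) ` Q| <o \<sigma>"
      using \<beta> card_image_ordLess[OF Q] by auto
  next
    fix \<alpha> assume "\<alpha> \<in> Field \<sigma>"
    then obtain \<gamma> where "\<gamma> \<in> Field \<sigma>" "\<alpha> \<in> underS \<sigma> \<gamma>" by (rule Cinfinite_limit[OF \<sigma>(1)])
    then show "\<exists>\<gamma>\<in>Field \<sigma>. \<alpha> \<in> underS \<sigma> \<gamma>" by blast
  qed simp
  then obtain x y where xy: "\<forall>\<epsilon>\<in>Field \<theta>. x \<epsilon> \<in> Field \<sigma> \<and> y \<epsilon> \<in> underS \<sigma> (x \<epsilon>) \<and>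
    (\<lambda>p. \<beta> (s (y \<epsilon>) p)) ` Q \<subseteq> underS \<sigma> (x \<epsilon>) \<and> (\<forall>\<zeta>\<in>underS \<theta> \<epsilon>. x \<zeta> \<in> underS \<sigma> (y \<epsilon>))"
    by (elim exE)
  have yF: "y \<epsilon> \<in> Field \<sigma>" if "\<epsilon> \<in> Field \<theta>" for \<epsilon> using xy that underS_Field_left by fast
  have xF: "x \<epsilon> \<in> Field \<sigma>" if "\<epsilon> \<in> Field \<theta>" for \<epsilon> using xy that by blast
  let ?X = "x ` Field \<theta> \<union> y ` Field \<theta>"
  have t: "|Field \<theta>| \<le>o \<theta>" by (rule card_of_Field_leq[OF theta(1) ordLeq_refl[OF theta(1)]])
  have "|?X| \<le>o \<theta>"
    by (rule card_of_Un_ordLeq_infinite_Field[OF theta(2) card_image_ordLeq[OF t] card_image_ordLeq[OF t] theta(1)])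
  moreover have "?X \<subseteq> Field \<sigma>" using xF yF by auto
  ultimately have "\<exists>p\<in>Q. \<exists>j. (\<forall>x\<in>?X. j x \<in> Field \<theta>) \<and>
      (\<forall>y\<in>?X. \<forall>x\<in>?X. x \<in> underS \<sigma> y \<longrightarrow> s y p (j x) = Some x)" by (intro s2)
  then obtain p j where p: "p \<in> Q" and j: "\<forall>x\<in>?X. j x \<in> Field \<theta>"
    and sj: "\<forall>y\<in>?X. \<forall>x\<in>?X. x \<in> underS \<sigma> y \<longrightarrow> s y p (j x) = Some x"
    by (elim bexE exE conjE)
  show "\<exists>x j. \<forall>\<epsilon>\<in>Field \<theta>. x \<epsilon> \<in> Field \<sigma> \<and> j \<epsilon> \<in> Field \<theta> \<and>
    (\<exists>u\<in>?S. \<beta> u \<in> underS \<sigma> (x \<epsilon>) \<and> (\<forall>\<zeta>\<in>underS \<theta> \<epsilon>. u (j \<zeta>) = Some (x \<zeta>)))"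
    proof (intro exI[of _ x] exI[of _ "\<lambda>\<epsilon>. j (x \<epsilon>)"] ballI conjI)
      fix \<epsilon> assume e: "\<epsilon> \<in> Field \<theta>"
      show "x \<epsilon> \<in> Field \<sigma>" by (rule xF[OF e])
      show "j (x \<epsilon>) \<in> Field \<theta>" using j e by blast
      show "\<exists>u\<in>?S. \<beta> u \<in> underS \<sigma> (x \<epsilon>) \<and> (\<forall>\<zeta>\<in>underS \<theta> \<epsilon>. u (j (x \<zeta>)) = Some (x \<zeta>))"
      proof (intro bexI[of _ "s (y \<epsilon>) p"] conjI ballI)
        show "\<beta> (s (y \<epsilon>) p) \<in> underS \<sigma> (x \<epsilon>)" using xy e p by blast
        fix \<zeta> assume z: "\<zeta> \<in> underS \<theta> \<epsilon>"
        have "x \<zeta> \<in> underS \<sigma> (y \<epsilon>)" using xy e z by blast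
        then show "s (y \<epsilon>) p (j (x \<zeta>)) = Some (x \<zeta>)" using sj e underS_Field_left[OF z] by blast
      next
        show "s (y \<epsilon>) p \<in> ?S" using yF[OF e] p by (intro image_eqI[of _ _ "(y \<epsilon>, p)"]) auto
      qed
  qed
qed


subsection \<open>Club guessing\<close>

text \<open>The retraction onto a club: the largest closure point that is not above
  \<open>b\<close>.\<close>

definition last_point :: "'l rel \<Rightarrow> ('l \<Rightarrow> 'l) \<Rightarrow> 'l \<Rightarrow> 'l" where
  "last_point r \<phi> b = (SOME d. d \<in> closure_points r \<phi> \<and> (d, b) \<in> r \<and>
    (\<forall>c\<in>closure_points r \<phi>. (c, b) \<in> r \<longrightarrow> (c, d) \<in> r))"

lemma last_point:
  assumes r: "Well_order r" and b: "b \<in> Field r"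
  shows "last_point r \<phi> b \<in> closure_points r \<phi>" "(last_point r \<phi> b, b) \<in> r"
    "\<And>c. c \<in> closure_points r \<phi> \<Longrightarrow> (c, b) \<in> r \<Longrightarrow> (c, last_point r \<phi> b) \<in> r"
proof -
  let ?C = "closure_points r \<phi>"
  let ?M = "{c\<in>?C. (c, b) \<in> r}"
  let ?B = "{z\<in>Field r. \<forall>c\<in>?M. (c, z) \<in> r}"
  have B: "?B \<subseteq> Field r" "?B \<noteq> {}" using b by blast+
  obtain d where d: "d \<in> ?B" "\<And>z. z \<in> ?B \<Longrightarrow> (d, z) \<in> r" by (rule least_in[OF r B]) blast
  have dF: "d \<in> Field r" using d(1) by blast
  have db: "(d, b) \<in> r" by (rule d(2)) (use b in blast)
  have "d \<in> ?C"
  proof (cases "d \<in> ?M")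
    case False
    have "\<phi> \<nu> \<in> underS r d" if \<nu>: "\<nu> \<in> underS r d" for \<nu>
    proof -
      have \<nu>F: "\<nu> \<in> Field r" by (rule underS_Field_left[OF \<nu>])
      have "(d, \<nu>) \<notin> r" using underS_le_trans[OF r \<nu>, of \<nu>] underS_irrefl[of \<nu> r] by blast
      then obtain c where c: "c \<in> ?M" "(c, \<nu>) \<notin> r" using d(2)[of \<nu>] \<nu>F by blast
      have cF: "c \<in> Field r" using c(1) closure_points_sub[of r \<phi>] by blast
      have "\<nu> \<in> underS r c" using c(2) not_underS_iff[OF r \<nu>F cF] by blast
      then have "\<phi> \<nu> \<in> underS r c" using c(1) unfolding closure_points_def by blast
      moreover have "(c, d) \<in> r" using d(1) c(1) by blast
      ultimately show ?thesis by (rule underS_le_trans[OF r])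
    qed
    then show ?thesis unfolding closure_points_def using dF by blast
  qed blast
  then have ex: "d \<in> ?C \<and> (d, b) \<in> r \<and> (\<forall>c\<in>?C. (c, b) \<in> r \<longrightarrow> (c, d) \<in> r)"
    using db d(1) by blast
  have "last_point r \<phi> b \<in> ?C \<and> (last_point r \<phi> b, b) \<in> r \<and>
    (\<forall>c\<in>?C. (c, b) \<in> r \<longrightarrow> (c, last_point r \<phi> b) \<in> r)"
    unfolding last_point_def by (rule someI[where P = "\<lambda>d. d \<in> ?C \<and> (d, b) \<in> r \<and>
      (\<forall>c\<in>?C. (c, b) \<in> r \<longrightarrow> (c, d) \<in> r)", OF ex])
  then show "last_point r \<phi> b \<in> ?C" "(last_point r \<phi> b, b) \<in> r"
    "\<And>c. c \<in> ?C \<Longrightarrow> (c, b) \<in> r \<Longrightarrow> (c, last_point r \<phi> b) \<in> r" by blast+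
qed

lemma last_point_self:
  assumes r: "Well_order r" and d: "d \<in> closure_points r \<phi>"
  shows "last_point r \<phi> d = d"
proof -
  have dF: "d \<in> Field r" by (rule subsetD[OF closure_points_sub d])
  show ?thesis
    using wo_le_antisym[OF r last_point(2)[OF r dF] last_point(3)[OF r dF d wo_le_refl[OF r dF]]] .
qed

lemma closure_points_mono:
  assumes r: "Well_order r" and le: "\<And>\<nu>. \<nu> \<in> Field r \<Longrightarrow> (\<psi> \<nu>, \<phi> \<nu>) \<in> r"
  shows "closure_points r \<phi> \<subseteq> closure_points r \<psi>"
proof
  fix \<gamma> assume \<gamma>: "\<gamma> \<in> closure_points r \<phi>"
  have "\<psi> \<nu> \<in> underS r \<gamma>" if \<nu>: "\<nu> \<in> underS r \<gamma>" for \<nu>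
  proof -
    have "\<phi> \<nu> \<in> underS r \<gamma>" using \<gamma> \<nu> unfolding closure_points_def by blast
    then show ?thesis by (rule le_underS_trans[OF r le[OF underS_Field_left[OF \<nu>]]])
  qed
  then show "\<gamma> \<in> closure_points r \<psi>" using \<gamma> unfolding closure_points_def by blast
qed

text \<open>The retraction given by \<psi> moves every ordinal recorded at the points
  \<open>y \<epsilon>\<close>, not just the chain, into the club of \<phi>, and leaves the chain
  fixed. Whole records matter because at larger cardinals the challenge is evaluated at the complete
  translated map.\<close>

definition guesses ::
    "'t rel \<Rightarrow> 'l rel \<Rightarrow> 'p set \<Rightarrow> ('l \<Rightarrow> 'p \<Rightarrow> 't \<Rightarrow> 'l option) \<Rightarrow> ('l \<Rightarrow> 'l) \<Rightarrow> ('l \<Rightarrow> 'l) \<Rightarrow> bool" where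
  "guesses \<theta> \<sigma> Q s \<psi> \<phi> \<longleftrightarrow> (\<exists>p\<in>Q. \<exists>x y j. \<forall>\<epsilon>\<in>Field \<theta>. j \<epsilon> \<in> Field \<theta> \<and>
    x \<epsilon> \<in> closure_points \<sigma> \<phi> \<and> y \<epsilon> \<in> underS \<sigma> (x \<epsilon>) \<and>
    (\<forall>t b. s (y \<epsilon>) p t = Some b \<longrightarrow> last_point \<sigma> \<psi> b \<in> closure_points \<sigma> \<phi>) \<and>
    (\<forall>\<zeta>\<in>underS \<theta> \<epsilon>. s (y \<epsilon>) p (j \<zeta>) = Some (x \<zeta>) \<and> last_point \<sigma> \<psi> (x \<zeta>) = x \<zeta>))"

text \<open>
  Iterating a failure of guessing \<open>\<theta>\<^sup>+\<close> times produces a decreasing sequence of clubs; the last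
  points below the at most \<open>\<theta>\<close> relevant ordinals decrease along it, hence stabilise.
\<close>

lemma club_guessing:
  fixes \<theta> :: "'t rel" and Q :: "'p set"
  defines "\<mu> \<equiv> cardSuc \<theta>" and "\<sigma> \<equiv> cardSuc (cardSuc \<theta>)"
  assumes theta: "Card_order \<theta>" "infinite (Field \<theta>)" and sq: "square_family \<theta> \<sigma> Q s"
  shows "\<exists>\<psi>. \<forall>\<phi>. (\<forall>\<nu>\<in>Field \<sigma>. \<phi> \<nu> \<in> Field \<sigma>) \<longrightarrow> guesses \<theta> \<sigma> Q s \<psi> \<phi>"
proof (rule ccontr)
  assume "\<not> ?thesis"
  then have "\<forall>\<psi>. \<exists>\<phi>. (\<forall>\<nu>\<in>Field \<sigma>. \<phi> \<nu> \<in> Field \<sigma>) \<and> \<not> guesses \<theta> \<sigma> Q s \<psi> \<phi>" by blast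
  from choice[OF this] obtain bad where
    bad: "\<forall>\<psi>. (\<forall>\<nu>\<in>Field \<sigma>. bad \<psi> \<nu> \<in> Field \<sigma>) \<and> \<not> guesses \<theta> \<sigma> Q s \<psi> (bad \<psi>)" ..
  have badF: "bad \<psi> \<nu> \<in> Field \<sigma>" if "\<nu> \<in> Field \<sigma>" for \<psi> \<nu> using spec[OF bad, of \<psi>] that by blast
  note \<mu> = infinite_cardSuc[OF theta, folded \<mu>_def]
  have \<mu>c: "Card_order \<mu>" and \<mu>inf: "infinite (Field \<mu>)" using \<mu>(1) unfolding cinfinite_def by blast+
  have \<sigma>\<mu>: "\<sigma> = cardSuc \<mu>" unfolding \<sigma>_def \<mu>_def ..
  note \<sigma> = infinite_cardSuc[OF \<mu>c \<mu>inf, folded \<sigma>\<mu>]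
  have \<sigma>wo: "Well_order \<sigma>" and \<mu>wo: "Well_order \<mu>"
    using \<sigma>(1) \<mu>c Card_order_imp_Well_order by blast+
  have \<theta>\<mu>: "\<theta> <o \<mu>" unfolding \<mu>_def by (rule cardSuc_greater[OF theta(1)])
  have \<mu>\<sigma>: "\<mu> <o \<sigma>" unfolding \<sigma>\<mu> by (rule cardSuc_greater[OF \<mu>c])
  have \<theta>\<sigma>: "\<theta> <o \<sigma>" by (rule ordLess_transitive[OF \<theta>\<mu> \<mu>\<sigma>])
  \<comment> \<open>Each stage dominates all earlier functions together with their counterexamples,
    so its club lies inside the clubs of both.\<close>
  define R where "R f \<xi> \<phi> \<longleftrightarrow> (\<forall>\<nu>\<in>Field \<sigma>. \<phi> \<nu> \<in> Field \<sigma> \<and>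
      (\<forall>\<zeta>\<in>underS \<mu> \<xi>. f \<zeta> \<nu> \<in> underS \<sigma> (\<phi> \<nu>) \<and> bad (f \<zeta>) \<nu> \<in> underS \<sigma> (\<phi> \<nu>)))"
    for f :: "'t set \<Rightarrow> 't set set \<Rightarrow> 't set set" and \<xi> \<phi>
  have ex_bound: "\<exists>\<phi>. \<forall>\<nu>\<in>Field \<sigma>. \<phi> \<nu> \<in> Field \<sigma> \<and>
      (\<forall>\<zeta>\<in>Z. f \<zeta> \<nu> \<in> underS \<sigma> (\<phi> \<nu>) \<and> bad (f \<zeta>) \<nu> \<in> underS \<sigma> (\<phi> \<nu>))"
    if Z: "|Z| <o \<sigma>" and f: "\<And>\<zeta> \<nu>. \<zeta> \<in> Z \<Longrightarrow> \<nu> \<in> Field \<sigma> \<Longrightarrow> f \<zeta> \<nu> \<in> Field \<sigma>"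
    for Z and f :: "'t set \<Rightarrow> 't set set \<Rightarrow> 't set set"
  proof -
    have "\<exists>y. y \<in> Field \<sigma> \<and> (\<forall>\<zeta>\<in>Z. f \<zeta> \<nu> \<in> underS \<sigma> y \<and> bad (f \<zeta>) \<nu> \<in> underS \<sigma> y)"
      if \<nu>: "\<nu> \<in> Field \<sigma>" for \<nu>
    proof -
      let ?A = "(\<lambda>\<zeta>. f \<zeta> \<nu>) ` Z \<union> (\<lambda>\<zeta>. bad (f \<zeta>) \<nu>) ` Z"
      have "|?A| <o \<sigma>" by (rule card_Un_ordLess[OF \<sigma>(1) card_image_ordLess[OF Z] card_image_ordLess[OF Z]])
      moreover have A: "?A \<subseteq> Field \<sigma>" using f[OF _ \<nu>] badF[OF \<nu>] by blast
      ultimately obtain y where "y \<in> Field \<sigma>" "?A \<subseteq> underS \<sigma> y"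
        using regularCard_bound[OF \<sigma>(1,2) A] by metis
      then show ?thesis by blast
    qed
    then have "\<forall>\<nu>\<in>Field \<sigma>. \<exists>y. y \<in> Field \<sigma> \<and> (\<forall>\<zeta>\<in>Z. f \<zeta> \<nu> \<in> underS \<sigma> y \<and> bad (f \<zeta>) \<nu> \<in> underS \<sigma> y)"
      by blast
    from bchoice[OF this] show ?thesis .
  qed
  have "\<exists>f. \<forall>\<xi>\<in>Field \<mu>. R f \<xi> (f \<xi>)"
  proof (rule wo_choice[OF \<mu>wo])
    fix f g :: "'t set \<Rightarrow> 't set set \<Rightarrow> 't set set" and \<xi> \<phi>
    assume "\<And>z. z \<in> underS \<mu> \<xi> \<Longrightarrow> f z = g z"
    then show "R f \<xi> \<phi> = R g \<xi> \<phi>" unfolding R_def by simp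
  next
    fix f :: "'t set \<Rightarrow> 't set set \<Rightarrow> 't set set" and \<xi>
    assume \<xi>: "\<xi> \<in> Field \<mu>" and IH: "\<And>\<zeta>. \<zeta> \<in> underS \<mu> \<xi> \<Longrightarrow> R f \<zeta> (f \<zeta>)"
    show "\<exists>\<phi>. R f \<xi> \<phi>"
      unfolding R_def
    proof (rule ex_bound)
      show "|underS \<mu> \<xi>| <o \<sigma>" by (rule ordLess_transitive[OF card_of_underS[OF \<mu>c \<xi>] \<mu>\<sigma>])
      fix \<zeta> \<nu> assume "\<zeta> \<in> underS \<mu> \<xi>" "\<nu> \<in> Field \<sigma>"
      then show "f \<zeta> \<nu> \<in> Field \<sigma>" using IH[of \<zeta>] unfolding R_def by blast
    qed
  qed
  then obtain \<Phi> where \<Phi>: "\<forall>\<xi>\<in>Field \<mu>. R \<Phi> \<xi> (\<Phi> \<xi>)" ..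
  have \<Phi>F: "\<Phi> \<xi> \<nu> \<in> Field \<sigma>" if "\<xi> \<in> Field \<mu>" "\<nu> \<in> Field \<sigma>" for \<xi> \<nu>
    using \<Phi> that unfolding R_def by blast
  have \<Phi>lt: "\<Phi> \<zeta> \<nu> \<in> underS \<sigma> (\<Phi> \<xi> \<nu>)" "bad (\<Phi> \<zeta>) \<nu> \<in> underS \<sigma> (\<Phi> \<xi> \<nu>)"
    if "\<zeta> \<in> underS \<mu> \<xi>" "\<nu> \<in> Field \<sigma>" for \<zeta> \<xi> \<nu>
    using \<Phi> that underS_Field_right[OF that(1)] unfolding R_def by blast+
  have \<Phi>sub: "closure_points \<sigma> (\<Phi> \<xi>) \<subseteq> closure_points \<sigma> (\<Phi> \<zeta>)"
    "closure_points \<sigma> (\<Phi> \<xi>) \<subseteq> closure_points \<sigma> (bad (\<Phi> \<zeta>))" if "\<zeta> \<in> underS \<mu> \<xi>" for \<zeta> \<xi>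
    by (rule closure_points_mono[OF \<sigma>wo], rule underS_imp_le, rule \<Phi>lt[OF that], assumption)+
  \<comment> \<open>A function above all stages, possible since there are fewer than \<sigma> of
    them. A chain in its club lies in the club of every stage and is fixed by every
    retraction.\<close>
  have "\<exists>\<phi>. \<forall>\<nu>\<in>Field \<sigma>. \<phi> \<nu> \<in> Field \<sigma> \<and>
      (\<forall>\<zeta>\<in>Field \<mu>. \<Phi> \<zeta> \<nu> \<in> underS \<sigma> (\<phi> \<nu>) \<and> bad (\<Phi> \<zeta>) \<nu> \<in> underS \<sigma> (\<phi> \<nu>))"
    by (rule ex_bound[OF card_of_Field_less[OF \<mu>c \<mu>\<sigma>] \<Phi>F])
  then obtain \<phi> where \<phi>: "\<forall>\<nu>\<in>Field \<sigma>. \<phi> \<nu> \<in> Field \<sigma> \<and>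
      (\<forall>\<zeta>\<in>Field \<mu>. \<Phi> \<zeta> \<nu> \<in> underS \<sigma> (\<phi> \<nu>) \<and> bad (\<Phi> \<zeta>) \<nu> \<in> underS \<sigma> (\<phi> \<nu>))" ..
  have \<phi>F: "\<And>\<nu>. \<nu> \<in> Field \<sigma> \<Longrightarrow> \<phi> \<nu> \<in> Field \<sigma>" using \<phi> by blast
  have \<phi>sub: "closure_points \<sigma> \<phi> \<subseteq> closure_points \<sigma> (\<Phi> \<xi>)"
    "closure_points \<sigma> \<phi> \<subseteq> closure_points \<sigma> (bad (\<Phi> \<xi>))" if "\<xi> \<in> Field \<mu>" for \<xi>
    by (rule closure_points_mono[OF \<sigma>wo], rule underS_imp_le, use \<phi> that in blast)+
  have "\<exists>x y. \<forall>\<epsilon>\<in>Field \<theta>. x \<epsilon> \<in> closure_points \<sigma> \<phi> \<and> y \<epsilon> \<in> underS \<sigma> (x \<epsilon>) \<and>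
    {} \<subseteq> underS \<sigma> (x \<epsilon>) \<and> (\<forall>\<zeta>\<in>underS \<theta> \<epsilon>. x \<zeta> \<in> underS \<sigma> (y \<epsilon>))"
  proof (rule interleaved_chain[OF theta(1) \<sigma>(1,2) \<theta>\<sigma>])
    show "closure_points \<sigma> \<phi> \<subseteq> Field \<sigma>" by (rule closure_points_sub)
    fix \<alpha> assume \<alpha>: "\<alpha> \<in> Field \<sigma>"
    obtain \<gamma> where "\<gamma> \<in> closure_points \<sigma> \<phi>" "\<alpha> \<in> underS \<sigma> \<gamma>"
      by (rule closure_points_cofinal[of \<sigma> \<phi> \<alpha>, OF \<sigma> \<phi>F \<alpha>])
    then show "\<exists>\<gamma>\<in>closure_points \<sigma> \<phi>. \<alpha> \<in> underS \<sigma> \<gamma>" by blast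
  next
    fix y assume "y \<in> Field \<sigma>"
    have "|{} :: 't set set set| <o \<sigma>" by (rule card_finite_ordLess[OF \<sigma>(1)]) simp
    then show "{} \<subseteq> Field \<sigma> \<and> |{} :: 't set set set| <o \<sigma>" by blast
  qed
  then obtain x y where xy: "\<forall>\<epsilon>\<in>Field \<theta>. x \<epsilon> \<in> closure_points \<sigma> \<phi> \<and> y \<epsilon> \<in> underS \<sigma> (x \<epsilon>) \<and>
    {} \<subseteq> underS \<sigma> (x \<epsilon>) \<and> (\<forall>\<zeta>\<in>underS \<theta> \<epsilon>. x \<zeta> \<in> underS \<sigma> (y \<epsilon>))" by (elim exE)
  have xC: "x \<epsilon> \<in> closure_points \<sigma> \<phi>" and yx: "y \<epsilon> \<in> underS \<sigma> (x \<epsilon>)" if "\<epsilon> \<in> Field \<theta>" for \<epsilon>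
    using xy that by blast+
  have xF: "x \<epsilon> \<in> Field \<sigma>" and yF: "y \<epsilon> \<in> Field \<sigma>" if "\<epsilon> \<in> Field \<theta>" for \<epsilon>
    by (rule underS_Field_right[OF yx[OF that]], rule underS_Field_left[OF yx[OF that]])
  let ?X = "x ` Field \<theta> \<union> y ` Field \<theta>"
  have t: "|Field \<theta>| \<le>o \<theta>" by (rule card_of_Field_leq[OF theta(1) ordLeq_refl[OF theta(1)]])
  have X_card: "|?X| \<le>o \<theta>"
    by (rule card_of_Un_ordLeq_infinite_Field[OF theta(2) card_image_ordLeq[OF t] card_image_ordLeq[OF t] theta(1)])
  have XF: "?X \<subseteq> Field \<sigma>" using xF yF by auto
  have s1: "\<And>y p t b. s y p t = Some b \<Longrightarrow> t \<in> Field \<theta> \<and> b \<in> underS \<sigma> y"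
    and s2: "\<And>X. X \<subseteq> Field \<sigma> \<Longrightarrow> |X| \<le>o \<theta> \<Longrightarrow> \<exists>p\<in>Q. \<exists>j. (\<forall>x\<in>X. j x \<in> Field \<theta>) \<and>
      (\<forall>y\<in>X. \<forall>x\<in>X. x \<in> underS \<sigma> y \<longrightarrow> s y p (j x) = Some x)"
    using sq unfolding square_family_def by blast+
  obtain p j where p: "p \<in> Q" and j: "\<forall>x\<in>?X. j x \<in> Field \<theta>"
    and sj: "\<forall>y\<in>?X. \<forall>x\<in>?X. x \<in> underS \<sigma> y \<longrightarrow> s y p (j x) = Some x"
    using s2[OF XF X_card] by (elim bexE exE conjE)
  \<comment> \<open>The ordinals whose last points have to stabilise: they are recorded at \<theta>
    points under at most \<theta> labels, so they are fewer than the stages.\<close>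
  define B where "B = {b. \<exists>\<epsilon>\<in>Field \<theta>. \<exists>t. s (y \<epsilon>) p t = Some b}"
  have BF: "B \<subseteq> Field \<sigma>" unfolding B_def using s1 underS_Field_left by fast
  have "B \<subseteq> (\<lambda>(\<epsilon>, t). the (s (y \<epsilon>) p t)) ` (Field \<theta> \<times> Field \<theta>)"
  proof
    fix b assume "b \<in> B"
    then obtain \<epsilon> t where et: "\<epsilon> \<in> Field \<theta>" "s (y \<epsilon>) p t = Some b" unfolding B_def by blast
    then have "(\<epsilon>, t) \<in> Field \<theta> \<times> Field \<theta>" using s1 by blast
    then show "b \<in> (\<lambda>(\<epsilon>, t). the (s (y \<epsilon>) p t)) ` (Field \<theta> \<times> Field \<theta>)"
      using et(2) by (intro image_eqI[of _ _ "(\<epsilon>, t)"]) simp_all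
  qed
  moreover have "Cinfinite \<theta>" using theta unfolding cinfinite_def by blast
  then have "|(\<lambda>(\<epsilon>, t). the (s (y \<epsilon>) p t)) ` (Field \<theta> \<times> Field \<theta>)| \<le>o \<theta>"
    by (rule card_image_ordLeq[OF card_Times_ordLeq[OF _ t t]])
  ultimately have B_card: "|B| <o \<mu>"
    using ordLeq_ordLess_trans[OF ordLeq_transitive[OF card_of_mono1] \<theta>\<mu>] by blast
  define \<pi> where "\<pi> \<xi> b = last_point \<sigma> (\<Phi> \<xi>) b" for \<xi> b
  have \<pi>dec: "(\<pi> \<xi> b, \<pi> \<zeta> b) \<in> \<sigma>" if z: "\<zeta> \<in> underS \<mu> \<xi>" and b: "b \<in> Field \<sigma>" for \<zeta> \<xi> b
    unfolding \<pi>_def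
    by (rule last_point(3)[OF \<sigma>wo b subsetD[OF \<Phi>sub(1)[OF z] last_point(1)[OF \<sigma>wo b]] last_point(2)[OF \<sigma>wo b]])
  have \<pi>F: "\<pi> \<xi> b \<in> Field \<sigma>" if "b \<in> Field \<sigma>" for \<xi> b
    unfolding \<pi>_def by (rule subsetD[OF closure_points_sub last_point(1)[OF \<sigma>wo that]])
  have "\<forall>b\<in>B. \<exists>\<xi>. \<xi> \<in> Field \<mu> \<and> (\<forall>\<zeta>. \<xi> \<in> underS \<mu> \<zeta> \<longrightarrow> \<pi> \<zeta> b = \<pi> \<xi> b)"
  proof
    fix b assume "b \<in> B"
    then have b: "b \<in> Field \<sigma>" using BF by blast
    have "Field \<mu> \<noteq> {}" using \<mu>inf by auto
    then have A: "(\<lambda>\<xi>. \<pi> \<xi> b) ` Field \<mu> \<subseteq> Field \<sigma>" "(\<lambda>\<xi>. \<pi> \<xi> b) ` Field \<mu> \<noteq> {}" using \<pi>F[OF b] by auto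
    obtain m where m: "m \<in> (\<lambda>\<xi>. \<pi> \<xi> b) ` Field \<mu>"
      "\<And>z. z \<in> (\<lambda>\<xi>. \<pi> \<xi> b) ` Field \<mu> \<Longrightarrow> (m, z) \<in> \<sigma>" by (rule least_in[OF \<sigma>wo A]) blast
    obtain \<xi> where \<xi>: "\<xi> \<in> Field \<mu>" "m = \<pi> \<xi> b" using m(1) by blast
    have "\<pi> \<zeta> b = \<pi> \<xi> b" if z: "\<xi> \<in> underS \<mu> \<zeta>" for \<zeta>
    proof (rule wo_le_antisym[OF \<sigma>wo \<pi>dec[OF z b]])
      show "(\<pi> \<xi> b, \<pi> \<zeta> b) \<in> \<sigma>" using m(2) \<xi>(2) underS_Field_right[OF z] by blast
    qed
    then show "\<exists>\<xi>. \<xi> \<in> Field \<mu> \<and> (\<forall>\<zeta>. \<xi> \<in> underS \<mu> \<zeta> \<longrightarrow> \<pi> \<zeta> b = \<pi> \<xi> b)" using \<xi>(1) by blast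
  qed
  from bchoice[OF this] obtain st where
    st: "\<forall>b\<in>B. st b \<in> Field \<mu> \<and> (\<forall>\<zeta>. st b \<in> underS \<mu> \<zeta> \<longrightarrow> \<pi> \<zeta> b = \<pi> (st b) b)" ..
  have stF: "st ` B \<subseteq> Field \<mu>" using st by blast
  obtain \<xi> where \<xi>: "\<xi> \<in> Field \<mu>" "st ` B \<subseteq> underS \<mu> \<xi>"
    by (rule regularCard_bound[OF \<mu>(1,2) stF card_image_ordLess[OF B_card]])
  \<comment> \<open>One further stage: the stable last point belongs also to the club of \<xi>',
    hence to the club that was bad for \<xi>.\<close>
  obtain \<xi>' where \<xi>': "\<xi>' \<in> Field \<mu>" "\<xi> \<in> underS \<mu> \<xi>'" by (rule Cinfinite_limit[OF \<mu>(1) \<xi>(1)])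
  have stable: "last_point \<sigma> (\<Phi> \<xi>) b \<in> closure_points \<sigma> (bad (\<Phi> \<xi>))" if b: "b \<in> B" for b
  proof -
    have s: "st b \<in> underS \<mu> \<xi>" using \<xi>(2) b by blast
    have "\<pi> \<xi> b = \<pi> \<xi>' b" using st b s underS_trans[OF \<mu>wo s \<xi>'(2)] by metis
    moreover have "\<pi> \<xi>' b \<in> closure_points \<sigma> (\<Phi> \<xi>')"
      unfolding \<pi>_def by (rule last_point(1)[OF \<sigma>wo]) (use b BF in blast)
    ultimately show ?thesis using \<Phi>sub(2)[OF \<xi>'(2)] unfolding \<pi>_def by auto
  qed
  have "guesses \<theta> \<sigma> Q s (\<Phi> \<xi>) (bad (\<Phi> \<xi>))"
    unfolding guesses_def
  proof (rule bexI[OF _ p], rule exI[of _ x], rule exI[of _ y], rule exI[of _ "\<lambda>\<epsilon>. j (x \<epsilon>)"],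
      intro ballI conjI allI impI)
    fix \<epsilon> assume e: "\<epsilon> \<in> Field \<theta>"
    show "j (x \<epsilon>) \<in> Field \<theta>" using j e by blast
    show "x \<epsilon> \<in> closure_points \<sigma> (bad (\<Phi> \<xi>))" using xC[OF e] \<phi>sub(2)[OF \<xi>(1)] by blast
    show "y \<epsilon> \<in> underS \<sigma> (x \<epsilon>)" by (rule yx[OF e])
    {
      fix t b assume "s (y \<epsilon>) p t = Some b"
      then have "b \<in> B" unfolding B_def using e by blast
      then show "last_point \<sigma> (\<Phi> \<xi>) b \<in> closure_points \<sigma> (bad (\<Phi> \<xi>))" by (rule stable)
    }
    fix \<zeta> assume z: "\<zeta> \<in> underS \<theta> \<epsilon>"
    note zF = underS_Field_left[OF z]
    have "x \<zeta> \<in> underS \<sigma> (y \<epsilon>)" using xy e z by blast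
    then show "s (y \<epsilon>) p (j (x \<zeta>)) = Some (x \<zeta>)" using sj e zF by blast
    show "last_point \<sigma> (\<Phi> \<xi>) (x \<zeta>) = x \<zeta>"
      by (rule last_point_self[OF \<sigma>wo subsetD[OF \<phi>sub(1)[OF \<xi>(1)] xC[OF zF]]])
  qed
  then show False using bad by blast
qed


subsection \<open>Guessing at large regular cardinals\<close>

definition ssup :: "'l rel \<Rightarrow> 'l set \<Rightarrow> 'l" where
  "ssup r A = (SOME z. z \<in> Field r \<and> A \<subseteq> underS r z \<and> (\<forall>w\<in>Field r. A \<subseteq> underS r w \<longrightarrow> (z, w) \<in> r))"

lemma ssup:
  assumes r: "Well_order r" and b: "b \<in> Field r" "A \<subseteq> underS r b"
  shows "ssup r A \<in> Field r" "A \<subseteq> underS r (ssup r A)"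
    "\<And>w. w \<in> Field r \<Longrightarrow> A \<subseteq> underS r w \<Longrightarrow> (ssup r A, w) \<in> r"
proof -
  let ?B = "{z\<in>Field r. A \<subseteq> underS r z}"
  have B: "?B \<subseteq> Field r" "?B \<noteq> {}" using b by blast+
  obtain z where z: "z \<in> ?B" "\<And>w. w \<in> ?B \<Longrightarrow> (z, w) \<in> r" by (rule least_in[OF r B]) blast
  have ex: "z \<in> Field r \<and> A \<subseteq> underS r z \<and> (\<forall>w\<in>Field r. A \<subseteq> underS r w \<longrightarrow> (z, w) \<in> r)"
    using z by blast
  have "ssup r A \<in> Field r \<and> A \<subseteq> underS r (ssup r A) \<and>
    (\<forall>w\<in>Field r. A \<subseteq> underS r w \<longrightarrow> (ssup r A, w) \<in> r)"
    unfolding ssup_def by (rule someI[where P = "\<lambda>z. z \<in> Field r \<and> A \<subseteq> underS r z \<and>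
      (\<forall>w\<in>Field r. A \<subseteq> underS r w \<longrightarrow> (z, w) \<in> r)", OF ex])
  then show "ssup r A \<in> Field r" "A \<subseteq> underS r (ssup r A)"
    "\<And>w. w \<in> Field r \<Longrightarrow> A \<subseteq> underS r w \<Longrightarrow> (ssup r A, w) \<in> r" by blast+
qed

text \<open>
  For every \<open>\<delta>\<close> of cofinality \<open>\<sigma> = \<theta>\<^sup>+\<^sup>+\<close> a cofinal map \<open>e \<delta>\<close> of \<open>\<sigma>\<close> into \<open>\<delta>\<close> is fixed beforehand. An
  increasing map \<open>\<xi>\<close> of \<open>\<sigma>\<close> closed under the challenge \<open>\<beta>\<close> agrees with \<open>e \<delta>\<close>, for
  \<open>\<delta> = sup \<xi>\<close>, on a club of limits, and this club is guessed.
\<close>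

lemma guessing_large:
  fixes \<theta> :: "'t rel" and r :: "'l rel"
  assumes theta: "Card_order \<theta>" "infinite (Field \<theta>)" and r: "Cinfinite r" "regularCard r"
    and less: "cardSuc (cardSuc \<theta>) <o r"
  shows "guessing \<theta> r"
proof -
  define \<mu> where "\<mu> = cardSuc \<theta>"
  define \<sigma> where "\<sigma> = cardSuc (cardSuc \<theta>)"
  define Q where "Q = Field \<mu> \<times> Field \<mu>"
  note \<mu> = infinite_cardSuc[OF theta, folded \<mu>_def]
  have \<mu>c: "Card_order \<mu>" and \<mu>inf: "infinite (Field \<mu>)" using \<mu>(1) unfolding cinfinite_def by blast+
  have \<sigma>\<mu>: "\<sigma> = cardSuc \<mu>" unfolding \<sigma>_def \<mu>_def ..
  note \<sigma> = infinite_cardSuc[OF \<mu>c \<mu>inf, folded \<sigma>\<mu>]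
  have \<sigma>c: "Card_order \<sigma>" and rc: "Card_order r" using \<sigma>(1) r(1) by blast+
  have \<sigma>wo: "Well_order \<sigma>" and rwo: "Well_order r"
    using \<sigma>c rc Card_order_imp_Well_order by blast+
  have \<mu>\<sigma>: "\<mu> <o \<sigma>" unfolding \<sigma>\<mu> by (rule cardSuc_greater[OF \<mu>c])
  have \<sigma>r: "\<sigma> <o r" unfolding \<sigma>_def by (rule less)
  have \<sigma>F: "|Field \<sigma>| <o r" by (rule card_of_Field_less[OF \<sigma>c \<sigma>r])
  have Q\<mu>: "|Q| \<le>o \<mu>" unfolding Q_def
    by (rule card_Times_ordLeq[OF \<mu>(1)]; rule card_of_Field_leq[OF \<mu>c ordLeq_refl[OF \<mu>c]])
  have Qr: "|Q| <o r" by (rule ordLeq_ordLess_trans[OF Q\<mu> ordLess_transitive[OF \<mu>\<sigma> \<sigma>r]])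
  obtain s where s: "square_family \<theta> \<sigma> Q s"
    using square_family_exists[OF theta] unfolding \<sigma>_def Q_def \<mu>_def by blast
  obtain \<psi> where \<psi>: "\<forall>\<phi>. (\<forall>\<nu>\<in>Field \<sigma>. \<phi> \<nu> \<in> Field \<sigma>) \<longrightarrow> guesses \<theta> \<sigma> Q s \<psi> \<phi>"
    using club_guessing[OF theta s[unfolded \<sigma>_def]] unfolding \<sigma>_def by blast
  have s1: "b \<in> underS \<sigma> y" if "s y p t = Some b" for y p t b
    using s that unfolding square_family_def by blast
  \<comment> \<open>Records after retraction: for a guessed club all their entries are closure
    points.\<close>
  define c where "c y p t = map_option (last_point \<sigma> \<psi>) (s y p t)" for y p t
  have c1: "b \<in> underS \<sigma> y" if cb: "c y p t = Some b" for y p t b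
  proof -
    obtain b' where b': "s y p t = Some b'" "b = last_point \<sigma> \<psi> b'" using cb unfolding c_def by auto
    show ?thesis
      unfolding b'(2)
      by (rule le_underS_trans[OF \<sigma>wo last_point(2)[OF \<sigma>wo underS_Field_left[OF s1[OF b'(1)]]] s1[OF b'(1)]])
  qed
  define lim where "lim e k = ssup r (e ` underS \<sigma> k)" for e :: "'t set set \<Rightarrow> 'l" and k
  define adm where "adm e \<delta> \<longleftrightarrow> (\<forall>k\<in>Field \<sigma>. e k \<in> Field r) \<and>
    (\<forall>k. \<forall>l\<in>underS \<sigma> k. e l \<in> underS r (e k)) \<and> \<delta> = ssup r (e ` Field \<sigma>)" for e :: "'t set set \<Rightarrow> 'l" and \<delta>
  define e where "e \<delta> = (SOME e. adm e \<delta>)" for \<delta>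
  define \<Delta> where "\<Delta> = {\<delta>\<in>Field r. \<exists>e. adm e \<delta>}"
  have e: "adm (e \<delta>) \<delta>" if "\<delta> \<in> \<Delta>" for \<delta> using that someI_ex[of "\<lambda>e. adm e \<delta>"] unfolding \<Delta>_def e_def by blast
  have lim_bound: "\<exists>b\<in>Field r. f ` underS \<sigma> k \<subseteq> underS r b"
    if f: "\<And>l. l \<in> underS \<sigma> k \<Longrightarrow> f l \<in> Field r" for f k
  proof -
    have "f ` underS \<sigma> k \<subseteq> Field r" using f by blast
    moreover have "|f ` underS \<sigma> k| <o r"
      by (rule card_image_ordLess[OF card_subset_ordLess[OF Order_Relation.underS_Field \<sigma>F]])
    ultimately obtain b where "b \<in> Field r" "f ` underS \<sigma> k \<subseteq> underS r b"
      by (rule regularCard_bound[OF r])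
    then show ?thesis by blast
  qed
  have lim_props: "lim f k \<in> Field r" "f ` underS \<sigma> k \<subseteq> underS r (lim f k)"
    if f: "\<And>l. l \<in> underS \<sigma> k \<Longrightarrow> f l \<in> Field r" for f k
  proof -
    obtain b where b: "b \<in> Field r" "f ` underS \<sigma> k \<subseteq> underS r b" using lim_bound[of k f, OF f] by blast
    show "lim f k \<in> Field r" "f ` underS \<sigma> k \<subseteq> underS r (lim f k)"
      unfolding lim_def by (rule ssup[OF rwo b])+
  qed
  \<comment> \<open>A record is carried from \<sigma> to \<open>r\<close> by replacing
    \<open>k\<close> with the supremum of \<open>f\<close> below \<open>k\<close>. Two cofinal maps
    into the same \<delta> need not share values, but they share such suprema on a club.\<close>
  define u where "u f y p = (\<lambda>t. map_option (lim f) (c y p t))" for f y p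
  define S where "S = (\<lambda>(\<delta>, y, p). u (e \<delta>) y p) ` (\<Delta> \<times> Field \<sigma> \<times> Q)"
  have S_card: "|S| \<le>o r"
  proof -
    have "|\<Delta>| \<le>o r"
      by (rule ordLeq_transitive[OF card_of_mono1 card_of_Field_leq[OF rc ordLeq_refl[OF rc]]])
        (auto simp: \<Delta>_def)
    moreover have "|Field \<sigma> \<times> Q| \<le>o r"
      by (rule card_Times_ordLeq[OF r(1) ordLess_imp_ordLeq[OF \<sigma>F] ordLess_imp_ordLeq[OF Qr]])
    ultimately show ?thesis unfolding S_def by (rule card_image_ordLeq[OF card_Times_ordLeq[OF r(1)]])
  qed
  have S_Field: "b \<in> Field r" if w: "w \<in> S" and wj: "w j = Some b" for w j b
  proof -
    obtain \<delta> y p where dyp: "\<delta> \<in> \<Delta>" "w = u (e \<delta>) y p" using w unfolding S_def by auto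
    then obtain k where k: "c y p j = Some k" "b = lim (e \<delta>) k" using wj unfolding u_def by auto
    have "e \<delta> l \<in> Field r" if "l \<in> underS \<sigma> k" for l
      using e[OF dyp(1)] underS_Field_left[OF that] unfolding adm_def by blast
    then show ?thesis unfolding k(2) by (rule lim_props)
  qed
  show ?thesis
    unfolding guessing_def
  proof (intro exI[of _ S] conjI ballI allI impI)
    show "|S| \<le>o r" by (rule S_card)
  next
    fix w j b assume "w \<in> S" "w j = Some b"
    then show "b \<in> Field r" by (rule S_Field)
  next
    fix \<beta> assume \<beta>: "\<forall>s\<in>S. \<beta> s \<in> Field r"
    obtain r0 where r0: "r0 \<in> Field r" using r(1) unfolding cinfinite_def by (metis finite.emptyI equals0I)
    \<comment> \<open>During the recursion a translated map may lie outside \<open>S\<close>, where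
      \<beta> is not known to take values in \<open>Field r\<close>.\<close>
    define \<beta>' where "\<beta>' w = (if w \<in> S then \<beta> w else r0)" for w
    have \<beta>'F: "\<beta>' w \<in> Field r" for w using \<beta> r0 unfolding \<beta>'_def by simp
    \<comment> \<open>The entries of \<open>c y p\<close> are below \<open>y\<close>, so for
      \<open>y\<close> up to and including \<open>k\<close> the map \<open>u f y p\<close> is
      determined by \<open>f\<close> below \<open>k\<close>. Hence the challenge at
      \<open>y = k\<close> can already be met by the value at \<open>k\<close>.\<close>
    define G where "G f k = f ` underS \<sigma> k \<union> (\<lambda>(y, p). \<beta>' (u f y p)) ` (under \<sigma> k \<times> Q)"
      for f :: "'t set set \<Rightarrow> 'l" and k
    have "\<exists>\<xi>. \<forall>k\<in>Field \<sigma>. \<xi> k \<in> Field r \<and> G \<xi> k \<subseteq> underS r (\<xi> k)"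
    proof (rule regular_recursion[OF \<sigma>wo r])
      fix f g :: "'t set set \<Rightarrow> 'l" and k
      assume fg: "\<And>z. z \<in> underS \<sigma> k \<Longrightarrow> f z = g z"
      have "u f y p = u g y p" if y: "y \<in> under \<sigma> k" for y p
      proof
        fix t
        show "u f y p t = u g y p t"
        proof (cases "c y p t")
          case (Some b)
          have "(y, k) \<in> \<sigma>" using y unfolding under_def by blast
          then have bk: "b \<in> underS \<sigma> k" by (rule underS_le_trans[OF \<sigma>wo c1[OF Some]])
          have "f ` underS \<sigma> b = g ` underS \<sigma> b"
            by (rule image_cong[OF refl fg]) (rule underS_trans[OF \<sigma>wo _ bk])
          then show ?thesis unfolding u_def Some lim_def by simp
        qed (simp add: u_def)
      qed
      then have "(\<lambda>(y, p). \<beta>' (u f y p)) ` (under \<sigma> k \<times> Q) = (\<lambda>(y, p). \<beta>' (u g y p)) ` (under \<sigma> k \<times> Q)"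
        by (intro image_cong[OF refl]) auto
      moreover have "f ` underS \<sigma> k = g ` underS \<sigma> k" by (rule image_cong[OF refl fg])
      ultimately show "G f k = G g k" unfolding G_def by simp
    next
      fix f :: "'t set set \<Rightarrow> 'l" and k
      assume f: "\<And>z. z \<in> underS \<sigma> k \<Longrightarrow> f z \<in> Field r"
      have 1: "|f ` underS \<sigma> k| <o r"
        by (rule card_image_ordLess[OF card_subset_ordLess[OF Order_Relation.underS_Field \<sigma>F]])
      have "|under \<sigma> k| \<le>o \<sigma>"
        by (rule ordLeq_transitive[OF card_of_mono1[OF under_Field] card_of_Field_leq[OF \<sigma>c ordLeq_refl[OF \<sigma>c]]])
      then have "|under \<sigma> k \<times> Q| \<le>o \<sigma>"
        by (rule card_Times_ordLeq[OF \<sigma>(1) _ ordLess_imp_ordLeq[OF ordLeq_ordLess_trans[OF Q\<mu> \<mu>\<sigma>]]])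
      then have "|under \<sigma> k \<times> Q| <o r" by (rule ordLeq_ordLess_trans[OF _ \<sigma>r])
      then have 2: "|(\<lambda>(y, p). \<beta>' (u f y p)) ` (under \<sigma> k \<times> Q)| <o r" by (rule card_image_ordLess)
      have "G f k \<subseteq> Field r" unfolding G_def using f \<beta>'F by auto
      then show "G f k \<subseteq> Field r \<and> |G f k| <o r"
        unfolding G_def using card_Un_ordLess[OF r(1) 1 2] by blast
    qed
    then obtain \<xi> where \<xi>: "\<forall>k\<in>Field \<sigma>. \<xi> k \<in> Field r \<and> G \<xi> k \<subseteq> underS r (\<xi> k)" ..
    have \<xi>F: "\<xi> k \<in> Field r" if "k \<in> Field \<sigma>" for k using \<xi> that by blast
    have \<xi>lt: "\<xi> l \<in> underS r (\<xi> k)" if "l \<in> underS \<sigma> k" for k l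
      using \<xi> underS_Field_right[OF that] that unfolding G_def by blast
    have "\<xi> ` Field \<sigma> \<subseteq> Field r" using \<xi>F by blast
    then obtain b where b: "b \<in> Field r" "\<xi> ` Field \<sigma> \<subseteq> underS r b"
      by (rule regularCard_bound[OF r _ card_image_ordLess[OF \<sigma>F]])
    define \<delta> where "\<delta> = ssup r (\<xi> ` Field \<sigma>)"
    note \<delta>_props = ssup[OF rwo b, folded \<delta>_def]
    have "adm \<xi> \<delta>" unfolding adm_def using \<xi>F \<xi>lt \<delta>_def by blast
    then have \<delta>\<Delta>: "\<delta> \<in> \<Delta>" unfolding \<Delta>_def using \<delta>_props(1) by blast
    note ad = e[OF \<delta>\<Delta>]
    have eF: "e \<delta> k \<in> Field r" if "k \<in> Field \<sigma>" for k using ad that unfolding adm_def by blast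
    have elt: "e \<delta> l \<in> underS r (e \<delta> k)" if "l \<in> underS \<sigma> k" for k l using ad that unfolding adm_def by blast
    have e\<delta>: "\<delta> = ssup r (e \<delta> ` Field \<sigma>)" using ad unfolding adm_def by blast
    have "e \<delta> ` Field \<sigma> \<subseteq> Field r" using eF by blast
    then obtain b' where b': "b' \<in> Field r" "e \<delta> ` Field \<sigma> \<subseteq> underS r b'"
      by (rule regularCard_bound[OF r _ card_image_ordLess[OF \<sigma>F]])
    note e_props = ssup[OF rwo b', folded e\<delta>]
    have beyond: "\<exists>l\<in>Field \<sigma>. (v, f l) \<in> r"
      if f: "\<And>k. k \<in> Field \<sigma> \<Longrightarrow> f k \<in> Field r"
        and least: "\<And>w. w \<in> Field r \<Longrightarrow> f ` Field \<sigma> \<subseteq> underS r w \<Longrightarrow> (\<delta>, w) \<in> r"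
        and v: "v \<in> underS r \<delta>" for f v
    proof (rule ccontr)
      assume no: "\<not> (\<exists>l\<in>Field \<sigma>. (v, f l) \<in> r)"
      have vF: "v \<in> Field r" by (rule underS_Field_left[OF v])
      have "f ` Field \<sigma> \<subseteq> underS r v" using no not_underS_iff[OF rwo f vF] by blast
      then have "(\<delta>, v) \<in> r" by (rule least[OF vF])
      then show False using underS_le_trans[OF rwo v] underS_irrefl by fast
    qed
    \<comment> \<open>Both sequences are cofinal in \<delta>, so each overtakes the other. Below a
      closure point of the resulting \<phi> they have the same strict bounds, hence the same
      supremum.\<close>
    have "\<forall>k\<in>Field \<sigma>. \<exists>l. l \<in> Field \<sigma> \<and> (\<xi> k, e \<delta> l) \<in> r \<and> (e \<delta> k, \<xi> l) \<in> r"
    proof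
      fix k assume k: "k \<in> Field \<sigma>"
      have "\<xi> k \<in> underS r \<delta>" "e \<delta> k \<in> underS r \<delta>" using \<delta>_props(2) e_props(2) k by blast+
      then obtain l m where l: "l \<in> Field \<sigma>" "(\<xi> k, e \<delta> l) \<in> r" and m: "m \<in> Field \<sigma>" "(e \<delta> k, \<xi> m) \<in> r"
        using beyond[of "e \<delta>" "\<xi> k", OF eF e_props(3)] beyond[of \<xi> "e \<delta> k", OF \<xi>F \<delta>_props(3)] by blast
      consider "l \<in> underS \<sigma> m" | "l = m" | "m \<in> underS \<sigma> l" using underS_linear[OF \<sigma>wo l(1) m(1)] by blast
      then show "\<exists>l. l \<in> Field \<sigma> \<and> (\<xi> k, e \<delta> l) \<in> r \<and> (e \<delta> k, \<xi> l) \<in> r"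
      proof cases
        case 1
        then have "(\<xi> k, e \<delta> m) \<in> r" using wo_le_trans[OF rwo l(2) underS_imp_le[OF elt]] by blast
        then show ?thesis using m by blast
      next
        case 2
        then show ?thesis using l m by blast
      next
        case 3
        then have "(e \<delta> k, \<xi> l) \<in> r" using wo_le_trans[OF rwo m(2) underS_imp_le[OF \<xi>lt]] by blast
        then show ?thesis using l by blast
      qed
    qed
    from bchoice[OF this] obtain \<phi> where
      \<phi>: "\<forall>k\<in>Field \<sigma>. \<phi> k \<in> Field \<sigma> \<and> (\<xi> k, e \<delta> (\<phi> k)) \<in> r \<and> (e \<delta> k, \<xi> (\<phi> k)) \<in> r" ..
    have agree: "lim (e \<delta>) k = lim \<xi> k" if k: "k \<in> closure_points \<sigma> \<phi>" for k
    proof -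
      have clos: "\<phi> l \<in> underS \<sigma> k" if "l \<in> underS \<sigma> k" for l
        using k that unfolding closure_points_def by blast
      have "e \<delta> ` underS \<sigma> k \<subseteq> underS r w \<longleftrightarrow> \<xi> ` underS \<sigma> k \<subseteq> underS r w" for w
      proof
        assume w: "e \<delta> ` underS \<sigma> k \<subseteq> underS r w"
        show "\<xi> ` underS \<sigma> k \<subseteq> underS r w"
        proof (rule image_subsetI)
          fix l assume l: "l \<in> underS \<sigma> k"
          have "e \<delta> (\<phi> l) \<in> underS r w" using w clos[OF l] by blast
          moreover have "(\<xi> l, e \<delta> (\<phi> l)) \<in> r" using \<phi> underS_Field_left[OF l] by blast
          ultimately show "\<xi> l \<in> underS r w" using le_underS_trans[OF rwo] by blast
        qed
      next
        assume w: "\<xi> ` underS \<sigma> k \<subseteq> underS r w"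
        show "e \<delta> ` underS \<sigma> k \<subseteq> underS r w"
        proof (rule image_subsetI)
          fix l assume l: "l \<in> underS \<sigma> k"
          have "\<xi> (\<phi> l) \<in> underS r w" using w clos[OF l] by blast
          moreover have "(e \<delta> l, \<xi> (\<phi> l)) \<in> r" using \<phi> underS_Field_left[OF l] by blast
          ultimately show "e \<delta> l \<in> underS r w" using le_underS_trans[OF rwo] by blast
        qed
      qed
      then show ?thesis unfolding lim_def ssup_def by simp
    qed
    have "guesses \<theta> \<sigma> Q s \<psi> \<phi>" using \<psi> \<phi> by blast
    then obtain p x y j where p: "p \<in> Q" and g: "\<forall>\<epsilon>\<in>Field \<theta>. j \<epsilon> \<in> Field \<theta> \<and>
      x \<epsilon> \<in> closure_points \<sigma> \<phi> \<and> y \<epsilon> \<in> underS \<sigma> (x \<epsilon>) \<and>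
      (\<forall>t b. s (y \<epsilon>) p t = Some b \<longrightarrow> last_point \<sigma> \<psi> b \<in> closure_points \<sigma> \<phi>) \<and>
      (\<forall>\<zeta>\<in>underS \<theta> \<epsilon>. s (y \<epsilon>) p (j \<zeta>) = Some (x \<zeta>) \<and> last_point \<sigma> \<psi> (x \<zeta>) = x \<zeta>)"
      unfolding guesses_def by (elim bexE exE)
    show "\<exists>x j. \<forall>\<epsilon>\<in>Field \<theta>. x \<epsilon> \<in> Field r \<and> j \<epsilon> \<in> Field \<theta> \<and>
      (\<exists>w\<in>S. \<beta> w \<in> underS r (x \<epsilon>) \<and> (\<forall>\<zeta>\<in>underS \<theta> \<epsilon>. w (j \<zeta>) = Some (x \<zeta>)))"
    proof (intro exI[of _ "\<lambda>\<epsilon>. lim \<xi> (x \<epsilon>)"] exI[of _ j] ballI conjI)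
      fix \<epsilon> assume e: "\<epsilon> \<in> Field \<theta>"
      have ge: "j \<epsilon> \<in> Field \<theta>" "x \<epsilon> \<in> closure_points \<sigma> \<phi>" "y \<epsilon> \<in> underS \<sigma> (x \<epsilon>)"
        "\<And>t b. s (y \<epsilon>) p t = Some b \<Longrightarrow> last_point \<sigma> \<psi> b \<in> closure_points \<sigma> \<phi>"
        "\<And>\<zeta>. \<zeta> \<in> underS \<theta> \<epsilon> \<Longrightarrow> s (y \<epsilon>) p (j \<zeta>) = Some (x \<zeta>) \<and> last_point \<sigma> \<psi> (x \<zeta>) = x \<zeta>"
        using g e by blast+
      show "j \<epsilon> \<in> Field \<theta>" by (rule ge(1))
      have \<xi>F': "\<xi> l \<in> Field r" if "l \<in> underS \<sigma> (x \<epsilon>)" for l by (rule \<xi>F[OF underS_Field_left[OF that]])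
      show "lim \<xi> (x \<epsilon>) \<in> Field r" by (rule lim_props(1)[of "x \<epsilon>" \<xi>, OF \<xi>F'])
      have yF: "y \<epsilon> \<in> Field \<sigma>" by (rule underS_Field_left[OF ge(3)])
      \<comment> \<open>The supplied map, built from \<open>e \<delta>\<close> in advance, equals
        the one built from \<xi> at every label, so \<xi> has already escaped its challenge.\<close>
      have eq: "u (e \<delta>) (y \<epsilon>) p = u \<xi> (y \<epsilon>) p"
      proof
        fix t
        show "u (e \<delta>) (y \<epsilon>) p t = u \<xi> (y \<epsilon>) p t"
          using agree[OF ge(4)] unfolding u_def c_def by (cases "s (y \<epsilon>) p t") simp_all
      qed
      have uS: "u (e \<delta>) (y \<epsilon>) p \<in> S"
        unfolding S_def using \<delta>\<Delta> yF p by (intro image_eqI[of _ _ "(\<delta>, y \<epsilon>, p)"]) simp_all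
      show "\<exists>w\<in>S. \<beta> w \<in> underS r (lim \<xi> (x \<epsilon>)) \<and> (\<forall>\<zeta>\<in>underS \<theta> \<epsilon>. w (j \<zeta>) = Some (lim \<xi> (x \<zeta>)))"
      proof (rule bexI[OF _ uS], intro conjI ballI)
        have "y \<epsilon> \<in> under \<sigma> (y \<epsilon>)" unfolding under_def using wo_le_refl[OF \<sigma>wo yF] by simp
        then have "\<beta>' (u \<xi> (y \<epsilon>) p) \<in> G \<xi> (y \<epsilon>)"
          unfolding G_def using p by (intro UnI2 image_eqI[of _ _ "(y \<epsilon>, p)"]) simp_all
        then have "\<beta>' (u \<xi> (y \<epsilon>) p) \<in> underS r (\<xi> (y \<epsilon>))" using \<xi> yF by blast
        moreover have "\<beta>' (u \<xi> (y \<epsilon>) p) = \<beta> (u (e \<delta>) (y \<epsilon>) p)" unfolding \<beta>'_def using uS eq by simp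
        ultimately have "\<beta> (u (e \<delta>) (y \<epsilon>) p) \<in> underS r (\<xi> (y \<epsilon>))" by simp
        moreover have "\<xi> (y \<epsilon>) \<in> underS r (lim \<xi> (x \<epsilon>))" using lim_props(2)[of "x \<epsilon>" \<xi>, OF \<xi>F'] ge(3) by blast
        ultimately show "\<beta> (u (e \<delta>) (y \<epsilon>) p) \<in> underS r (lim \<xi> (x \<epsilon>))" by (rule underS_trans[OF rwo])
        fix \<zeta> assume z: "\<zeta> \<in> underS \<theta> \<epsilon>"
        show "u (e \<delta>) (y \<epsilon>) p (j \<zeta>) = Some (lim \<xi> (x \<zeta>))"
          unfolding eq unfolding u_def c_def using ge(5)[OF z] by simp
      qed
    qed
  qed
qed

text \<open>Finite \<theta> is treated apart because its successors are finite and carry no clubs.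
  At the double successor itself the square family suffices; beyond it club guessing is
  required.\<close>

lemma guessing_double_successor:
  assumes theta: "Card_order \<theta>" and r: "Cinfinite r" "regularCard r" and le: "cardSuc (cardSuc \<theta>) \<le>o r"
  shows "guessing \<theta> r"
proof (cases "finite (Field \<theta>)")
  case True
  then show ?thesis by (rule guessing_finite[OF Card_order_imp_Well_order[OF theta] _ r(1)])
next
  case inf: False
  let ?\<mu> = "cardSuc \<theta>"
  let ?\<sigma> = "cardSuc ?\<mu>"
  note \<mu> = infinite_cardSuc[OF theta inf]
  have \<mu>c: "Card_order ?\<mu>" and \<mu>inf: "infinite (Field ?\<mu>)" using \<mu>(1) unfolding cinfinite_def by blast+
  note \<sigma> = infinite_cardSuc[OF \<mu>c \<mu>inf]
  show ?thesis
  proof (cases "?\<sigma> <o r")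
    case True
    then show ?thesis by (rule guessing_large[OF theta inf r])
  next
    case False
    then have iso: "?\<sigma> =o r" using le ordLeq_iff_ordLess_or_ordIso by blast
    obtain s where s: "square_family \<theta> ?\<sigma> (Field ?\<mu> \<times> Field ?\<mu>) s"
      using square_family_exists[OF theta inf] by blast
    have Q: "|Field ?\<mu> \<times> Field ?\<mu>| <o ?\<sigma>"
      by (rule ordLeq_ordLess_trans[OF card_Times_ordLeq[OF \<mu>(1)] cardSuc_greater[OF \<mu>c]];
        rule card_of_Field_leq[OF \<mu>c ordLeq_refl[OF \<mu>c]])
    have "\<theta> <o ?\<sigma>"
      by (rule ordLess_transitive[OF cardSuc_greater[OF theta] cardSuc_greater[OF \<mu>c]])
    then have "guessing \<theta> ?\<sigma>" by (rule square_guessing[OF theta inf \<sigma>(1,2) _ Q s])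
    then show ?thesis by (rule guessing_ordIso[OF _ iso])
  qed
qed


theorem claim2p12:
  fixes \<kappa> :: "'k rel" and lam :: "'k \<Rightarrow> 'a rel" and I :: "'k set set" and \<theta> :: "'t rel"
  assumes kappa: "Cinfinite \<kappa>"
    and lam: "\<And>i. i \<in> Field \<kappa> \<Longrightarrow> Cinfinite (lam i) \<and> regularCard (lam i)"
    and ideal: "proper_ideal_on (Field \<kappa>) I"
    and theta: "Card_order \<theta>"
  shows
    "(star_condition (Field \<kappa>) I lam \<theta> \<longrightarrow> weak_pcf_th (Field \<kappa>) I lam (cardSuc \<theta>)) \<and>
     (star_condition (Field \<kappa>) I lam \<theta> \<and>
        (directed_card (card_prod (Field \<kappa>) lam) (less_mod (Field \<kappa>) lam I)
            (cardSuc (cardSuc \<theta>)) \<or>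
         (\<exists>a. continuity_condition (cardSuc \<theta>) \<theta> a)) \<longrightarrow>
        pcf_th (Field \<kappa>) I lam (cardSuc \<theta>)) \<and>
     (cardSuc \<theta> <o min_card (Field \<kappa>) lam \<longrightarrow>
        directed_card (card_prod (Field \<kappa>) lam) (less_mod (Field \<kappa>) lam I)
            (cardSuc (cardSuc \<theta>))) \<and>
     (pcf_th (Field \<kappa>) I lam \<theta> \<longrightarrow> weak_pcf_th (Field \<kappa>) I lam \<theta>) \<and>
     (weak_pcf_th (Field \<kappa>) I lam \<theta> \<longrightarrow> weaker_pcf_th (Field \<kappa>) I lam \<theta>) \<and>
     (weaker_pcf_th (Field \<kappa>) I lam \<theta> \<longrightarrow> weakest_pcf_th (Field \<kappa>) I lam \<theta>)"
proof -
  interpret reduced_product "Field \<kappa>" lam I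
    by unfold_locales (use lam ideal in blast)+
  note sc = cardSuc_Card_order[OF theta]
  have weak: "weak_pcf_th (Field \<kappa>) I lam (cardSuc \<theta>)" if "star_condition (Field \<kappa>) I lam \<theta>"
  proof -
    from star_condition_abstract[OF theta that]
    obtain H where "weakly_saturated_product (Field \<kappa>) lam I \<theta> H" by blast
    then show ?thesis by (rule weakly_saturated_product.weak_pcf)
  qed
  have strong: "pcf_th (Field \<kappa>) I lam (cardSuc \<theta>)"
    if star: "star_condition (Field \<kappa>) I lam \<theta>"
      and cases: "directed_card (card_prod (Field \<kappa>) lam) (less_mod (Field \<kappa>) lam I) (cardSuc (cardSuc \<theta>)) \<or>
        (\<exists>a. continuity_condition (cardSuc \<theta>) \<theta> a)"
  proof -
    obtain H where H: "weakly_saturated_product (Field \<kappa>) lam I \<theta> H"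
      using star_condition_abstract[OF theta star] by blast
    interpret weakly_saturated_product "Field \<kappa>" lam I \<theta> H by (rule H)
    show ?thesis
    proof (rule pcf_generators)
      fix l assume l: "l \<in> pcf (Field \<kappa>) I lam"
      note linf = pcf_Cinfinite[OF l] and lreg = pcf_regular[OF l]
      have lc: "Card_order l" using linf by blast
      have ge: "cardSuc \<theta> \<le>o l" by (rule cardSuc_least[OF theta lc theta_less_pcf[OF l]])
      obtain D where D: "D \<in> U" "l = tcfU D" using l unfolding pcf_iff by blast
      \<comment> \<open>Only the cofinality \<open>cardSuc \<theta>\<close> lies outside the general
        guessing result: it is served by the continuity condition, or ruled out by
        directedness.\<close>
      have "cardSuc (cardSuc \<theta>) \<le>o l \<or> (cardSuc \<theta> =o l \<and> (\<exists>a. continuity_condition (cardSuc \<theta>) \<theta> a))"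
      proof (cases "\<exists>a. continuity_condition (cardSuc \<theta>) \<theta> a")
        case True
        then show ?thesis
          using ge cardSuc_least[OF sc lc] ordLeq_iff_ordLess_or_ordIso by blast
      next
        case False
        then have "directed_card P (less_mod (Field \<kappa>) lam I) (cardSuc (cardSuc \<theta>))" using cases by blast
        then have "cardSuc (cardSuc \<theta>) \<le>o tcfU D"
          using directed_tcf[OF D(1) _ _ cardSuc_Card_order[OF sc]] D(1) unfolding U_def by blast
        then show ?thesis using D(2) by blast
      qed
      then show "guessing \<theta> l"
      proof
        assume "cardSuc (cardSuc \<theta>) \<le>o l"
        then show ?thesis by (rule guessing_double_successor[OF theta linf lreg])
      next
        assume "cardSuc \<theta> =o l \<and> (\<exists>a. continuity_condition (cardSuc \<theta>) \<theta> a)"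
        then obtain a where a: "cardSuc \<theta> =o l" "continuity_condition (cardSuc \<theta>) \<theta> a" by blast
        show ?thesis by (rule guessing_ordIso[OF continuity_guessing[OF theta a(2)] a(1)])
      qed
    qed
  qed
  show ?thesis
    using weak strong less_min_card_directed[OF sc] pcf_imp_weak_pcf
      weak_pcf_imp_weaker_pcf[OF theta] unfolding weaker_pcf_th_def by blast
qed

end
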